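(* Let $m>n\geq 1$, let $\Lambda\subset\mathbb R^n$ be a Delone, Bohr almost periodic set of toral type, with associated toral compactification $(\mathbb T^m,\psi)$ of $\mathbb R^n$, $\psi=\rho_m\circ M$, where $M\in\mathbb R^{m\times n}$ satisfies $M^TM=I_n$. Let $K:=\overline{\psi(\Lambda)}\subset\mathbb T^m$ and let $K_c$ be a connected component of $K$. Then $K_c$ is homeomorphic to $\mathbb T^{m-n}$, and the homomorphism $\pi_1(i):\pi_1(K_c)\rightarrow\pi_1(\mathbb T^m)=\mathbb Z^m$ induced on fundamental groups by the inclusion map $i:K_c\rightarrow\mathbb T^m$ is injective.
   Context: Notation. $\mathbb T=\{z\in\mathbb C:|z|=1\}$. $\rho_m:\mathbb R^m\to\mathbb T^m$ is $\rho_m([x_1,\dots,x_m]^T)=[e^{2\pi i x_1},\dots,e^{2\pi i x_m}]^T$. For $y\in\mathbb R^n$, $\chi_y(x)=e^{2\pi i y^Tx}$. $U(\mathbb R^n)$ (Bohr almost periodic functions) is the sup-norm closure of $\mathrm{span}\{\chi_y:y\in\mathbb R^n\}$ in the bounded continuous functions $\mathbb R^n\to\mathbb C$. $B(x,R)$ is the open ball and $V_n(R)$ is the volume of $B(0,R)\subset\mathbb R^n$. Delone: $\Lambda\subset\mathbb R^n$ is Delone if $R_1(\Lambda):=\inf\{\|\lambda_2-\lambda_1\|:\lambda_1\ne\lambda_2\in\Lambda\}>0$ and there is a finite $R$ with $\bigcup_{\lambda\in\Lambda}B(\lambda,R)=\mathbb R^n$. Bohr almost periodic: with $\mu:=\sum_{\lambda\in\Lambda}\delta_\lambda$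 and $(\mu*f)(x)=\sum_{\lambda\in\Lambda}f(x-\lambda)$, $\Lambda$ is Bohr almost periodic if $\mu*f\in U(\mathbb R^n)$ for every $f\in C_c(\mathbb R^n)$. Toral type: for such $\Lambda$ the spectrum $\Omega(\mu)$ is the set of $y\in\mathbb R^n$ for which $\widehat\mu(y):=\lim_{R\to\infty}V_n(R)^{-1}\sum_{\lambda\in\Lambda\cap B(0,R)}\chi_{-y}(\lambda)\neq 0$. $\Lambda$ is of toral type if $\Omega(\mu)$ generates a subgroup of $\mathbb R^n$ of finite rank $m$. Toral compactification: a pair $(\mathbb T^m,\psi)$ with $\psi:\mathbb R^n\to\mathbb T^m$ a continuous homomorphism with dense image; then $\psi=\rho_m\circ M$ for a matrix $M\in\mathbb R^{m\times n}$ whose rows are linearly independent over $\mathbb Q$. It is associated with $\Lambda$ if $\Omega(\mu)\subset M^T\mathbb Z^m$; equivalently (for Bohr almost periodic $\Lambda$), for each $f\in C_c(\mathbb R^n)$ there is a continuous $\Theta f:\mathbb T^m\to\mathbb C$ with $(\Theta f)\circ\psi=\mu*f$. *)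

theory Defs
  imports
    "HOL-Analysis.Analysis"
    "HOL-Algebra.Group"
    "HOL-Computational_Algebra.Group_Closure"
begin

section \<open>Tori and characters\<close>

definition torus :: "(complex ^ 'm) set"
  where "torus = {z. \<forall>i. norm (z $ i) = 1}"

text \<open>The \<open>k\<close>-dimensional torus as a topological space, for a number \<open>k\<close> that need not be
  the cardinality of a given type.\<close>

definition torus_space :: "nat \<Rightarrow> (nat \<Rightarrow> complex) topology"
  where "torus_space k = product_topology (\<lambda>_. top_of_set (sphere 0 1)) {..<k}"

definition rho :: "real ^ 'm \<Rightarrow> complex ^ 'm"
  where "rho x = (\<chi> i. exp (2 * pi * \<i> * complex_of_real (x $ i)))"

definition character :: "real ^ 'n \<Rightarrow> real ^ 'n \<Rightarrow> complex"
  where "character y x = exp (2 * pi * \<i> * complex_of_real (y \<bullet> x))"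

section \<open>Bohr almost periodic functions\<close>

text \<open>The complex linear span of the characters. It is written out since the library's
  \<^const>\<open>span\<close> is the real span.\<close>

definition trig_polys :: "(real ^ 'n \<Rightarrow> complex) set"
  where "trig_polys = {p. \<exists>Y c. finite Y \<and> p = (\<lambda>x. \<Sum>y\<in>Y. c y * character y x)}"

text \<open>The type of bounded continuous functions carries the sup metric, so the closure below is the
  one in the sup norm.\<close>

definition almost_periodic_funs :: "(real ^ 'n \<Rightarrow> complex) set"
  where "almost_periodic_funs =
    apply_bcontfun ` closure {p :: (real ^ 'n) \<Rightarrow>\<^sub>C complex. apply_bcontfun p \<in> trig_polys}"

definition compactly_supported :: "(real ^ 'n \<Rightarrow> complex) set"
  where "compactly_supported = {f. continuous_on UNIV f \<and> compact (closure {x. f x \<noteq> 0})}"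

section \<open>Delone sets, Bohr almost periodic sets and the spectrum\<close>

definition min_separation :: "(real ^ 'n) set \<Rightarrow> real"
  where "min_separation \<Lambda> = Inf {norm (b - a) | a b. a \<in> \<Lambda> \<and> b \<in> \<Lambda> \<and> a \<noteq> b}"

text \<open>The covering condition forces \<open>\<Lambda>\<close> to be infinite, so the infimum is never that of
  the empty set.\<close>

definition delone :: "(real ^ 'n) set \<Rightarrow> bool"
  where "delone \<Lambda> \<longleftrightarrow>
    min_separation \<Lambda> > 0 \<and> (\<exists>R::real. (\<Union>a\<in>\<Lambda>. ball a R) = UNIV)"

text \<open>For a Delone set and a compactly supported function the sum below has only finitely many
  nonzero terms for each \<open>x\<close>.\<close>

definition conv_counting :: "(real ^ 'n) set \<Rightarrow> (real ^ 'n \<Rightarrow> complex) \<Rightarrow> real ^ 'n \<Rightarrow> complex"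
  where "conv_counting \<Lambda> f x = (\<Sum>\<^sub>\<infinity>a\<in>\<Lambda>. f (x - a))"

definition bohr_almost_periodic :: "(real ^ 'n) set \<Rightarrow> bool"
  where "bohr_almost_periodic \<Lambda> \<longleftrightarrow>
    (\<forall>f\<in>compactly_supported. conv_counting \<Lambda> f \<in> almost_periodic_funs)"

text \<open>The mean of \<open>character (- y)\<close> over \<open>\<Lambda>\<close>. Membership in the spectrum includes existence of
  the limit, which for Bohr almost periodic Delone sets is automatic.\<close>

definition has_fourier_coeff :: "(real ^ 'n) set \<Rightarrow> real ^ 'n \<Rightarrow> complex \<Rightarrow> bool"
  where "has_fourier_coeff \<Lambda> y c \<longleftrightarrow>
    ((\<lambda>R::real. (\<Sum>a\<in>\<Lambda> \<inter> ball 0 R. character (- y) a) /\<^sub>R measure lborel (ball (0 :: real ^ 'n) R))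
       \<longlongrightarrow> c) at_top"

definition spectrum :: "(real ^ 'n) set \<Rightarrow> (real ^ 'n) set"
  where "spectrum \<Lambda> = {y. \<exists>c. has_fourier_coeff \<Lambda> y c \<and> c \<noteq> 0}"

text \<open>Rank of an additive subgroup: the maximal number of elements that are linearly independent
  over the integers.\<close>

abbreviation int_independent :: "(real ^ 'n) set \<Rightarrow> bool"
  where "int_independent \<equiv> module.independent (\<lambda>(k::int) v. of_int k *\<^sub>R v)"

definition has_rank :: "(real ^ 'n) set \<Rightarrow> nat \<Rightarrow> bool"
  where "has_rank G r \<longleftrightarrow>
    (\<exists>B\<subseteq>G. finite B \<and> card B = r \<and> int_independent B) \<and>
    (\<forall>B\<subseteq>G. int_independent B \<longrightarrow> finite B \<and> card B \<le> r)"

definition toral_type :: "(real ^ 'n) set \<Rightarrow> bool"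
  where "toral_type \<Lambda> \<longleftrightarrow> (\<exists>r. has_rank (group_closure (spectrum \<Lambda>)) r)"

section \<open>Toral compactifications\<close>

text \<open>Multiplication in \<^typ>\<open>complex ^ 'm\<close> is componentwise.\<close>

definition toral_compactification :: "(real ^ 'n \<Rightarrow> complex ^ 'm) \<Rightarrow> bool"
  where "toral_compactification \<psi> \<longleftrightarrow>
    continuous_on UNIV \<psi> \<and> \<psi> \<in> UNIV \<rightarrow> torus \<and> (\<forall>x y. \<psi> (x + y) = \<psi> x * \<psi> y) \<and>
    closure (range \<psi>) = torus"

text \<open>The compactification \<open>rho \<circ> M\<close> is associated with \<open>\<Lambda>\<close> if the spectrum
  of \<open>\<Lambda>\<close> lies in the image of the integer vectors under the transpose of \<open>M\<close>.\<close>

definition associated_with :: "real ^ 'n ^ 'm \<Rightarrow> (real ^ 'n) set \<Rightarrow> bool"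
  where "associated_with M \<Lambda> \<longleftrightarrow>
    spectrum \<Lambda> \<subseteq> {transpose M *v k | k. \<forall>i. k $ i \<in> \<int>}"

section \<open>The fundamental group\<close>

definition loops :: "'a::real_normed_vector set \<Rightarrow> 'a \<Rightarrow> (real \<Rightarrow> 'a) set"
  where "loops S a = {p. path p \<and> path_image p \<subseteq> S \<and> pathstart p = a \<and> pathfinish p = a}"

definition loop_rel :: "'a::real_normed_vector set \<Rightarrow> 'a \<Rightarrow> ((real \<Rightarrow> 'a) \<times> (real \<Rightarrow> 'a)) set"
  where "loop_rel S a = {(p, q). p \<in> loops S a \<and> q \<in> loops S a \<and> homotopic_paths S p q}"

definition fundamental_group :: "'a::real_normed_vector set \<Rightarrow> 'a \<Rightarrow> (real \<Rightarrow> 'a) set monoid"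
  where "fundamental_group S a =
    \<lparr>carrier = loops S a // loop_rel S a,
     monoid.mult = (\<lambda>A B. \<Union>p\<in>A. \<Union>q\<in>B. loop_rel S a `` {p +++ q}),
     one = loop_rel S a `` {linepath a a}\<rparr>"

text \<open>The map induced by a continuous \<open>f\<close> from \<open>S\<close> to \<open>T\<close>, sending the class of a loop \<open>p\<close> at \<open>a\<close>
  to the class of \<open>f \<circ> p\<close>.\<close>

definition fundamental_group_map ::
    "'b::real_normed_vector set \<Rightarrow> ('a::real_normed_vector \<Rightarrow> 'b) \<Rightarrow> 'a \<Rightarrow>
      (real \<Rightarrow> 'a) set \<Rightarrow> (real \<Rightarrow> 'b) set"
  where "fundamental_group_map T f a A = (\<Union>p\<in>A. loop_rel T (f a) `` {f \<circ> p})"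

lemma equiv_loop_rel: "equiv (loops S a) (loop_rel S a)"
proof (rule equivI)
  show "loop_rel S a \<subseteq> loops S a \<times> loops S a"
    by (auto simp: loop_rel_def)
  show "refl_on (loops S a) (loop_rel S a)"
    by (auto simp: refl_on_def loop_rel_def loops_def)
  show "sym (loop_rel S a)"
    by (auto simp: sym_def loop_rel_def intro: homotopic_paths_sym)
  show "trans (loop_rel S a)"
    by (auto simp: trans_def loop_rel_def intro: homotopic_paths_trans)
qed

lemma join_in_loops: "\<lbrakk>p \<in> loops S a; q \<in> loops S a\<rbrakk> \<Longrightarrow> p +++ q \<in> loops S a"
  by (auto simp: loops_def path_image_join)

lemma fundamental_group_mult:
  assumes "p \<in> loops S a" "q \<in> loops S a"
  shows "loop_rel S a `` {p} \<otimes>\<^bsub>fundamental_group S a\<^esub> loop_rel S a `` {q} =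
    loop_rel S a `` {p +++ q}"
proof -
  have "congruent2 (loop_rel S a) (loop_rel S a) (\<lambda>p q. loop_rel S a `` {p +++ q})"
  proof (rule congruent2I')
    fix p p' q q'
    assume "(p, p') \<in> loop_rel S a" "(q, q') \<in> loop_rel S a"
    then have l: "p \<in> loops S a" "p' \<in> loops S a" "q \<in> loops S a" "q' \<in> loops S a"
      and h: "homotopic_paths S p p'" "homotopic_paths S q q'"
      by (simp_all add: loop_rel_def)
    have "pathfinish p = pathstart q"
      using l by (simp add: loops_def)
    then have "homotopic_paths S (p +++ q) (p' +++ q')"
      by (rule homotopic_paths_join[OF h])
    then have "(p +++ q, p' +++ q') \<in> loop_rel S a"
      using l by (simp add: loop_rel_def join_in_loops)
    then show "loop_rel S a `` {p +++ q} = loop_rel S a `` {p' +++ q'}"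
      using equiv_class_eq[OF equiv_loop_rel] by blast
  qed
  from UN_equiv_class2[OF equiv_loop_rel equiv_loop_rel this assms] show ?thesis
    by (simp add: fundamental_group_def)
qed

lemma loop_class_eqI:
  assumes "homotopic_paths S p q" "p \<in> loops S a"
  shows "loop_rel S a `` {p} = loop_rel S a `` {q}"
proof (rule equiv_class_eq[OF equiv_loop_rel])
  have "q \<in> loops S a"
    using assms(2) homotopic_paths_imp_path[OF assms(1)] homotopic_paths_imp_subset[OF assms(1)]
      homotopic_paths_imp_pathstart[OF assms(1)] homotopic_paths_imp_pathfinish[OF assms(1)]
    by (simp add: loops_def)
  then show "(p, q) \<in> loop_rel S a"
    using assms by (simp add: loop_rel_def)
qed

lemma fundamental_group_carrierE:
  assumes "A \<in> carrier (fundamental_group S a)"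
  obtains p where "p \<in> loops S a" "A = loop_rel S a `` {p}"
  using assms by (auto simp: fundamental_group_def elim: quotientE)

lemma loop_class_in_carrier:
  "p \<in> loops S a \<Longrightarrow> loop_rel S a `` {p} \<in> carrier (fundamental_group S a)"
  by (auto simp: fundamental_group_def intro: quotientI)

lemma fundamental_group_one:
  "\<one>\<^bsub>fundamental_group S a\<^esub> = loop_rel S a `` {linepath a a}"
  by (simp add: fundamental_group_def)

lemma group_fundamental_group:
  assumes "a \<in> S"
  shows "group (fundamental_group S a)"
proof (rule groupI)
  let ?G = "fundamental_group S a"
  have const: "linepath a a \<in> loops S a"
    using assms by (auto simp: loops_def)
  show "\<one>\<^bsub>?G\<^esub> \<in> carrier ?G"
    unfolding fundamental_group_one by (rule loop_class_in_carrier[OF const])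
  fix x assume "x \<in> carrier ?G"
  then obtain p where p: "p \<in> loops S a" "x = loop_rel S a `` {p}"
    by (rule fundamental_group_carrierE)
  have "homotopic_paths S (linepath a a +++ p) p"
    using p(1) homotopic_paths_lid[of p S] by (auto simp: loops_def)
  then show "\<one>\<^bsub>?G\<^esub> \<otimes>\<^bsub>?G\<^esub> x = x"
    unfolding fundamental_group_one p(2) fundamental_group_mult[OF const p(1)]
    by (rule loop_class_eqI[OF _ join_in_loops[OF const p(1)]])
  have rev: "reversepath p \<in> loops S a"
    using p(1) by (auto simp: loops_def)
  have "homotopic_paths S (reversepath p +++ p) (linepath a a)"
    using p(1) homotopic_paths_linv[of p S] by (auto simp: loops_def)
  then have "loop_rel S a `` {reversepath p} \<otimes>\<^bsub>?G\<^esub> x = \<one>\<^bsub>?G\<^esub>"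
    unfolding fundamental_group_one p(2) fundamental_group_mult[OF rev p(1)]
    by (rule loop_class_eqI[OF _ join_in_loops[OF rev p(1)]])
  then show "\<exists>y\<in>carrier ?G. y \<otimes>\<^bsub>?G\<^esub> x = \<one>\<^bsub>?G\<^esub>"
    using loop_class_in_carrier[OF rev] by blast
  fix y assume "y \<in> carrier ?G"
  then obtain q where q: "q \<in> loops S a" "y = loop_rel S a `` {q}"
    by (rule fundamental_group_carrierE)
  show "x \<otimes>\<^bsub>?G\<^esub> y \<in> carrier ?G"
    unfolding p(2) q(2) fundamental_group_mult[OF p(1) q(1)]
    by (rule loop_class_in_carrier[OF join_in_loops[OF p(1) q(1)]])
  fix z assume "z \<in> carrier ?G"
  then obtain r where r: "r \<in> loops S a" "z = loop_rel S a `` {r}"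
    by (rule fundamental_group_carrierE)
  note pq = join_in_loops[OF p(1) q(1)] and qr = join_in_loops[OF q(1) r(1)]
  have "homotopic_paths S (p +++ (q +++ r)) ((p +++ q) +++ r)"
    using p(1) q(1) r(1) by (intro homotopic_paths_assoc) (auto simp: loops_def)
  then have "homotopic_paths S ((p +++ q) +++ r) (p +++ (q +++ r))"
    by (rule homotopic_paths_sym)
  then show "x \<otimes>\<^bsub>?G\<^esub> y \<otimes>\<^bsub>?G\<^esub> z = x \<otimes>\<^bsub>?G\<^esub> (y \<otimes>\<^bsub>?G\<^esub> z)"
    unfolding p(2) q(2) r(2) fundamental_group_mult[OF p(1) q(1)]
      fundamental_group_mult[OF q(1) r(1)] fundamental_group_mult[OF pq r(1)]
      fundamental_group_mult[OF p(1) qr]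
    by (rule loop_class_eqI[OF _ join_in_loops[OF pq r(1)]])
qed

lemma comp_in_loops:
  "\<lbrakk>p \<in> loops S a; continuous_on S f; f \<in> S \<rightarrow> T\<rbrakk> \<Longrightarrow> f \<circ> p \<in> loops T (f a)"
  by (auto simp: loops_def path_image_compose pathstart_compose pathfinish_compose
      intro!: path_continuous_image continuous_on_subset[of S f])

lemma fundamental_group_map_class:
  assumes "continuous_on S f" "f \<in> S \<rightarrow> T" "p \<in> loops S a"
  shows "fundamental_group_map T f a (loop_rel S a `` {p}) = loop_rel T (f a) `` {f \<circ> p}"
proof -
  have "congruent (loop_rel S a) (\<lambda>p. loop_rel T (f a) `` {f \<circ> p})"
    by (rule congruentI, rule loop_class_eqI)
      (use assms in \<open>auto simp: loop_rel_def intro: homotopic_paths_continuous_image comp_in_loops\<close>)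
  from UN_equiv_class[OF equiv_loop_rel this assms(3)] show ?thesis
    by (simp add: fundamental_group_map_def)
qed

lemma fundamental_group_map_hom:
  assumes "continuous_on S f" "f \<in> S \<rightarrow> T"
  shows "fundamental_group_map T f a \<in> hom (fundamental_group S a) (fundamental_group T (f a))"
proof (rule homI)
  fix x assume "x \<in> carrier (fundamental_group S a)"
  then obtain p where p: "p \<in> loops S a" "x = loop_rel S a `` {p}"
    by (rule fundamental_group_carrierE)
  note fp = comp_in_loops[OF p(1) assms]
  show "fundamental_group_map T f a x \<in> carrier (fundamental_group T (f a))"
    unfolding p(2) fundamental_group_map_class[OF assms p(1)] by (rule loop_class_in_carrier[OF fp])
  fix y assume "y \<in> carrier (fundamental_group S a)"
  then obtain q where q: "q \<in> loops S a" "y = loop_rel S a `` {q}"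
    by (rule fundamental_group_carrierE)
  note fq = comp_in_loops[OF q(1) assms]
  show "fundamental_group_map T f a (x \<otimes>\<^bsub>fundamental_group S a\<^esub> y) =
      fundamental_group_map T f a x \<otimes>\<^bsub>fundamental_group T (f a)\<^esub> fundamental_group_map T f a y"
    unfolding p(2) q(2) fundamental_group_mult[OF p(1) q(1)]
      fundamental_group_map_class[OF assms p(1)] fundamental_group_map_class[OF assms q(1)]
      fundamental_group_map_class[OF assms join_in_loops[OF p(1) q(1)]]
      fundamental_group_mult[OF fp fq] path_compose_join ..
qed

end

theory Submission
  imports Defs "HOL-Real_Asymp.Real_Asymp"
begin

text \<open>Let \<open>V\<close> be the orthogonal complement of the range of \<open>M\<close>, let \<open>Q\<close> be the orthogonal projection
  onto \<open>V\<close>, and let \<open>X\<close> be the preimage of \<open>K\<close> under \<open>rho\<close>. If \<open>M t\<close> is close to an integer vector, then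
  \<open>\<Lambda> + t\<close> is uniformly close to \<open>\<Lambda>\<close>: the convolution of \<open>\<Lambda>\<close> with a tent function is uniformly
  approximated by trigonometric polynomials, and averaging against Fejer kernels makes all their
  frequencies lie in the spectrum and hence in the group of the vectors \<open>M\<^sup>T k\<close> with \<open>k\<close> integral.
  As distinct points of \<open>\<Lambda>\<close> are uniformly separated, it follows that \<open>Q\<close> maps \<open>X\<close> onto \<open>V\<close> as a covering.
  Since \<open>V\<close> is simply connected, \<open>X\<close> is a disjoint union of graphs over \<open>V\<close>. So \<open>Kc\<close> is the image under
  \<open>rho\<close> of one such graph and thus the quotient of \<open>V\<close> by a discrete cocompact subgroup, which is a
  torus of dimension \<open>dim V\<close>. A loop in \<open>Kc\<close> lifts to a path in the graph; if the loop is
  null-homotopic in the torus, then the lifted path is closed and can be contracted in the graph.\<close>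

section \<open>Uniform coverings\<close>

text \<open>Bohr almost periodicity supplies trigonometric polynomials whose frequencies are
  uncontrolled, and for a general frequency \<open>y\<close> the closeness of \<open>M *v t\<close>
  to an integer vector says nothing about \<open>character y t\<close>. For
  \<open>y = transpose M *v l\<close> with \<open>l\<close> integral, however,
  \<open>y \<bullet> t = l \<bullet> (M *v t)\<close>, so that \<open>character y t\<close> is close
  to 1. This is why the frequencies have to be forced into that group. The points of
  \<open>X\<close> are only limits of points \<open>M *v a + k\<close> with \<open>a\<close> in
  \<open>\<Lambda>\<close> and \<open>k\<close> integral, so the covering property is obtained for
  such points with errors that tend to 0. If \<open>Q\<close> nearly identifies
  \<open>M *v a + k\<close> and \<open>M *v a' + k'\<close>, then \<open>Q (k' - k)\<close> is
  small, and \<open>t = transpose M *v (k' - k)\<close> is an almost period of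
  \<open>\<Lambda>\<close>. Neither \<open>X\<close> nor \<open>V\<close> is compact, so a local
  notion of covering gives no control at infinity. The notion below asks for constants that serve
  all points at once; they make sections uniformly continuous, and this in turn makes the image of a
  sheet clopen in \<open>K\<close>.\<close>

definition uniform_covering ::
    "'a::metric_space set \<Rightarrow> ('a \<Rightarrow> 'b::metric_space) \<Rightarrow> 'b set \<Rightarrow> bool"
  where "uniform_covering X p Y \<longleftrightarrow> continuous_on X p \<and> p ` X = Y \<and>
    (\<exists>r>0. \<forall>x\<in>X. \<forall>x'\<in>X. p x = p x' \<longrightarrow> dist x x' < r \<longrightarrow> x = x') \<and>
    (\<forall>e>0. \<exists>d>0. \<forall>x\<in>X. \<forall>y\<in>Y. dist (p x) y < d \<longrightarrow> (\<exists>x'\<in>X. p x' = y \<and> dist x x' < e))"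

lemma uniform_coveringE:
  assumes "uniform_covering X p Y"
  obtains r where "r > 0" "\<And>x x'. \<lbrakk>x \<in> X; x' \<in> X; p x = p x'; dist x x' < r\<rbrakk> \<Longrightarrow> x = x'"
  using assms unfolding uniform_covering_def by blast

lemma uniform_covering_liftE:
  assumes "uniform_covering X p Y" "e > 0"
  obtains d where "d > 0"
    "\<And>x y. \<lbrakk>x \<in> X; y \<in> Y; dist (p x) y < d\<rbrakk> \<Longrightarrow> \<exists>x'\<in>X. p x' = y \<and> dist x x' < e"
proof -
  have "\<exists>d>0. \<forall>x\<in>X. \<forall>y\<in>Y. dist (p x) y < d \<longrightarrow> (\<exists>x'\<in>X. p x' = y \<and> dist x x' < e)"
    using assms by (simp add: uniform_covering_def)
  then obtain d where d: "d > 0"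
    "\<forall>x\<in>X. \<forall>y\<in>Y. dist (p x) y < d \<longrightarrow> (\<exists>x'\<in>X. p x' = y \<and> dist x x' < e)"
    by auto
  show ?thesis
    by (rule that[OF d(1)], rule d(2)[rule_format])
qed

text \<open>The sheets over the ball of radius \<open>d\<close> around \<open>y0\<close> are cut out
  by balls of radius \<open>r / 4\<close> around the points of the fibre. Points of one sheet are
  less than \<open>r / 2\<close> apart, so \<open>p\<close> is injective there, and fibre points
  whose sheets meet are less than \<open>r\<close> apart and hence equal.\<close>

proposition uniform_covering_imp_covering_space:
  fixes p :: "'a::metric_space \<Rightarrow> 'b::metric_space"
  assumes cov: "uniform_covering X p Y"
  shows "covering_space X p Y"
proof
  show cont: "continuous_on X p" and surj: "p ` X = Y"
    using cov by (auto simp: uniform_covering_def)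
  obtain r where r: "r > 0" and inj: "\<And>x x'. \<lbrakk>x \<in> X; x' \<in> X; p x = p x'; dist x x' < r\<rbrakk> \<Longrightarrow> x = x'"
    by (fact uniform_coveringE[OF cov])
  fix y0 assume y0: "y0 \<in> Y"
  have r4: "r / 4 > 0"
    using r by simp
  obtain d where d: "d > 0"
    "\<And>x y. \<lbrakk>x \<in> X; y \<in> Y; dist (p x) y < d\<rbrakk> \<Longrightarrow> \<exists>x'\<in>X. p x' = y \<and> dist x x' < r / 4"
    by (fact uniform_covering_liftE[OF cov r4])
  define T where "T = Y \<inter> ball y0 d"
  define U where "U x0 = (X \<inter> p -` T) \<inter> ball x0 (r / 4)" for x0
  define F where "F = {x \<in> X. p x = y0}"
  have openT: "openin (top_of_set Y) T"
    by (simp add: T_def openin_open_Int)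
  have openP: "openin (top_of_set X) (X \<inter> p -` T)"
    using cont surj openT by (simp add: continuous_on_open)
  have close: "dist x x' < r / 2" if "x \<in> U x0" "x' \<in> U x0" for x x' x0
    using that dist_triangle2[of x x' x0] by (auto simp: U_def dist_commute)
  show "\<exists>T. y0 \<in> T \<and> openin (top_of_set Y) T \<and>
          (\<exists>v. \<Union>v = X \<inter> p -` T \<and> (\<forall>u\<in>v. openin (top_of_set X) u) \<and>
               pairwise disjnt v \<and> (\<forall>u\<in>v. \<exists>q. homeomorphism u T p q))"
  proof (intro exI[of _ T] conjI exI[of _ "U ` F"] ballI)
    show "y0 \<in> T"
      using y0 d(1) by (simp add: T_def)
    show "openin (top_of_set Y) T"
      by (rule openT)
    show "\<Union> (U ` F) = X \<inter> p -` T"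
    proof
      show "X \<inter> p -` T \<subseteq> \<Union> (U ` F)"
      proof
        fix x assume x: "x \<in> X \<inter> p -` T"
        then have "dist (p x) y0 < d"
          by (simp add: T_def dist_commute)
        then obtain x0 where "x0 \<in> X" "p x0 = y0" "dist x x0 < r / 4"
          using d(2) x y0 by blast
        then show "x \<in> \<Union> (U ` F)"
          using x by (auto simp: U_def F_def dist_commute)
      qed
    qed (auto simp: U_def)
    fix u assume "u \<in> U ` F"
    then obtain x0 where x0: "x0 \<in> X" "p x0 = y0" and u: "u = U x0"
      by (auto simp: F_def)
    show "openin (top_of_set X) u"
      unfolding u U_def using openP by (rule openin_Int_open) simp
    have injU: "inj_on p u"
    proof (rule inj_onI)
      fix x x' assume "x \<in> u" "x' \<in> u" "p x = p x'"
      then show "x = x'"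
        using close[of x x0 x'] r by (intro inj) (auto simp: u U_def)
    qed
    have "p ` u = T"
    proof
      show "T \<subseteq> p ` u"
      proof
        fix y assume y: "y \<in> T"
        then have "dist (p x0) y < d" "y \<in> Y"
          using x0 by (auto simp: T_def)
        then obtain x where "x \<in> X" "p x = y" "dist x0 x < r / 4"
          using d(2) x0 by blast
        then show "y \<in> p ` u"
          using y by (auto simp: u U_def)
      qed
    qed (auto simp: u U_def)
    define q where "q = inv_into u p"
    have q: "q y \<in> u" "p (q y) = y" if "y \<in> T" for y
      using that \<open>p ` u = T\<close> by (auto simp: q_def inv_into_into f_inv_into_f)
    have "continuous_on T q"
      unfolding continuous_on_iff
    proof (intro ballI allI impI)
      fix y and e :: real assume y: "y \<in> T" and e: "e > 0"
      \<comment> \<open>The lift of \<open>y'\<close> near \<open>q y\<close> is not known to lie in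
        \<open>u\<close>. Being within \<open>r / 2\<close> of \<open>q y\<close>, it is within
        \<open>r\<close> of \<open>q y'\<close>, and injectivity identifies the two.\<close>
      have er: "min e (r / 2) > 0"
        using r e by simp
      obtain d' where d': "d' > 0"
        "\<And>x y. \<lbrakk>x \<in> X; y \<in> Y; dist (p x) y < d'\<rbrakk> \<Longrightarrow> \<exists>x'\<in>X. p x' = y \<and> dist x x' < min e (r / 2)"
        by (fact uniform_covering_liftE[OF cov er])
      have "dist (q y') (q y) < e" if y': "y' \<in> T" "dist y' y < d'" for y'
      proof -
        have "q y \<in> X" "y' \<in> Y" "dist (p (q y)) y' < d'"
          using q[OF y] y' by (auto simp: T_def u U_def dist_commute)
        then obtain x where x: "x \<in> X" "p x = y'" "dist (q y) x < min e (r / 2)"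
          using d' by blast
        have "q y' = x"
        proof (rule inj)
          show "dist (q y') x < r"
            using close[of "q y'" x0 "q y"] q[OF y] q[OF y'(1)] x(3) dist_triangle[of "q y'" x "q y"]
            unfolding u by simp
        qed (use x q[OF y'(1)] in \<open>auto simp: u U_def\<close>)
        then show ?thesis
          using x by (simp add: dist_commute)
      qed
      then show "\<exists>d>0. \<forall>y'\<in>T. dist y' y < d \<longrightarrow> dist (q y') (q y) < e"
        using d'(1) by blast
    qed
    moreover have "continuous_on u p"
      using cont by (rule continuous_on_subset) (auto simp: u U_def)
    moreover have "q ` T \<subseteq> u"
      using q(1) by blast
    moreover have "q (p x) = x" if "x \<in> u" for x
      using that injU by (simp add: q_def)
    ultimately have "homeomorphism u T p q"
      unfolding homeomorphism_def using q(2) \<open>p ` u = T\<close> by force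
    then show "\<exists>q. homeomorphism u T p q"
      by blast
  next
    show "pairwise disjnt (U ` F)"
    proof (clarsimp simp: pairwise_def disjnt_def)
      fix x0 x1 assume x: "x0 \<in> F" "x1 \<in> F" "U x0 \<noteq> U x1"
      have False if "x \<in> U x0" "x \<in> U x1" for x
      proof -
        have "dist x0 x1 < r"
          using that r dist_triangle3[of x0 x1 x] by (auto simp: U_def dist_commute)
        then have "x0 = x1"
          using x inj by (auto simp: F_def)
        then show False
          using x by simp
      qed
      then show "U x0 \<inter> U x1 = {}"
        by blast
    qed
  qed
qed

text \<open>A lift near \<open>s y\<close> and within the injectivity radius of \<open>s z\<close> equals \<open>s z\<close>; by the intermediate value
  theorem on segments, \<open>s z\<close> cannot leave the range in which this applies.\<close>

lemma section_uniformly_continuous: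
  fixes Y :: "'b::real_normed_vector set"
  assumes cov: "uniform_covering X p Y" and "convex Y"
    and s: "continuous_on Y s" "s \<in> Y \<rightarrow> X" "\<And>y. y \<in> Y \<Longrightarrow> p (s y) = y"
  shows "uniformly_continuous_on Y s"
  unfolding uniformly_continuous_on_def
proof (intro allI impI)
  obtain r where r: "r > 0" and inj: "\<And>x x'. \<lbrakk>x \<in> X; x' \<in> X; p x = p x'; dist x x' < r\<rbrakk> \<Longrightarrow> x = x'"
    by (fact uniform_coveringE[OF cov])
  fix e0 :: real assume "e0 > 0"
  define e where "e = min e0 (r / 2)"
  have e: "e > 0" "e \<le> e0" "e \<le> r / 2"
    using \<open>e0 > 0\<close> r by (auto simp: e_def)
  obtain d where d: "d > 0"
    "\<And>x y. \<lbrakk>x \<in> X; y \<in> Y; dist (p x) y < d\<rbrakk> \<Longrightarrow> \<exists>x'\<in>X. p x' = y \<and> dist x x' < e"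
    by (fact uniform_covering_liftE[OF cov e(1)])
  have "dist (s y') (s y) < e" if y: "y \<in> Y" "y' \<in> Y" "dist y' y < d" for y y'
  proof (rule ccontr)
    assume far: "\<not> dist (s y') (s y) < e"
    have seg: "closed_segment y y' \<subseteq> Y"
      using y \<open>convex Y\<close> by (simp add: closed_segment_subset)
    let ?D = "(\<lambda>z. dist (s z) (s y)) ` closed_segment y y'"
    have "connected ?D"
      by (intro connected_continuous_image continuous_intros continuous_on_subset[OF s(1) seg]) simp
    moreover have "dist (s y) (s y) \<in> ?D" "dist (s y') (s y) \<in> ?D"
      by (rule imageI, simp)+
    ultimately have "e \<in> ?D"
      by (rule connectedD_interval) (use far e in auto)
    then obtain z where z: "z \<in> closed_segment y y'" "dist (s z) (s y) = e"
      by auto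
    then have zY: "z \<in> Y"
      using seg by auto
    have "dist z y \<le> dist y' y"
      using segment_bound1[OF z(1)] by (simp add: dist_norm)
    then have "dist (p (s y)) z < d"
      using y s(3) by (simp add: dist_commute)
    then obtain x where x: "x \<in> X" "p x = z" "dist (s y) x < e"
      using d(2)[of "s y" z] zY y s(2) by auto
    have "x = s z"
    proof (rule inj)
      show "dist x (s z) < r"
        using x(3) z(2) e dist_triangle[of x "s z" "s y"] by (simp add: dist_commute)
    qed (use x zY s in auto)
    then show False
      using x z by (simp add: dist_commute)
  qed
  then show "\<exists>d>0. \<forall>y\<in>Y. \<forall>y'\<in>Y. dist y' y < d \<longrightarrow> dist (s y') (s y) < e0"
    using d(1) e(2) by (meson order_less_le_trans)
qed

text \<open>Surjectivity comes for free: one radius \<open>d\<close> serves all points, so both the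
  image and its complement in \<open>Y\<close> are open, and \<open>Y\<close> is connected.\<close>

lemma uniform_covering_surjI:
  assumes cont: "continuous_on X p" and sub: "p ` X \<subseteq> Y" and "X \<noteq> {}" "connected Y"
    and inj: "\<exists>r>0. \<forall>x\<in>X. \<forall>x'\<in>X. p x = p x' \<longrightarrow> dist x x' < r \<longrightarrow> x = x'"
    and lift: "\<And>e. e > 0 \<Longrightarrow> \<exists>d>0. \<forall>x\<in>X. \<forall>y\<in>Y. dist (p x) y < d \<longrightarrow> (\<exists>x'\<in>X. p x' = y \<and> dist x x' < e)"
  shows "uniform_covering X p Y"
proof -
  obtain d where d: "d > 0" "\<And>x y. \<lbrakk>x \<in> X; y \<in> Y; dist (p x) y < d\<rbrakk> \<Longrightarrow> y \<in> p ` X"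
    using lift[OF zero_less_one] by blast
  have "openin (top_of_set Y) (p ` X)"
    unfolding openin_euclidean_subtopology_iff
    using sub d by (auto simp: dist_commute intro!: exI[of _ d])
  moreover have "openin (top_of_set Y) (Y - p ` X)"
    unfolding openin_euclidean_subtopology_iff
    using d by (auto simp: dist_commute intro!: exI[of _ d])
  then have "closedin (top_of_set Y) (p ` X)"
    using sub by (simp add: closedin_def)
  ultimately have "p ` X = Y"
    using \<open>connected Y\<close> \<open>X \<noteq> {}\<close> by (auto simp: connected_clopen)
  then show ?thesis
    using cont inj lift by (simp add: uniform_covering_def)
qed

lemma clopen_connected_eq_component:
  assumes "C \<in> components S" "connected T" "openin (top_of_set S) T" "closedin (top_of_set S) T" "C \<inter> T \<noteq> {}"
  shows "C = T"
proof
  show "T \<subseteq> C"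
    using assms closedin_imp_subset[OF assms(4)] by (intro components_maximal[of C S]) auto
  have "C \<subseteq> S"
    using assms(1) by (rule in_components_subset)
  then have "openin (top_of_set C) (C \<inter> T)" "closedin (top_of_set C) (C \<inter> T)"
    using assms(3,4) by (auto simp: closedin_closed openin_open)
  then show "C \<subseteq> T"
    using in_components_connected[OF assms(1)] assms(5) by (auto simp: connected_clopen)
qed

section \<open>The exponential covering of the torus\<close>

lemma exp_2pi_i_eq_iff:
  fixes a b :: real
  shows "exp (2 * pi * \<i> * complex_of_real a) = exp (2 * pi * \<i> * complex_of_real b) \<longleftrightarrow> a - b \<in> \<int>"
proof -
  have eq: "2 * pi * a = 2 * pi * b + of_int (2 * n) * pi \<longleftrightarrow> a - b = of_int n" for n :: int
  proof -
    have "2 * pi * a - (2 * pi * b + of_int (2 * n) * pi) = 2 * pi * (a - b - of_int n)"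
      by (simp add: algebra_simps)
    then show ?thesis
      by (metis eq_iff_diff_eq_0 mult_eq_0_iff pi_neq_zero zero_neq_numeral)
  qed
  have "exp (2 * pi * \<i> * complex_of_real a) = exp (2 * pi * \<i> * complex_of_real b) \<longleftrightarrow>
      (\<exists>n::int. 2 * pi * a = 2 * pi * b + of_int (2 * n) * pi)"
    unfolding exp_eq by (simp add: complex_eq_iff)
  then show ?thesis
    unfolding eq Ints_def image_def by blast
qed

lemma exp_2pi_i_Arg: "norm z = 1 \<Longrightarrow> exp (2 * pi * \<i> * complex_of_real (Arg z / (2 * pi))) = z"
  using Arg_eq[of z] by (cases "z = 0") auto

lemma rho_eq_iff: "rho x = rho y \<longleftrightarrow> (\<forall>i. (x - y) $ i \<in> \<int>)"
  by (simp add: rho_def vec_eq_iff exp_2pi_i_eq_iff del: of_real_mult)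

lemma rho_in_torus [simp]: "rho x \<in> torus"
  by (simp add: rho_def torus_def norm_exp_eq_Re)

lemma continuous_on_rho [continuous_intros]:
  "continuous_on S f \<Longrightarrow> continuous_on S (\<lambda>x. rho (f x))"
  unfolding rho_def by (intro continuous_intros)

text \<open>The argument of the quotient of two nearby points of the circle is small, because
  \<open>Arg\<close> is continuous at 1. Working with the quotient avoids the branch cut and makes
  \<open>d\<close> independent of \<open>t\<close>.\<close>

lemma circle_lift:
  assumes "e > 0"
  obtains d where "d > 0" "\<And>t z. \<lbrakk>norm z = 1; dist (exp (2 * pi * \<i> * complex_of_real t)) z < d\<rbrakk> \<Longrightarrow>
    \<exists>t'. exp (2 * pi * \<i> * complex_of_real t') = z \<and> \<bar>t' - t\<bar> < e"
proof -
  have "continuous (at 1) Arg"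
    by (rule continuous_at_Arg) simp
  then obtain d where d: "d > 0" "\<And>w. dist w 1 < d \<Longrightarrow> dist (Arg w) (Arg 1) < 2 * pi * e"
    unfolding continuous_at_eps_delta using assms pi_gt_zero by (metis dist_norm mult_pos_pos zero_less_numeral)
  show ?thesis
  proof (rule that[OF d(1)])
    fix t z assume z: "norm z = 1" "dist (exp (2 * pi * \<i> * complex_of_real t)) z < d"
    define u where "u = exp (2 * pi * \<i> * complex_of_real t)"
    have u: "norm u = 1" "u \<noteq> 0"
      by (simp_all add: u_def)
    have "dist (z / u) 1 = dist u z"
      using u norm_divide[of "z - u" u] by (simp add: dist_norm norm_minus_commute diff_divide_distrib)
    then have "\<bar>Arg (z / u)\<bar> < 2 * pi * e"
      using d(2)[of "z / u"] z(2) by (simp add: u_def dist_norm)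
    moreover have "exp (2 * pi * \<i> * complex_of_real (t + Arg (z / u) / (2 * pi))) = z"
    proof -
      have "exp (\<i> * complex_of_real (Arg (z / u))) = z / u"
        using Arg_eq[of "z / u"] u z(1) by (metis divide_eq_0_iff mult_1 norm_divide norm_zero of_real_1 zero_neq_one div_by_1)
      moreover have "2 * pi * \<i> * complex_of_real (t + Arg (z / u) / (2 * pi)) =
          2 * pi * \<i> * complex_of_real t + \<i> * complex_of_real (Arg (z / u))"
        by (simp add: field_simps)
      ultimately show ?thesis
        by (simp add: exp_add u_def)
    qed
    ultimately show "\<exists>t'. exp (2 * pi * \<i> * complex_of_real t') = z \<and> \<bar>t' - t\<bar> < e"
      by (intro exI[of _ "t + Arg (z / u) / (2 * pi)"]) (simp add: abs_divide field_simps)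
  qed
qed

lemma Ints_vec_norm_less_1:
  fixes k :: "real ^ 'm"
  assumes "\<And>i. k $ i \<in> \<int>" "norm k < 1"
  shows "k = 0"
proof -
  have "\<bar>k $ i\<bar> < 1" for i
    using component_le_norm_cart[of k i] assms(2) by linarith
  then show ?thesis
    using assms(1) by (simp add: vec_eq_iff Ints_eq_abs_less1)
qed

lemma rho_inj:
  assumes "rho x = rho y" "dist x y < 1"
  shows "x = y"
  using assms Ints_vec_norm_less_1[of "x - y"] by (simp add: rho_eq_iff dist_norm)

lemma uniform_covering_rho: "uniform_covering UNIV rho (torus :: (complex ^ 'm) set)"
  unfolding uniform_covering_def
proof (intro conjI allI impI)
  show "continuous_on UNIV (rho :: real ^ 'm \<Rightarrow> _)"
    by (intro continuous_intros)
  show "range rho = (torus :: (complex ^ 'm) set)"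
  proof
    show "(torus :: (complex ^ 'm) set) \<subseteq> range rho"
    proof
      fix z :: "complex ^ 'm" assume "z \<in> torus"
      then have z: "norm (z $ i) = 1" for i
        by (simp add: torus_def)
      then have "z = rho (\<chi> i. Arg (z $ i) / (2 * pi))"
        unfolding rho_def vec_eq_iff vec_lambda_beta exp_2pi_i_Arg[OF z] by simp
      then show "z \<in> range rho"
        by blast
    qed
  qed auto
  show "\<exists>r>0. \<forall>x\<in>UNIV :: (real ^ 'm) set. \<forall>x'\<in>UNIV. rho x = rho x' \<longrightarrow> dist x x' < r \<longrightarrow> x = x'"
    using rho_inj zero_less_one by blast
  fix e :: real assume e: "e > 0"
  \<comment> \<open>The error allowed per coordinate: the Euclidean distance is estimated by the sum
    of the \<open>CARD('m)\<close> coordinate distances.\<close>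
  define e' where "e' = e / CARD('m)"
  have "e' > 0"
    using e by (simp add: e'_def)
  obtain d where d: "d > 0" "\<And>t z. \<lbrakk>norm z = 1; dist (exp (2 * pi * \<i> * complex_of_real t)) z < d\<rbrakk> \<Longrightarrow>
    \<exists>t'. exp (2 * pi * \<i> * complex_of_real t') = z \<and> \<bar>t' - t\<bar> < e'"
    by (fact circle_lift[OF \<open>e' > 0\<close>])
  have "\<exists>x'. rho x' = z \<and> dist x x' < e" if "z \<in> torus" "dist (rho x) z < d" for x :: "real ^ 'm" and z
  proof -
    have "\<exists>t'. exp (2 * pi * \<i> * complex_of_real t') = z $ i \<and> \<bar>t' - x $ i\<bar> < e'" for i
    proof (rule d(2))
      show "norm (z $ i) = 1"
        using that by (simp add: torus_def)
      have "dist (rho x $ i) (z $ i) \<le> dist (rho x) z"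
        by (rule dist_vec_nth_le)
      then show "dist (exp (2 * pi * \<i> * complex_of_real (x $ i))) (z $ i) < d"
        using that(2) by (simp add: rho_def)
    qed
    then obtain f where f: "\<And>i. exp (2 * pi * \<i> * complex_of_real (f i)) = z $ i" "\<And>i. \<bar>f i - x $ i\<bar> < e'"
      by metis
    have "dist x (\<chi> i. f i) \<le> (\<Sum>i\<in>UNIV. \<bar>(x - (\<chi> i. f i)) $ i\<bar>)"
      unfolding dist_norm by (rule norm_le_l1_cart)
    also have "\<dots> < (\<Sum>i\<in>(UNIV::'m set). e')"
      by (rule sum_strict_mono) (use f(2) in \<open>simp_all add: abs_minus_commute\<close>)
    also have "\<dots> = e"
      by (simp add: e'_def)
    finally show ?thesis
      using f(1) by (intro exI[of _ "\<chi> i. f i"]) (simp add: rho_def vec_eq_iff)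
  qed
  then show "\<exists>d>0. \<forall>x\<in>UNIV :: (real ^ 'm) set. \<forall>y\<in>torus. dist (rho x) y < d \<longrightarrow> (\<exists>x'\<in>UNIV. rho x' = y \<and> dist x x' < e)"
    using d(1) by blast
qed

lemma rho_unit_cube: "rho ` cbox 0 1 = (torus :: (complex ^ 'm) set)"
proof
  show "(torus :: (complex ^ 'm) set) \<subseteq> rho ` cbox 0 1"
  proof
    fix z :: "complex ^ 'm" assume "z \<in> torus"
    moreover have "range rho = (torus :: (complex ^ 'm) set)"
      using uniform_covering_rho[where 'm = 'm] by (simp add: uniform_covering_def)
    ultimately obtain x where x: "z = rho x"
      by blast
    define y where "y = (\<chi> i. frac (x $ i))"
    have "rho y = rho x"
      by (simp add: rho_eq_iff y_def frac_def)
    moreover have "y \<in> cbox 0 1"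
      by (simp add: mem_box_cart y_def less_imp_le[OF frac_lt_1])
    ultimately show "z \<in> rho ` cbox 0 1"
      using x by (metis imageI)
  qed
qed auto

lemma compact_torus: "compact torus"
  unfolding rho_unit_cube[symmetric]
  by (intro compact_continuous_image continuous_intros compact_cbox)

section \<open>Discrete subgroups\<close>

lemma finite_bounded_separated:
  fixes S :: "'a::euclidean_space set"
  assumes "bounded S" "e > 0" "\<And>x y. \<lbrakk>x \<in> S; y \<in> S; dist x y < e\<rbrakk> \<Longrightarrow> x = y"
  shows "finite S"
proof (rule ccontr)
  assume "infinite S"
  moreover have "compact (closure S)" "S \<subseteq> closure S"
    using \<open>bounded S\<close> by (auto simp: compact_closure closure_subset)
  ultimately obtain l where l: "l islimpt S"
    using Heine_Borel_imp_Bolzano_Weierstrass by metis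
  have "infinite (S \<inter> ball l (e / 2))"
    using l \<open>e > 0\<close> by (simp add: islimpt_eq_infinite_ball)
  moreover have "x = y" if "x \<in> S \<inter> ball l (e / 2)" "y \<in> S \<inter> ball l (e / 2)" for x y
    using that assms(3)[of x y] dist_triangle_half_r[of l x e y] by (auto simp: dist_commute)
  then have "S \<inter> ball l (e / 2) \<subseteq> {x}" if "x \<in> S \<inter> ball l (e / 2)" for x
    using that by blast
  then have "finite (S \<inter> ball l (e / 2))"
    by (metis ex_in_conv finite.emptyI finite.insertI finite_subset)
  ultimately show False
    by blast
qed

text \<open>For finite \<open>B\<close> this is the subgroup generated by \<open>B\<close>. Real
  coefficients with integral values permit a direct comparison with coordinates in
  \<open>span B\<close>.\<close>

definition int_span :: "'a::real_vector set \<Rightarrow> 'a set"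
  where "int_span B = {x. \<exists>c. (\<forall>b\<in>B. c b \<in> \<int>) \<and> x = (\<Sum>b\<in>B. c b *\<^sub>R b)}"

lemma int_span_insert:
  assumes "finite B" "b \<notin> B" "x - of_int q *\<^sub>R b \<in> int_span B"
  shows "x \<in> int_span (insert b B)"
proof -
  obtain c where c: "\<forall>b\<in>B. c b \<in> \<int>" "x - of_int q *\<^sub>R b = (\<Sum>b\<in>B. c b *\<^sub>R b)"
    using assms(3) by (auto simp: int_span_def)
  define c' where "c' = c(b := of_int q)"
  have "(\<Sum>b\<in>B. c' b *\<^sub>R b) = (\<Sum>b\<in>B. c b *\<^sub>R b)"
    by (rule sum.cong) (use assms(2) in \<open>auto simp: c'_def\<close>)
  then have "x = (\<Sum>b\<in>insert b B. c' b *\<^sub>R b)"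
    using assms c(2) by (simp add: c'_def algebra_simps)
  moreover have "\<forall>b\<in>insert b B. c' b \<in> \<int>"
    using c(1) by (auto simp: c'_def)
  ultimately show ?thesis
    unfolding int_span_def by blast
qed

locale discrete_subgroup =
  fixes L :: "'a::euclidean_space set" and e :: real
  assumes zero: "0 \<in> L" and diff: "\<lbrakk>x \<in> L; y \<in> L\<rbrakk> \<Longrightarrow> x - y \<in> L"
    and e_pos: "e > 0" and discrete: "\<lbrakk>x \<in> L; norm x < e\<rbrakk> \<Longrightarrow> x = 0"
begin

lemma uminus: "x \<in> L \<Longrightarrow> - x \<in> L"
  using diff[OF zero] by simp

lemma add: "\<lbrakk>x \<in> L; y \<in> L\<rbrakk> \<Longrightarrow> x + y \<in> L"
  using diff[of x "- y"] uminus[of y] by simp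

lemma scale_nat: "x \<in> L \<Longrightarrow> real n *\<^sub>R x \<in> L"
  by (induction n) (auto simp: zero algebra_simps intro: add)

lemma scale_int: "x \<in> L \<Longrightarrow> of_int q *\<^sub>R x \<in> L"
  using scale_nat[of x "nat q"] uminus[OF scale_nat[of x "nat (- q)"]] by (cases "q \<ge> 0") auto

lemma sum: "(\<And>i. i \<in> I \<Longrightarrow> f i \<in> L) \<Longrightarrow> sum f I \<in> L"
  by (induction I rule: infinite_finite_induct) (auto simp: zero intro: add)

lemma int_span_subset: "B \<subseteq> L \<Longrightarrow> int_span B \<subseteq> L"
  unfolding int_span_def by (auto intro!: sum elim!: Ints_cases scale_int) (metis Ints_cases scale_int subsetD)

lemma finite_Int_bounded: "bounded S \<Longrightarrow> finite (L \<inter> S)"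
  by (rule finite_bounded_separated[OF _ e_pos])
    (use diff discrete in \<open>force simp: dist_norm intro: bounded_subset\<close>)+

lemma extend_int_basis:
  assumes B: "finite B" "B \<subseteq> L" "independent B" "L \<inter> span B \<subseteq> int_span B" and v: "v \<in> L" "v \<notin> span B"
  obtains b where "b \<in> L" "b \<notin> span B" "L \<inter> span (insert b B) \<subseteq> int_span (insert b B)"
proof -
  text \<open>Each coset of \<open>span B\<close> meets \<open>L\<close> in a point reduced modulo \<open>int_span B\<close>; discreteness then
    gives a coset at minimal positive height.\<close>
  define T where "T = {t. 0 < t \<and> t \<le> 1 \<and> (\<exists>y\<in>span B. y + t *\<^sub>R v \<in> L)}"
  have "\<exists>y. y \<in> span B \<and> y + t *\<^sub>R v \<in> L \<inter> cball 0 ((\<Sum>b\<in>B. norm b) + norm v)" if t: "t \<in> T" for t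
  proof -
    obtain y where y: "y \<in> span B" "y + t *\<^sub>R v \<in> L"
      using t by (auto simp: T_def)
    obtain c where c: "y = (\<Sum>b\<in>B. c b *\<^sub>R b)"
      using y(1) by (auto simp: span_finite[OF B(1)])
    define z where "z = (\<Sum>b\<in>B. of_int \<lfloor>c b\<rfloor> *\<^sub>R b)"
    have "z \<in> L"
      unfolding z_def using B(2) by (auto intro!: sum scale_int)
    have yz: "y - z = (\<Sum>b\<in>B. frac (c b) *\<^sub>R b)"
      by (simp add: c z_def frac_def sum_subtractf scaleR_diff_left)
    have "norm (y - z) \<le> (\<Sum>b\<in>B. norm (frac (c b) *\<^sub>R b))"
      unfolding yz by (rule norm_sum)
    also have "\<dots> \<le> (\<Sum>b\<in>B. norm b)"
      by (rule sum_mono) (simp add: mult_left_le_one_le less_imp_le[OF frac_lt_1])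
    finally have "norm (y - z) \<le> (\<Sum>b\<in>B. norm b)" .
    moreover have "norm (t *\<^sub>R v) \<le> norm v"
      using t by (simp add: T_def mult_left_le_one_le)
    ultimately have "norm (y - z + t *\<^sub>R v) \<le> (\<Sum>b\<in>B. norm b) + norm v"
      using norm_triangle_ineq[of "y - z" "t *\<^sub>R v"] by linarith
    moreover have "y - z + t *\<^sub>R v \<in> L"
      using diff[OF y(2) \<open>z \<in> L\<close>] by (simp add: algebra_simps)
    moreover have "z \<in> span B"
      unfolding z_def by (auto intro: span_sum span_scale span_base)
    ultimately show ?thesis
      using y(1) by (intro exI[of _ "y - z"]) (auto intro: span_diff)
  qed
  then obtain Y where Y: "\<And>t. t \<in> T \<Longrightarrow> Y t \<in> span B"
    "\<And>t. t \<in> T \<Longrightarrow> Y t + t *\<^sub>R v \<in> L \<inter> cball 0 ((\<Sum>b\<in>B. norm b) + norm v)"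
    by metis
  \<comment> \<open>Different heights give different points, since \<open>v\<close> is not in
    \<open>span B\<close>; so the finitely many points of \<open>L\<close> in the ball leave room
    for finitely many heights only.\<close>
  have "inj_on (\<lambda>t. Y t + t *\<^sub>R v) T"
  proof (rule inj_onI)
    fix t u assume tu: "t \<in> T" "u \<in> T" "Y t + t *\<^sub>R v = Y u + u *\<^sub>R v"
    then have "(t - u) *\<^sub>R v = Y u - Y t"
      by (simp add: algebra_simps)
    then have "(t - u) *\<^sub>R v \<in> span B"
      using Y(1) tu by (simp add: span_diff)
    then have "(1 / (t - u)) *\<^sub>R ((t - u) *\<^sub>R v) \<in> span B"
      by (rule span_scale)
    then show "t = u"
      using v(2) by (cases "t = u") auto
  qed
  moreover have "finite ((\<lambda>t. Y t + t *\<^sub>R v) ` T)"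
    by (rule finite_subset[OF _ finite_Int_bounded[OF bounded_cball]]) (use Y(2) in blast)
  ultimately have "finite T"
    by (rule finite_imageD[rotated])
  moreover have "1 \<in> T"
    using v(1) by (auto simp: T_def intro: bexI[of _ 0] span_zero)
  ultimately have min: "Min T \<in> T" "\<And>t. t \<in> T \<Longrightarrow> Min T \<le> t"
    using Min_in by auto
  define m where "m = Min T"
  define b where "b = Y m + m *\<^sub>R v"
  have m: "m > 0" "m \<in> T"
    using min(1) by (auto simp: T_def m_def)
  have bL: "b \<in> L" and Ym: "Y m \<in> span B"
    using Y[OF m(2)] by (auto simp: b_def)
  have vb: "v = (1 / m) *\<^sub>R (b - Y m)"
    using m by (simp add: b_def)
  show ?thesis
  proof (rule that[OF bL])
    show "b \<notin> span B"
      using v(2) Ym span_scale[OF span_diff, of b B "Y m" "1 / m"] vb by auto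
    then have "b \<notin> B"
      using span_base by blast
    show "L \<inter> span (insert b B) \<subseteq> int_span (insert b B)"
    proof
      fix x assume x: "x \<in> L \<inter> span (insert b B)"
      then obtain s where s: "x - s *\<^sub>R b \<in> span B"
        using span_breakdown_eq[of x b B] by auto
      \<comment> \<open>Subtracting the integral part of \<open>s\<close> leaves a point of
        \<open>L\<close> at height \<open>r\<close> in the interval from 0 to \<open>m\<close>, with
        \<open>m\<close> excluded; minimality of \<open>m\<close> then forces
        \<open>r = 0\<close>.\<close>
      define q where "q = \<lfloor>s\<rfloor>"
      define r where "r = frac s * m"
      have xq: "x - of_int q *\<^sub>R b \<in> L"
        using x bL by (auto intro: diff scale_int)
      have "x - of_int q *\<^sub>R b = (x - s *\<^sub>R b) + frac s *\<^sub>R b"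
        by (simp add: q_def frac_def scaleR_diff_left)
      then have eq: "x - of_int q *\<^sub>R b = ((x - s *\<^sub>R b) + frac s *\<^sub>R Y m) + r *\<^sub>R v"
        by (simp add: b_def r_def algebra_simps)
      have "r = 0"
      proof (rule ccontr)
        assume "r \<noteq> 0"
        then have "r > 0"
          using m by (simp add: r_def)
        moreover have "r < m"
          using m by (simp add: r_def frac_lt_1)
        moreover have "m \<le> 1"
          using m by (simp add: T_def)
        moreover have "(x - s *\<^sub>R b) + frac s *\<^sub>R Y m \<in> span B"
          using s Ym by (intro span_add span_scale)
        ultimately have "r \<in> T"
          using xq eq by (auto simp: T_def)
        then show False
          using min(2) \<open>r < m\<close> by (force simp: m_def)
      qed
      then have "frac s = 0"
        using m by (simp add: r_def)
      then have "x - of_int q *\<^sub>R b \<in> span B"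
        unfolding eq \<open>r = 0\<close> \<open>frac s = 0\<close> using s by simp
      then have "x - of_int q *\<^sub>R b \<in> int_span B"
        using B(4) xq by blast
      then show "x \<in> int_span (insert b B)"
        by (rule int_span_insert[OF B(1) \<open>b \<notin> B\<close>])
    qed
  qed
qed

text \<open>Vectors are adjoined one at a time, keeping the points of \<open>L\<close> in the span
  integrally generated. An independent set has at most \<open>DIM('a)\<close> elements, so asking
  for one more forces the alternative \<open>L \<subseteq> span B\<close>.\<close>

proposition int_basis_exists:
  obtains B where "finite B" "B \<subseteq> L" "independent B" "int_span B = L"
proof -
  have ex: "\<exists>B. finite B \<and> B \<subseteq> L \<and> independent B \<and> L \<inter> span B \<subseteq> int_span B \<and> (card B \<ge> n \<or> L \<subseteq> span B)" for n
  proof (induction n)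
    case 0
    show ?case
      by (rule exI[of _ "{}"]) (auto simp: int_span_def independent_empty)
  next
    case (Suc n)
    then obtain B where B: "finite B" "B \<subseteq> L" "independent B" "L \<inter> span B \<subseteq> int_span B" "card B \<ge> n \<or> L \<subseteq> span B"
      by blast
    show ?case
    proof (cases "L \<subseteq> span B")
      case False
      then obtain v where "v \<in> L" "v \<notin> span B"
        by blast
      then obtain b where b: "b \<in> L" "b \<notin> span B" "L \<inter> span (insert b B) \<subseteq> int_span (insert b B)"
        using extend_int_basis[OF B(1-4)] by metis
      then have "b \<notin> B"
        using span_base by blast
      then show ?thesis
        using b B False by (intro exI[of _ "insert b B"]) (auto simp: independent_insert)
    qed (use B in blast)
  qed
  obtain B where B: "finite B" "B \<subseteq> L" "independent B" "L \<inter> span B \<subseteq> int_span B"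
    "card B \<ge> Suc DIM('a) \<or> L \<subseteq> span B"
    using ex[of "Suc DIM('a)"] by (elim exE conjE) metis
  have "card B \<le> DIM('a)"
    using independent_bound[OF B(3)] by simp
  then have "L \<subseteq> int_span B"
    using B by auto
  then show ?thesis
    using that[of B] B int_span_subset[OF B(2)] by blast
qed

end

section \<open>Sections of coverings and tori\<close>

text \<open>The map \<open>\<sigma>\<close> parametrises one sheet of \<open>X\<close>. Of the point
  set only two facts enter: \<open>Q\<close> is a uniform covering of the subspace \<open>V\<close>,
  and \<open>X\<close> is a union of fibres of \<open>rho\<close>.\<close>

locale torus_cover_section =
  fixes X V :: "(real ^ 'm) set" and Q \<sigma> :: "real ^ 'm \<Rightarrow> real ^ 'm"
  assumes subspace: "subspace V" and Q_diff: "Q (x - y) = Q x - Q y" and Q_in: "Q x \<in> V"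
    and Q_norm: "norm (Q x) \<le> norm x"
    and cov: "uniform_covering X Q V"
    and periodic: "\<lbrakk>x \<in> X; rho y = rho x\<rbrakk> \<Longrightarrow> y \<in> X"
    and cont: "continuous_on V \<sigma>" and \<sigma>_in: "\<sigma> \<in> V \<rightarrow> X" and Q_\<sigma>: "v \<in> V \<Longrightarrow> Q (\<sigma> v) = v"
begin

definition \<pi> :: "real ^ 'm \<Rightarrow> complex ^ 'm"
  where "\<pi> v = rho (\<sigma> v)"

lemma convexV: "convex V"
  using subspace by (rule subspace_imp_convex)

lemma V_add: "\<lbrakk>v \<in> V; w \<in> V\<rbrakk> \<Longrightarrow> v + w \<in> V" and V_diff: "\<lbrakk>v \<in> V; w \<in> V\<rbrakk> \<Longrightarrow> v - w \<in> V"
  using subspace by (auto intro: subspace_add subspace_diff)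

lemma section_uc:
  assumes "e > 0"
  obtains d where "d > 0" "\<And>v w. \<lbrakk>v \<in> V; w \<in> V; dist v w < d\<rbrakk> \<Longrightarrow> dist (\<sigma> v) (\<sigma> w) < e"
proof -
  have "uniformly_continuous_on V \<sigma>"
    by (rule section_uniformly_continuous[OF cov convexV cont \<sigma>_in Q_\<sigma>])
  then obtain d where d: "d > 0" "\<forall>w\<in>V. \<forall>v\<in>V. dist v w < d \<longrightarrow> dist (\<sigma> v) (\<sigma> w) < e"
    unfolding uniformly_continuous_on_def using assms by metis
  show ?thesis
    by (rule that[OF d(1)]) (use d(2) in blast)
qed

lemma continuous_\<pi>: "continuous_on V \<pi>"
  unfolding \<pi>_def by (intro continuous_intros cont)

lemma \<pi>_in: "v \<in> V \<Longrightarrow> \<pi> v \<in> rho ` X"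
  using \<sigma>_in by (auto simp: \<pi>_def)

text \<open>Both sides are lifts of \<open>u \<mapsto> u + (v - w)\<close> through \<open>Q\<close> that agree at \<open>w\<close>.\<close>

lemma section_translate:
  assumes vw: "v \<in> V" "w \<in> V" "\<pi> v = \<pi> w" and u: "u \<in> V"
  shows "\<sigma> (u + (v - w)) = \<sigma> u + (\<sigma> v - \<sigma> w)"
proof (rule covering_space_lift_unique[OF uniform_covering_imp_covering_space[OF cov],
      where T = V and a = w and f = "\<lambda>u. u + (v - w)" and x = u and ?g1.0 = "\<lambda>u. \<sigma> (u + (v - w))"
        and ?g2.0 = "\<lambda>u. \<sigma> u + (\<sigma> v - \<sigma> w)"])
  have shift: "(\<lambda>u. u + (v - w)) \<in> V \<rightarrow> V"
    using vw by (auto intro: V_add V_diff)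
  then show "(\<lambda>u. u + (v - w)) \<in> V \<rightarrow> V" .
  show "continuous_on V (\<lambda>u. \<sigma> (u + (v - w)))"
    by (rule continuous_on_compose2[OF cont]) (use shift in \<open>auto intro!: continuous_intros\<close>)
  show "(\<lambda>u. \<sigma> (u + (v - w))) \<in> V \<rightarrow> X"
    using shift \<sigma>_in by blast
  show "(\<lambda>u. \<sigma> u + (\<sigma> v - \<sigma> w)) \<in> V \<rightarrow> X"
  proof
    fix x assume "x \<in> V"
    then have "\<sigma> x \<in> X"
      using \<sigma>_in by blast
    moreover have "rho (\<sigma> x + (\<sigma> v - \<sigma> w)) = rho (\<sigma> x)"
      using vw(3) by (simp add: \<pi>_def rho_eq_iff)
    ultimately show "\<sigma> x + (\<sigma> v - \<sigma> w) \<in> X"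
      by (rule periodic)
  qed
  fix x assume x: "x \<in> V"
  then have "x + (v - w) \<in> V"
    using shift by blast
  then show "x + (v - w) = Q (\<sigma> (x + (v - w)))"
    by (simp add: Q_\<sigma>)
  have "\<sigma> x + (\<sigma> v - \<sigma> w) = \<sigma> x - (\<sigma> w - \<sigma> v)"
    by simp
  then have "Q (\<sigma> x + (\<sigma> v - \<sigma> w)) = Q (\<sigma> x) - (Q (\<sigma> w) - Q (\<sigma> v))"
    by (simp only: Q_diff)
  then show "x + (v - w) = Q (\<sigma> x + (\<sigma> v - \<sigma> w))"
    using x vw by (simp add: Q_\<sigma>)
qed (use vw u convexV in \<open>auto intro!: continuous_intros cont convex_connected\<close>)

text \<open>A point \<open>y\<close> near \<open>\<pi> v\<close> has a preimage \<open>q\<close>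
  under \<open>rho\<close> near \<open>\<sigma> v\<close>. It lies in \<open>X\<close> by
  periodicity, and it lies on the sheet of \<open>\<sigma>\<close> because \<open>q\<close> and
  \<open>\<sigma> (Q q)\<close> are lifts of the same point within the injectivity radius; the
  latter uses uniform continuity of \<open>\<sigma>\<close>. Since \<open>y\<close> ranges over the
  whole image of \<open>X\<close>, the lemma yields clopenness as well as the covering
  property.\<close>

lemma \<pi>_lift:
  assumes e: "e > 0"
  obtains d where "d > 0"
    "\<And>v y. \<lbrakk>v \<in> V; y \<in> rho ` X; dist (\<pi> v) y < d\<rbrakk> \<Longrightarrow> \<exists>v'\<in>V. \<pi> v' = y \<and> dist v v' < e"
proof -
  obtain r where r: "r > 0" and inj: "\<And>x x'. \<lbrakk>x \<in> X; x' \<in> X; Q x = Q x'; dist x x' < r\<rbrakk> \<Longrightarrow> x = x'"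
    by (fact uniform_coveringE[OF cov])
  have r2: "r / 2 > 0"
    using r by simp
  obtain d where d: "d > 0" "\<And>v w. \<lbrakk>v \<in> V; w \<in> V; dist v w < d\<rbrakk> \<Longrightarrow> dist (\<sigma> v) (\<sigma> w) < r / 2"
    by (fact section_uc[OF r2])
  define e' where "e' = Min {e, d, r / 2}"
  have e': "e' > 0" "e' \<le> e" "e' \<le> d" "e' \<le> r / 2"
    using e d r2 by (auto simp: e'_def)
  obtain c where c: "c > 0"
    "\<And>x y. \<lbrakk>x \<in> (UNIV :: (real ^ 'm) set); y \<in> torus; dist (rho x) y < c\<rbrakk> \<Longrightarrow> \<exists>x'\<in>UNIV. rho x' = y \<and> dist x x' < e'"
    by (fact uniform_covering_liftE[OF uniform_covering_rho e'(1)])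
  show ?thesis
  proof (rule that[OF c(1)])
    fix v y assume v: "v \<in> V" and y: "y \<in> rho ` X" "dist (\<pi> v) y < c"
    then obtain q where q: "rho q = y" "dist (\<sigma> v) q < e'"
      using c(2)[of "\<sigma> v" y] by (auto simp: \<pi>_def)
    then have "q \<in> X"
      using y(1) periodic by auto
    have "dist v (Q q) = norm (Q (\<sigma> v - q))"
      using v by (simp add: Q_diff Q_\<sigma> dist_norm)
    also have "\<dots> < e'"
      using Q_norm[of "\<sigma> v - q"] q(2) by (simp add: dist_norm)
    finally have close: "dist v (Q q) < e'" .
    then have "dist (\<sigma> v) (\<sigma> (Q q)) < r / 2"
      using d(2) v Q_in e'(3) by simp
    then have "dist q (\<sigma> (Q q)) < r"
      using q(2) e'(4) dist_triangle3[of q "\<sigma> (Q q)" "\<sigma> v"] by simp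
    then have "q = \<sigma> (Q q)"
      using inj \<open>q \<in> X\<close> \<sigma>_in Q_in Q_\<sigma> by (metis PiE)
    then have "\<pi> (Q q) = y"
      using q(1) by (simp add: \<pi>_def)
    then show "\<exists>v'\<in>V. \<pi> v' = y \<and> dist v v' < e"
      using close e'(2) Q_in by (intro bexI[of _ "Q q"]) auto
  qed
qed

text \<open>Distinct points in a fibre of \<open>rho\<close> are at distance at least 1, so
  \<open>\<sigma> v\<close> and \<open>\<sigma> w\<close> must coincide once they are closer than
  that; applying \<open>Q\<close> recovers \<open>v = w\<close>.\<close>

lemma \<pi>_inj:
  obtains d where "d > 0" "\<And>v w. \<lbrakk>v \<in> V; w \<in> V; \<pi> v = \<pi> w; dist v w < d\<rbrakk> \<Longrightarrow> v = w"
proof -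
  obtain d where d: "d > 0" "\<And>v w. \<lbrakk>v \<in> V; w \<in> V; dist v w < d\<rbrakk> \<Longrightarrow> dist (\<sigma> v) (\<sigma> w) < 1"
    by (fact section_uc[OF zero_less_one])
  show ?thesis
  proof (rule that[OF d(1)])
    fix v w assume vw: "v \<in> V" "w \<in> V" "\<pi> v = \<pi> w" "dist v w < d"
    then have "\<sigma> v = \<sigma> w"
      using d(2) by (intro rho_inj) (auto simp: \<pi>_def)
    then show "v = w"
      using Q_\<sigma> vw by metis
  qed
qed

lemma covering_\<pi>: "covering_space V \<pi> (\<pi> ` V)"
proof (rule uniform_covering_imp_covering_space, unfold uniform_covering_def, intro conjI allI impI)
  obtain d where "d > 0" "\<And>v w. \<lbrakk>v \<in> V; w \<in> V; \<pi> v = \<pi> w; dist v w < d\<rbrakk> \<Longrightarrow> v = w"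
    by (fact \<pi>_inj)
  then show "\<exists>r>0. \<forall>x\<in>V. \<forall>x'\<in>V. \<pi> x = \<pi> x' \<longrightarrow> dist x x' < r \<longrightarrow> x = x'"
    by blast
  fix e :: real assume "e > 0"
  obtain d where d: "d > 0"
    "\<And>v y. \<lbrakk>v \<in> V; y \<in> rho ` X; dist (\<pi> v) y < d\<rbrakk> \<Longrightarrow> \<exists>v'\<in>V. \<pi> v' = y \<and> dist v v' < e"
    by (fact \<pi>_lift[OF \<open>e > 0\<close>])
  show "\<exists>d>0. \<forall>x\<in>V. \<forall>y\<in>\<pi> ` V. dist (\<pi> x) y < d \<longrightarrow> (\<exists>x'\<in>V. \<pi> x' = y \<and> dist x x' < e)"
    using d \<pi>_in by (intro exI[of _ d]) auto
qed (auto intro: continuous_\<pi>)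

text \<open>The radius of \<open>\<pi>_lift\<close> is the same at all points of the image. A point
  of \<open>rho\<close> applied to \<open>X\<close> that is closer to the image than this radius
  belongs to it, which gives openness of both the image and its complement.\<close>

lemma clopen_image:
  shows "openin (top_of_set (rho ` X)) (\<pi> ` V)" and "closedin (top_of_set (rho ` X)) (\<pi> ` V)"
proof -
  obtain d where d: "d > 0"
    "\<And>v y. \<lbrakk>v \<in> V; y \<in> rho ` X; dist (\<pi> v) y < d\<rbrakk> \<Longrightarrow> \<exists>v'\<in>V. \<pi> v' = y \<and> dist v v' < 1"
    by (fact \<pi>_lift[OF zero_less_one])
  have d': "y \<in> \<pi> ` V" if "v \<in> V" "y \<in> rho ` X" "dist (\<pi> v) y < d" for v y
    using d(2)[OF that] by blast
  have sub: "\<pi> ` V \<subseteq> rho ` X"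
    using \<pi>_in by blast
  show "openin (top_of_set (rho ` X)) (\<pi> ` V)"
    unfolding openin_euclidean_subtopology_iff
  proof (intro conjI ballI sub)
    fix x assume "x \<in> \<pi> ` V"
    then show "\<exists>e>0. \<forall>x'\<in>rho ` X. dist x' x < e \<longrightarrow> x' \<in> \<pi> ` V"
      using d(1) d' by (intro exI[of _ d]) (auto simp: dist_commute)
  qed
  have "openin (top_of_set (rho ` X)) (rho ` X - \<pi> ` V)"
    unfolding openin_euclidean_subtopology_iff
  proof (intro conjI ballI Diff_subset)
    fix x assume "x \<in> rho ` X - \<pi> ` V"
    then show "\<exists>e>0. \<forall>x'\<in>rho ` X. dist x' x < e \<longrightarrow> x' \<in> rho ` X - \<pi> ` V"
      using d(1) d' by (intro exI[of _ d]) auto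
  qed
  then show "closedin (top_of_set (rho ` X)) (\<pi> ` V)"
    using sub by (simp add: closedin_def)
qed

text \<open>These are the translations of \<open>V\<close> that act as deck transformations of the
  covering \<open>\<pi>\<close>.\<close>

definition periods :: "(real ^ 'm) set"
  where "periods = {v \<in> V. \<forall>u\<in>V. \<pi> (u + v) = \<pi> u}"

text \<open>A single coincidence of values already produces a period: by
  \<open>section_translate\<close>, shifting the argument by \<open>v - w\<close> changes
  \<open>\<sigma>\<close> everywhere by the same integer vector
  \<open>\<sigma> v - \<sigma> w\<close>, which \<open>rho\<close> does not see.\<close>

lemma \<pi>_eq_iff:
  assumes "v \<in> V" "w \<in> V"
  shows "\<pi> v = \<pi> w \<longleftrightarrow> v - w \<in> periods"
proof
  assume eq: "\<pi> v = \<pi> w"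
  have "\<pi> (u + (v - w)) = \<pi> u" if "u \<in> V" for u
    using section_translate[OF assms eq that] eq by (simp add: \<pi>_def rho_eq_iff)
  then show "v - w \<in> periods"
    using assms by (simp add: periods_def V_diff)
next
  assume "v - w \<in> periods"
  then have "\<pi> (w + (v - w)) = \<pi> w"
    using assms(2) unfolding periods_def by blast
  then show "\<pi> v = \<pi> w"
    by simp
qed

lemma discrete_periods: "\<exists>e. discrete_subgroup periods e"
proof -
  obtain d where d: "d > 0" "\<And>v w. \<lbrakk>v \<in> V; w \<in> V; \<pi> v = \<pi> w; dist v w < d\<rbrakk> \<Longrightarrow> v = w"
    by (fact \<pi>_inj)
  have 0: "0 \<in> V"
    using subspace by (rule subspace_0)
  have \<pi>_0: "\<pi> x = \<pi> 0" if "x \<in> periods" for x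
  proof -
    have "\<pi> (0 + x) = \<pi> 0"
      using that 0 unfolding periods_def by blast
    then show ?thesis
      by simp
  qed
  have "discrete_subgroup periods d"
  proof
    show "0 \<in> periods"
      using 0 by (simp add: periods_def)
    show "x - y \<in> periods" if "x \<in> periods" "y \<in> periods" for x y
      using that \<pi>_eq_iff[of x y] \<pi>_0[of x] \<pi>_0[of y] unfolding periods_def by auto
    show "x = 0" if "x \<in> periods" "norm x < d" for x
      using d(2)[of x 0] that 0 \<pi>_0[OF that(1)] by (simp add: periods_def)
  qed (rule d(1))
  then show ?thesis ..
qed

text \<open>Compactness makes the periods cocompact: every point of \<open>V\<close> is congruent
  modulo \<open>periods\<close> to one within distance 1 of a fixed finite set. This excludes a
  nonzero direction of \<open>V\<close> orthogonal to all periods.\<close>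

lemma span_periods:
  assumes "compact (\<pi> ` V)"
  shows "span periods = V"
proof (rule ccontr)
  assume ne: "span periods \<noteq> V"
  have "periods \<subseteq> V"
    by (auto simp: periods_def)
  then have "span periods \<subset> span V"
    using ne subspace by (metis psubsetI span_eq_iff span_mono)
  then obtain u where u: "u \<noteq> 0" "u \<in> span V" "\<And>y. y \<in> span periods \<Longrightarrow> orthogonal u y"
    using orthogonal_to_subspace_exists_gen by metis
  then have uV: "u \<in> V"
    using subspace by (metis span_eq_iff)
  obtain d where d: "d > 0"
    "\<And>v y. \<lbrakk>v \<in> V; y \<in> rho ` X; dist (\<pi> v) y < d\<rbrakk> \<Longrightarrow> \<exists>v'\<in>V. \<pi> v' = y \<and> dist v v' < 1"
    by (fact \<pi>_lift[OF zero_less_one])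
  obtain C where C: "C \<subseteq> V" "finite C" "\<pi> ` V \<subseteq> (\<Union>v\<in>C. ball (\<pi> v) d)"
    by (rule compactE_image[OF assms, of V "\<lambda>v. ball (\<pi> v) d"]) (use d(1) in auto)
  obtain N where N: "\<And>w. w \<in> C \<Longrightarrow> norm w \<le> N"
    using finite_imp_bounded[OF C(2)] by (auto simp: bounded_iff)
  \<comment> \<open>Adding a period does not change the component along \<open>u\<close>, so every
    point congruent to \<open>v\<close> has norm at least \<open>\<bar>N\<bar> + 1\<close>, whereas
    the finite set provides one of norm less than \<open>N + 1\<close>.\<close>
  define v where "v = ((\<bar>N\<bar> + 1) / norm u) *\<^sub>R u"
  have v: "v \<in> V"
    using uV subspace by (simp add: v_def subspace_scale)
  then obtain w where w: "w \<in> C" "dist (\<pi> w) (\<pi> v) < d"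
    using C(3) by auto
  then obtain v' where v': "v' \<in> V" "\<pi> v' = \<pi> v" "dist w v' < 1"
    using d(2)[of w "\<pi> v"] C(1) \<pi>_in v by auto
  have "norm v' < N + 1"
    using N[OF w(1)] v'(3) norm_triangle_ineq2[of v' w] by (simp add: dist_norm norm_minus_commute)
  have "v' - v \<in> periods"
    using \<pi>_eq_iff v v' by blast
  then have "u \<bullet> v' = u \<bullet> v"
    using u(3) span_base by (force simp: orthogonal_def inner_diff_right)
  also have "\<dots> = (\<bar>N\<bar> + 1) * norm u"
    using u(1) by (simp add: v_def dot_square_norm power2_eq_square)
  finally have "(\<bar>N\<bar> + 1) * norm u \<le> norm u * norm v'"
    using norm_cauchy_schwarz[of u v'] by simp
  then have "\<bar>N\<bar> + 1 \<le> norm v'"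
    using u(1) by (simp add: mult.commute)
  then show False
    using \<open>norm v' < N + 1\<close> by linarith
qed

text \<open>Injectivity is checked on two classes with the same image instead of on the kernel: the
  lifts of two loops that are homotopic in the torus end at the same point of \<open>V\<close>, and
  \<open>V\<close> is simply connected.\<close>

lemma fundamental_group_mono:
  assumes "a \<in> \<pi> ` V"
  shows "fundamental_group_map torus id a \<in> mon (fundamental_group (\<pi> ` V) a) (fundamental_group torus a)"
proof -
  let ?C = "\<pi> ` V"
  have id: "continuous_on ?C id" "id \<in> ?C \<rightarrow> torus"
    by (auto simp: \<pi>_def intro: continuous_on_id)
  have cov_rho: "covering_space UNIV rho (torus :: (complex ^ 'm) set)"
    by (rule uniform_covering_imp_covering_space[OF uniform_covering_rho])
  obtain v0 where v0: "v0 \<in> V" "a = \<pi> v0"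
    using assms by blast
  have "A = A'" if A: "A \<in> carrier (fundamental_group ?C a)" "A' \<in> carrier (fundamental_group ?C a)"
    and eq: "fundamental_group_map torus id a A = fundamental_group_map torus id a A'" for A A'
  proof -
    obtain p where p: "p \<in> loops ?C a" "A = loop_rel ?C a `` {p}"
      using A(1) by (rule fundamental_group_carrierE)
    obtain q where q: "q \<in> loops ?C a" "A' = loop_rel ?C a `` {q}"
      using A(2) by (rule fundamental_group_carrierE)
    have pt: "p \<in> loops torus a" and qt: "q \<in> loops torus a"
      using comp_in_loops[OF p(1) id] comp_in_loops[OF q(1) id] by simp_all
    have "loop_rel torus a `` {p} = loop_rel torus a `` {q}"
      using eq fundamental_group_map_class[OF id p(1)] fundamental_group_map_class[OF id q(1)]
      by (simp add: p(2) q(2))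
    then have "(p, q) \<in> loop_rel torus a"
      by (rule eq_equiv_class[OF _ equiv_loop_rel qt])
    then have hom: "homotopic_paths torus p q"
      by (simp add: loop_rel_def)
    have pq: "path p" "path_image p \<subseteq> ?C" "pathstart p = \<pi> v0"
      "path q" "path_image q \<subseteq> ?C" "pathstart q = \<pi> v0"
      using p(1) q(1) v0 by (auto simp: loops_def)
    obtain h where h: "path h" "path_image h \<subseteq> V" "pathstart h = v0" "\<And>t. t \<in> {0..1} \<Longrightarrow> \<pi> (h t) = p t"
      using covering_space_lift_path_strong[OF covering_\<pi> v0(1) pq(1-3)] by metis
    obtain k where k: "path k" "path_image k \<subseteq> V" "pathstart k = v0" "\<And>t. t \<in> {0..1} \<Longrightarrow> \<pi> (k t) = q t"
      using covering_space_lift_path_strong[OF covering_\<pi> v0(1) pq(4-6)] by metis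
    \<comment> \<open>Composed with \<open>\<sigma>\<close>, the lifts through \<open>\<pi>\<close>
      become lifts of \<open>p\<close> and \<open>q\<close> through \<open>rho\<close>. So monodromy
      applies to a homotopy in the torus that may leave the component.\<close>
    have "pathfinish (\<sigma> \<circ> h) = pathfinish (\<sigma> \<circ> k)"
    proof (rule covering_space_monodromy[OF cov_rho _ _ _ _ hom])
      show "path_image p \<subseteq> torus" "path_image q \<subseteq> torus"
        using pt qt by (auto simp: loops_def)
      show "path (\<sigma> \<circ> h)" "path (\<sigma> \<circ> k)"
        using h k by (auto intro!: path_continuous_image continuous_on_subset[OF cont])
      show "rho ((\<sigma> \<circ> h) t) = p t" "rho ((\<sigma> \<circ> k) t) = q t" if "t \<in> {0..1}" for t
        using h(4)[OF that] k(4)[OF that] by (simp_all add: \<pi>_def)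
      show "pathstart (\<sigma> \<circ> h) = pathstart (\<sigma> \<circ> k)"
        using h(3) k(3) by (simp add: pathstart_compose)
    qed (use pq in auto)
    then have "\<sigma> (pathfinish h) = \<sigma> (pathfinish k)"
      by (simp add: pathfinish_compose)
    moreover have "pathfinish h \<in> V" "pathfinish k \<in> V"
      using h(2) k(2) by auto
    ultimately have "pathfinish h = pathfinish k"
      using Q_\<sigma> by metis
    then have "homotopic_paths V h k"
      using convex_imp_simply_connected[OF convexV] h k
      by (auto simp: simply_connected_eq_homotopic_paths)
    then have "homotopic_paths ?C (\<pi> \<circ> h) (\<pi> \<circ> k)"
      by (rule homotopic_paths_continuous_image[OF _ continuous_\<pi>]) auto
    moreover have "homotopic_paths ?C p (\<pi> \<circ> h)" "homotopic_paths ?C q (\<pi> \<circ> k)"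
      using h(4) k(4) pq by (auto intro!: homotopic_paths_eq)
    ultimately have "homotopic_paths ?C p q"
      by (meson homotopic_paths_sym homotopic_paths_trans)
    then show "A = A'"
      using loop_class_eqI[OF _ p(1)] by (simp add: p(2) q(2))
  qed
  then show ?thesis
    using fundamental_group_map_hom[OF id, of a] by (simp add: mon_def inj_on_def)
qed

text \<open>In coordinates with respect to an integral basis of the periods, the periods are the
  points with integral coordinates. Exponentiating the coordinates thus gives a map \<open>F\<close>
  from \<open>V\<close> onto the standard torus with the same fibres as
  \<open>\<pi>\<close>.\<close>

lemma homeomorphic_torus_space:
  assumes compact: "compact (\<pi> ` V)"
  shows "top_of_set (\<pi> ` V) homeomorphic_space torus_space (dim V)"
proof -
  obtain e where "discrete_subgroup periods e"
    using discrete_periods by blast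
  then interpret L: discrete_subgroup periods e .
  obtain B where B: "finite B" "B \<subseteq> periods" "independent B" "int_span B = periods"
    by (fact L.int_basis_exists)
  have "int_span B \<subseteq> span B"
    unfolding int_span_def by (auto intro: span_sum span_scale span_base)
  then have spanB: "span B = V"
    using span_periods[OF compact] B(2,4) by (metis span_mono span_span subset_antisym)
  then have dimV: "dim V = card B"
    using dim_span[of B] dim_eq_card_independent[OF B(3)] by simp
  obtain b where b: "bij_betw b {..<dim V} B"
    using ex_bij_betw_nat_finite[OF B(1)] by (auto simp: dimV atLeast0LessThan)
  have "\<exists>f. linear f \<and> (\<forall>x\<in>B. f x = (if x = y then 1 else 0 :: real))" for y
    by (rule linear_independent_extend[OF B(3)])
  then obtain c where c: "\<And>y. linear (c y)" "\<And>x y. x \<in> B \<Longrightarrow> c y x = (if x = y then 1 else 0 :: real)"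
    by metis
  have coords: "(\<Sum>y\<in>B. c y v *\<^sub>R y) = v" if "v \<in> V" for v
  proof -
    have "linear (\<lambda>v. \<Sum>y\<in>B. c y v *\<^sub>R y)"
      by (rule linearI) (simp_all add: linear_add[OF c(1)] linear_scale[OF c(1)] scaleR_add_left
          sum.distrib scaleR_sum_right)
    moreover have "(\<Sum>y\<in>B. c y x *\<^sub>R y) = x" if "x \<in> B" for x
      using that B(1) by (simp add: c(2) if_distrib[of "\<lambda>t. t *\<^sub>R _"] sum.delta cong: if_cong)
    ultimately show ?thesis
      using linear_eq_on_span[of "\<lambda>v. \<Sum>y\<in>B. c y v *\<^sub>R y" "\<lambda>v. v" B v] that spanB by (simp add: linear_ident)
  qed
  have c_int: "v \<in> periods \<longleftrightarrow> (\<forall>y\<in>B. c y v \<in> \<int>)" if "v \<in> V" for v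
  proof
    assume "v \<in> periods"
    then obtain k where k: "\<forall>y\<in>B. k y \<in> \<int>" "v = (\<Sum>y\<in>B. k y *\<^sub>R y)"
      using B(4) by (auto simp: int_span_def)
    have "c y v = k y" if "y \<in> B" for y
      using that B(1) by (simp add: k(2) linear_sum[OF c(1)] linear_scale[OF c(1)] c(2) if_distrib[of "\<lambda>t. _ * t"] cong: if_cong)
    then show "\<forall>y\<in>B. c y v \<in> \<int>"
      using k(1) by simp
  next
    assume "\<forall>y\<in>B. c y v \<in> \<int>"
    then show "v \<in> periods"
      unfolding B(4)[symmetric] int_span_def using coords[OF that] by (auto intro!: exI[of _ "\<lambda>y. c y v"])
  qed
  define F where "F v = (\<lambda>i\<in>{..<dim V}. exp (2 * pi * \<i> * complex_of_real (c (b i) v)))" for v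
  have F_eq_iff: "F v = F w \<longleftrightarrow> \<pi> v = \<pi> w" if "v \<in> V" "w \<in> V" for v w
  proof -
    have "F v = F w \<longleftrightarrow> (\<forall>i<dim V. c (b i) v - c (b i) w \<in> \<int>)"
      unfolding F_def restrict_def fun_eq_iff exp_2pi_i_eq_iff[symmetric] by auto
    also have "\<dots> \<longleftrightarrow> (\<forall>y\<in>B. c y (v - w) \<in> \<int>)"
      using b by (auto simp: bij_betw_def linear_diff[OF c(1)])
    also have "\<dots> \<longleftrightarrow> \<pi> v = \<pi> w"
      using c_int[OF V_diff[OF that]] \<pi>_eq_iff[OF that] by simp
    finally show ?thesis .
  qed
  have cont_F: "continuous_map (top_of_set V) (torus_space (dim V)) F"
    unfolding torus_space_def continuous_map_componentwise
  proof (intro conjI ballI)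
    show "F ` topspace (top_of_set V) \<subseteq> extensional {..<dim V}"
      by (auto simp: F_def)
    fix i assume "i \<in> {..<dim V}"
    then have "F v i = exp (2 * pi * \<i> * complex_of_real (c (b i) v))" for v
      by (simp add: F_def)
    moreover have "continuous_on V (\<lambda>v. exp (2 * pi * \<i> * complex_of_real (c (b i) v)))"
      by (intro continuous_intros linear_continuous_on linear_conv_bounded_linear[THEN iffD1] c(1))
    ultimately show "continuous_map (top_of_set V) (top_of_set (sphere 0 1)) (\<lambda>v. F v i)"
      by (simp add: continuous_map_in_subtopology image_subset_iff)
  qed
  have top: "topspace (torus_space (dim V)) = (\<Pi>\<^sub>E i\<in>{..<dim V}. sphere 0 1)"
    by (simp add: torus_space_def)
  have surj_F: "F ` V = topspace (torus_space (dim V))"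
  proof
    show "F ` V \<subseteq> topspace (torus_space (dim V))"
      using continuous_map_image_subset_topspace[OF cont_F] by simp
    show "topspace (torus_space (dim V)) \<subseteq> F ` V"
    proof
      fix z assume z: "z \<in> topspace (torus_space (dim V))"
      define t where "t y = Arg (z (inv_into {..<dim V} b y)) / (2 * pi)" for y
      define v where "v = (\<Sum>y\<in>B. t y *\<^sub>R y)"
      have "v \<in> V"
        unfolding v_def spanB[symmetric] by (intro span_sum span_scale span_base)
      have "c y v = t y" if "y \<in> B" for y
        using that B(1) by (simp add: v_def linear_sum[OF c(1)] linear_scale[OF c(1)] c(2) if_distrib[of "\<lambda>t. _ * t"] cong: if_cong)
      moreover have "b i \<in> B" "inv_into {..<dim V} b (b i) = i" if "i < dim V" for i
        using b that by (auto simp: bij_betw_def)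
      moreover have "norm (z i) = 1" if "i < dim V" for i
        using z that unfolding top by (auto simp: PiE_iff)
      ultimately have "exp (2 * pi * \<i> * complex_of_real (c (b i) v)) = z i" if "i < dim V" for i
        using exp_2pi_i_Arg[of "z i"] that by (simp add: t_def)
      moreover have "z \<in> extensional {..<dim V}"
        using z unfolding top by (simp add: PiE_iff)
      ultimately have "F v = z"
        by (auto simp: F_def restrict_def extensional_def fun_eq_iff)
      then show "z \<in> F ` V"
        using \<open>v \<in> V\<close> by blast
    qed
  qed
  \<comment> \<open>Coverings are open and hence quotient maps, so \<open>F\<close> descends to the
    image of \<open>\<pi>\<close>. The induced map is a continuous bijection from a compact space to
    a Hausdorff space.\<close>
  have "open_map (top_of_set V) (top_of_set (\<pi> ` V)) \<pi>"
    unfolding open_map_def using covering_space_open_map[OF covering_\<pi>] by blast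
  then have quot: "quotient_map (top_of_set V) (top_of_set (\<pi> ` V)) \<pi>"
    by (rule continuous_open_imp_quotient_map[rotated]) (auto simp: continuous_\<pi>)
  obtain g where g: "continuous_map (top_of_set (\<pi> ` V)) (torus_space (dim V)) g"
    "\<And>v. v \<in> V \<Longrightarrow> g (\<pi> v) = F v"
    using quotient_map_lift_exists[OF quot cont_F] F_eq_iff by (metis topspace_euclidean_subtopology)
  have "homeomorphic_map (top_of_set (\<pi> ` V)) (torus_space (dim V)) g"
  proof (rule continuous_imp_homeomorphic_map[OF g(1)])
    show "compact_space (top_of_set (\<pi> ` V))"
      using compact by (simp add: compact_space_subtopology)
    show "Hausdorff_space (torus_space (dim V))"
      unfolding torus_space_def Hausdorff_space_product_topology
      by (intro disjI2 ballI Hausdorff_space_subtopology Hausdorff_space_euclidean)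
    show "g ` topspace (top_of_set (\<pi> ` V)) = topspace (torus_space (dim V))"
      using surj_F g(2) by (simp add: image_image)
    show "inj_on g (topspace (top_of_set (\<pi> ` V)))"
      using g(2) F_eq_iff by (auto simp: inj_on_def)
  qed
  then show ?thesis
    by (rule homeomorphic_map_imp_homeomorphic_space)
qed

end

section \<open>Means over balls\<close>

text \<open>Volumes of balls are proportional to \<open>R ^ DIM('a)\<close>, so shells of fixed
  width are negligible. This absorbs boundary effects twice: for translates of a ball, and for
  points of \<open>\<Lambda>\<close> near its boundary sphere.\<close>

lemma shell_volume_tendsto:
  "((\<lambda>R. (measure lborel (ball (0 :: 'a::euclidean_space) (R + c)) - measure lborel (ball (0 :: 'a) (R - c))) /
      measure lborel (ball (0 :: 'a) R)) \<longlongrightarrow> 0) at_top"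
proof -
  have "((\<lambda>R. (1 + c * inverse R) ^ DIM('a) - (1 - c * inverse R) ^ DIM('a)) \<longlongrightarrow>
      (1 + c * 0) ^ DIM('a) - (1 - c * 0) ^ DIM('a)) at_top"
    by (intro tendsto_intros tendsto_inverse_0_at_top filterlim_ident)
  moreover have "eventually (\<lambda>R. (1 + c * inverse R) ^ DIM('a) - (1 - c * inverse R) ^ DIM('a) =
      (measure lborel (ball (0 :: 'a) (R + c)) - measure lborel (ball (0 :: 'a) (R - c))) / measure lborel (ball (0 :: 'a) R)) at_top"
    using eventually_gt_at_top[of "\<bar>c\<bar>"]
  proof eventually_elim
    case (elim R)
    define u where "u = measure lborel (ball (0 :: 'a) 1)"
    have "u > 0"
      unfolding u_def by (rule content_ball_pos) simp
    have vol: "measure lborel (ball (0 :: 'a) r) = r ^ DIM('a) * u" if "r \<ge> 0" for r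
      using content_ball_conv_unit_ball[OF that, of "0 :: 'a"] by (simp add: u_def)
    have "R > 0"
      using elim by simp
    then have "1 + c * inverse R = (R + c) / R" "1 - c * inverse R = (R - c) / R"
      by (simp_all add: field_simps)
    moreover have "(x ^ DIM('a) * u - y ^ DIM('a) * u) / (R ^ DIM('a) * u) = (x / R) ^ DIM('a) - (y / R) ^ DIM('a)" for x y
      using \<open>u > 0\<close> by (simp add: power_divide diff_divide_distrib)
    moreover have "R + c \<ge> 0" "R - c \<ge> 0" "R \<ge> 0"
      using elim by auto
    ultimately show ?case
      by (simp only: vol)
  qed
  ultimately show ?thesis
    by (rule tendsto_eq_rhs[OF Lim_transform_eventually]) simp
qed

definition ball_mean :: "(real ^ 'n \<Rightarrow> complex) \<Rightarrow> real \<Rightarrow> complex"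
  where "ball_mean h R = (LINT x:ball 0 R|lborel. h x) /\<^sub>R measure lborel (ball (0 :: real ^ 'n) R)"

text \<open>A relation instead of a limit operator, because existence of the limit is part of what
  has to be proved.\<close>

definition has_mean :: "(real ^ 'n \<Rightarrow> complex) \<Rightarrow> complex \<Rightarrow> bool"
  where "has_mean h c \<longleftrightarrow> (ball_mean h \<longlongrightarrow> c) at_top"

lemma set_integrable_ball:
  fixes h :: "'a::euclidean_space \<Rightarrow> 'b::{banach, second_countable_topology}"
  assumes "continuous_on UNIV h"
  shows "set_integrable lborel (ball a R) h"
proof (rule set_integrable_subset)
  show "set_integrable lborel (cball a R) h"
    unfolding set_integrable_def
    by (rule borel_integrable_compact) (auto intro: continuous_on_subset[OF assms])
qed auto

lemma ball_mean_add:
  "\<lbrakk>continuous_on UNIV g; continuous_on UNIV h\<rbrakk> \<Longrightarrow> ball_mean (\<lambda>x. g x + h x) R = ball_mean g R + ball_mean h R"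
  by (simp add: ball_mean_def set_integral_add set_integrable_ball scaleR_add_right)

lemma ball_mean_diff:
  "\<lbrakk>continuous_on UNIV g; continuous_on UNIV h\<rbrakk> \<Longrightarrow> ball_mean (\<lambda>x. g x - h x) R = ball_mean g R - ball_mean h R"
  by (simp add: ball_mean_def set_integral_diff set_integrable_ball scaleR_diff_right)

lemma ball_mean_const:
  assumes "R > 0"
  shows "ball_mean (\<lambda>x :: real ^ 'n. c) R = c"
proof -
  have "measure lborel (ball (0 :: real ^ 'n) R) > 0"
    using assms by (rule content_ball_pos)
  then show ?thesis
    using emeasure_lborel_ball_finite[of "0 :: real ^ 'n" R]
    by (simp add: ball_mean_def set_integral_const)
qed

lemma norm_ball_mean_le:
  assumes "continuous_on UNIV h" "continuous_on UNIV k" "\<And>x. norm (h x) \<le> k x"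
  shows "norm (ball_mean h R) \<le> Re (ball_mean (\<lambda>x. complex_of_real (k x)) R)"
proof -
  have "norm (LINT x:ball 0 R|lborel. h x) \<le> (LINT x:ball 0 R|lborel. norm (h x))"
    by (intro set_integral_norm_bound set_integrable_ball assms)
  also have "\<dots> \<le> (LINT x:ball 0 R|lborel. k x)"
    by (intro set_integral_mono set_integrable_ball assms continuous_intros)
  finally show ?thesis
    by (simp add: ball_mean_def set_integral_complex_of_real mult_left_mono)
qed

lemma norm_ball_mean_le_const:
  assumes "continuous_on UNIV h" "\<And>x. norm (h x) \<le> B" "R > 0"
  shows "norm (ball_mean h R) \<le> B"
  using norm_ball_mean_le[OF assms(1) continuous_on_const assms(2), of R] assms(3)
  by (simp add: ball_mean_const)

lemma has_mean_const: "has_mean (\<lambda>x. c) c"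
  unfolding has_mean_def
  by (rule tendsto_eventually)
    (use eventually_gt_at_top[of 0] in eventually_elim, simp add: ball_mean_const)

lemma has_mean_add:
  "\<lbrakk>has_mean g a; has_mean h b; continuous_on UNIV g; continuous_on UNIV h\<rbrakk> \<Longrightarrow> has_mean (\<lambda>x. g x + h x) (a + b)"
  unfolding has_mean_def ext[of "ball_mean _", OF ball_mean_add] by (rule tendsto_add)

lemma has_mean_diff:
  "\<lbrakk>has_mean g a; has_mean h b; continuous_on UNIV g; continuous_on UNIV h\<rbrakk> \<Longrightarrow> has_mean (\<lambda>x. g x - h x) (a - b)"
  unfolding has_mean_def ext[of "ball_mean _", OF ball_mean_diff] by (rule tendsto_diff)

lemma has_mean_cmult:
  assumes "has_mean g a"
  shows "has_mean (\<lambda>x. c * g x) (c * a)"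
proof -
  have "ball_mean (\<lambda>x. c * g x) = (\<lambda>R. c * ball_mean g R)"
    by (simp add: ball_mean_def fun_eq_iff)
  then show ?thesis
    using assms unfolding has_mean_def by (simp add: tendsto_mult_left)
qed

lemma has_mean_sum:
  assumes "finite I" "\<And>i. i \<in> I \<Longrightarrow> has_mean (g i) (a i)" "\<And>i. i \<in> I \<Longrightarrow> continuous_on UNIV (g i)"
  shows "has_mean (\<lambda>x. \<Sum>i\<in>I. g i x) (\<Sum>i\<in>I. a i)"
  using assms
proof (induction I rule: finite_induct)
  case empty
  then show ?case
    by (simp add: has_mean_const)
next
  case (insert i I)
  then show ?case
    by (auto intro!: has_mean_add continuous_on_sum)
qed

lemma has_mean_unique: "\<lbrakk>has_mean h a; has_mean h b\<rbrakk> \<Longrightarrow> a = b"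
  unfolding has_mean_def by (rule tendsto_unique) auto

lemma has_mean_norm_le:
  assumes "has_mean h a" "has_mean (\<lambda>x. complex_of_real (k x)) b"
    "continuous_on UNIV h" "continuous_on UNIV k" "\<And>x. norm (h x) \<le> k x"
  shows "norm a \<le> Re b"
proof (rule tendsto_le[OF trivial_limit_at_top_linorder])
  show "((\<lambda>R. norm (ball_mean h R)) \<longlongrightarrow> norm a) at_top"
    using assms(1) unfolding has_mean_def by (rule tendsto_norm)
  show "((\<lambda>R. Re (ball_mean (\<lambda>x. complex_of_real (k x)) R)) \<longlongrightarrow> Re b) at_top"
    using assms(2) unfolding has_mean_def by (rule tendsto_Re)
  show "\<forall>\<^sub>F R in at_top. norm (ball_mean h R) \<le> Re (ball_mean (\<lambda>x. complex_of_real (k x)) R)"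
    by (intro always_eventually allI norm_ball_mean_le assms)
qed

text \<open>Means do not increase the sup norm, so the means of uniform approximants form a Cauchy
  sequence, and its limit is the mean of \<open>h\<close>.\<close>

lemma has_mean_uniform_limit:
  assumes cont: "continuous_on UNIV h"
    and approx: "\<And>e. e > 0 \<Longrightarrow> \<exists>P. continuous_on UNIV P \<and> (\<exists>c. has_mean P c) \<and> (\<forall>x. norm (h x - P x) \<le> e)"
  shows "\<exists>c. has_mean h c"
proof -
  have "\<forall>j::nat. \<exists>P. continuous_on UNIV P \<and> (\<exists>c. has_mean P c) \<and> (\<forall>x. norm (h x - P x) \<le> inverse (Suc j))"
    using approx by simp
  then obtain P where P: "\<And>j::nat. continuous_on UNIV (P j)" "\<And>j. \<exists>c. has_mean (P j) c"
    "\<And>j x. norm (h x - P j x) \<le> inverse (Suc j)"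
    by metis
  obtain c where c: "\<And>j. has_mean (P j) (c j)"
    using P(2) by metis
  have diff: "norm (c i - c j) \<le> inverse (Suc i) + inverse (Suc j)" for i j
  proof -
    have "norm (P i x - P j x) \<le> inverse (Suc i) + inverse (Suc j)" for x
      using P(3)[of x i] P(3)[of x j] norm_triangle_ineq4[of "h x - P j x" "h x - P i x"] by simp
    then have "norm (c i - c j) \<le> Re (complex_of_real (inverse (Suc i) + inverse (Suc j)))"
      by (intro has_mean_norm_le[OF has_mean_diff[OF c c P(1) P(1)] has_mean_const] P continuous_intros)
    then show ?thesis
      by (simp only: Re_complex_of_real)
  qed
  have small: "\<exists>N. \<forall>j\<ge>N. inverse (real (Suc j)) < e" if "e > 0" for e
  proof -
    obtain N where "inverse (real (Suc N)) < e"
      using reals_Archimedean[OF \<open>e > 0\<close>] by blast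
    moreover have "inverse (real (Suc j)) \<le> inverse (real (Suc N))" if "j \<ge> N" for j
      using that by (simp add: le_imp_inverse_le)
    ultimately show ?thesis
      by (meson order_le_less_trans)
  qed
  have "Cauchy c"
    unfolding Cauchy_def
  proof (intro allI impI)
    fix e :: real assume "e > 0"
    then obtain N where N: "\<And>j. j \<ge> N \<Longrightarrow> inverse (real (Suc j)) < e / 2"
      using small[of "e / 2"] by auto
    have "dist (c i) (c j) < e" if "i \<ge> N" "j \<ge> N" for i j
      using diff[of i j] N[OF that(1)] N[OF that(2)] by (simp add: dist_norm)
    then show "\<exists>M. \<forall>m\<ge>M. \<forall>n\<ge>M. dist (c m) (c n) < e"
      by blast
  qed
  then obtain l where l: "c \<longlonglongrightarrow> l"
    using Cauchy_convergent convergent_def by blast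
  have "has_mean h l"
    unfolding has_mean_def tendsto_iff
  proof (intro allI impI)
    fix e :: real assume e: "e > 0"
    then obtain N where N: "\<And>j. j \<ge> N \<Longrightarrow> inverse (real (Suc j)) < e / 3"
      using small[of "e / 3"] by auto
    have e3: "e / 3 > 0"
      using e by simp
    obtain N' where N': "\<And>j. j \<ge> N' \<Longrightarrow> dist (c j) l < e / 3"
      using l e3 unfolding lim_sequentially by blast
    define j where "j = max N N'"
    have j: "inverse (real (Suc j)) < e / 3" "dist (c j) l < e / 3"
      by (rule N, simp add: j_def) (rule N', simp add: j_def)
    have "\<forall>\<^sub>F R in at_top. dist (ball_mean (P j) R) (c j) < e / 3"
      using c[of j] e3 unfolding has_mean_def tendsto_iff by blast
    then show "\<forall>\<^sub>F R in at_top. dist (ball_mean h R) l < e"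
      using eventually_gt_at_top[of 0]
    proof eventually_elim
      case (elim R)
      have "norm (ball_mean (\<lambda>x. h x - P j x) R) \<le> inverse (Suc j)"
        by (intro norm_ball_mean_le_const continuous_intros cont P elim)
      then have "dist (ball_mean h R) (ball_mean (P j) R) < e / 3"
        using j(1) by (simp add: ball_mean_diff[OF cont P(1)] dist_norm)
      then show ?case
        using elim(1) j(2) dist_triangle[of "ball_mean h R" l "ball_mean (P j) R"]
          dist_triangle[of "ball_mean (P j) R" l "c j"] by linarith
    qed
  qed
  then show ?thesis ..
qed

section \<open>Characters and their means\<close>

lemma continuous_character [continuous_intros]:
  "continuous_on S f \<Longrightarrow> continuous_on S (\<lambda>x. character y (f x))"
  unfolding character_def by (intro continuous_intros)

lemma norm_character [simp]: "norm (character y x) = 1"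
  by (simp add: character_def norm_exp_eq_Re)

lemma character_add: "character y (x + x') = character y x * character y x'"
  by (simp add: character_def inner_add_right algebra_simps exp_add)

lemma character_add_freq: "character (y + y') x = character y x * character y' x"
  by (simp add: character_def inner_add_left algebra_simps exp_add)

lemma character_diff: "character y (x - t) = character y x * character (- y) t"
  by (simp add: character_def inner_diff_right algebra_simps exp_add[symmetric])

lemma character_0 [simp]: "character 0 x = 1" "character y 0 = 1"
  by (simp_all add: character_def)

lemma integral_translate:
  fixes f :: "'a::euclidean_space \<Rightarrow> complex"
  assumes "f \<in> borel_measurable borel"
  shows "(LINT x|lborel. f (a + x)) = (LINT x|lborel. f x)"
proof -
  have "(LINT x|lborel. f x) = (LINT x|distr lborel borel ((+) a). f x)"
    by (simp add: lborel_distr_plus)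
  also have "\<dots> = (LINT x|lborel. f (a + x))"
    by (rule integral_distr) (use assms in auto)
  finally show ?thesis ..
qed

lemma has_mean_character:
  fixes y :: "real ^ 'n"
  shows "has_mean (character y) (if y = 0 then 1 else 0)"
proof (cases "y = 0")
  case True
  then have "character y = (\<lambda>x. 1)"
    by (auto simp: fun_eq_iff)
  then show ?thesis
    using True by (simp add: has_mean_const)
next
  case False
  define v where "v = (1 / (2 * (y \<bullet> y))) *\<^sub>R y"
  have yv: "y \<bullet> v = 1 / 2"
    using False by (simp add: v_def)
  have "character y v = exp (complex_of_real pi * \<i>)"
    unfolding character_def yv by simp
  then have "character y v = -1"
    by (simp only: exp_pi_i)
  text \<open>Translation by \<open>v\<close> changes the sign of the character, so that twice its integral over a ball
    is an integral over the symmetric difference of two balls at distance \<open>norm v\<close>.\<close>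
  have bound: "norm (ball_mean (character y) R) \<le>
      (measure lborel (ball (0 :: real ^ 'n) (R + norm v)) - measure lborel (ball (0 :: real ^ 'n) (R - norm v))) / measure lborel (ball (0 :: real ^ 'n) R)" for R
  proof -
    define f where "f x = indicator (ball 0 R) x *\<^sub>R character y x" for x
    \<comment> \<open>This is the indicator of a shell around the sphere of radius \<open>R\<close>
      that contains the symmetric difference of the balls of radius \<open>R\<close> around 0 and
      \<open>v\<close>.\<close>
    define W where "W x = indicator (ball 0 (R + norm v)) x - (indicator (ball 0 (R - norm v)) x :: real)" for x :: "real ^ 'n"
    have int: "set_integrable lborel (ball a r) (character y)" for a r
      by (intro set_integrable_ball continuous_intros)
    have "f \<in> borel_measurable borel"
      using int[of 0 R] by (simp add: f_def[abs_def] set_integrable_def borel_measurable_integrable)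
    then have translate: "(LINT x|lborel. f x) = (LINT x|lborel. f (- v + x))"
      by (rule integral_translate[symmetric])
    have "f (- v + x) = - (indicator (ball v R) x *\<^sub>R character y x)" for x
    proof -
      have "character y x = character y v * character y (- v + x)"
        by (simp flip: character_add)
      then have "character y (- v + x) = - character y x"
        using \<open>character y v = -1\<close> by simp
      moreover have "indicator (ball 0 R) (- v + x) = (indicator (ball v R) x :: real)"
        by (simp add: indicator_def dist_norm norm_minus_commute)
      ultimately show ?thesis
        by (simp add: f_def)
    qed
    then have eq: "(LINT x|lborel. f x) = - (LINT x:ball v R|lborel. character y x)"
      unfolding translate by (simp add: set_lebesgue_integral_def)
    have ind: "integrable lborel (indicator (ball 0 r) :: real ^ 'n \<Rightarrow> real)" for r
      using emeasure_lborel_ball_finite[of "0 :: real ^ 'n" r] by (simp add: integrable_indicator_iff)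
    have "2 * (LINT x|lborel. f x) = (LINT x:ball 0 R|lborel. character y x) - (LINT x:ball v R|lborel. character y x)"
      using eq by (simp add: f_def set_lebesgue_integral_def)
    also have "\<dots> = (LINT x|lborel. indicator (ball 0 R) x *\<^sub>R character y x - indicator (ball v R) x *\<^sub>R character y x)"
      unfolding set_lebesgue_integral_def using int by (simp add: set_integrable_def)
    also have "norm \<dots> \<le> (LINT x|lborel. W x)"
    proof (rule Bochner_Integration.integral_norm_bound_integral)
      show "integrable lborel (\<lambda>x. indicator (ball 0 R) x *\<^sub>R character y x - indicator (ball v R) x *\<^sub>R character y x)"
        using int[of 0 R] int[of v R] by (simp add: set_integrable_def)
      show "integrable lborel W"
        unfolding W_def by (intro Bochner_Integration.integrable_diff ind)
      fix x
      have "x \<in> ball 0 (R + norm v)" if "x \<in> ball 0 R \<or> x \<in> ball v R"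
        using that norm_triangle_ineq2[of x v] norm_ge_zero[of v]
        unfolding mem_ball dist_norm norm_minus_commute[of v x] diff_0 norm_minus_cancel by arith
      moreover have "x \<in> ball 0 R \<and> x \<in> ball v R" if "x \<in> ball 0 (R - norm v)"
        using that norm_triangle_ineq4[of v x] norm_ge_zero[of v]
        unfolding mem_ball dist_norm diff_0 norm_minus_cancel by arith
      ultimately have "\<bar>indicator (ball 0 R) x - indicator (ball v R) x :: real\<bar> \<le> W x"
        unfolding W_def indicator_def by (smt (verit) of_bool_eq)
      then show "norm (indicator (ball 0 R) x *\<^sub>R character y x - indicator (ball v R) x *\<^sub>R character y x) \<le> W x"
        by (simp flip: scaleR_diff_left)
    qed
    also have "(LINT x|lborel. W x) = measure lborel (ball (0 :: real ^ 'n) (R + norm v)) - measure lborel (ball (0 :: real ^ 'n) (R - norm v))"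
      unfolding W_def using ind by simp
    finally have "2 * norm (LINT x|lborel. f x) \<le> measure lborel (ball (0 :: real ^ 'n) (R + norm v)) - measure lborel (ball (0 :: real ^ 'n) (R - norm v))"
      by (simp add: norm_mult)
    moreover have "norm (LINT x|lborel. f x) \<le> 2 * norm (LINT x|lborel. f x)"
      by simp
    ultimately have "norm (LINT x|lborel. f x) \<le> measure lborel (ball (0 :: real ^ 'n) (R + norm v)) - measure lborel (ball (0 :: real ^ 'n) (R - norm v))"
      by linarith
    moreover have "norm (ball_mean (character y) R) = norm (LINT x|lborel. f x) / measure lborel (ball (0 :: real ^ 'n) R)"
      unfolding ball_mean_def set_lebesgue_integral_def f_def[symmetric]
      by (simp add: divide_inverse mult.commute)
    ultimately show ?thesis
      by (simp add: divide_right_mono)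
  qed
  have "(ball_mean (character y) \<longlongrightarrow> 0) at_top"
    by (rule Lim_null_comparison[OF _ shell_volume_tendsto[where 'a = "real ^ 'n" and c = "norm v"]])
      (intro always_eventually allI bound)
  then show ?thesis
    using False by (simp add: has_mean_def)
qed

section \<open>Approximation with prescribed frequencies\<close>

text \<open>A finitely generated abelian group has polynomial growth, so the number of elements of the
  boxes below cannot grow by a fixed factor at every step.\<close>

lemma folner_set_exists:
  fixes Y :: "(real ^ 'n) set"
  assumes Y: "finite Y" and "\<eta> > 0"
  obtains A where "finite A" "A \<noteq> {}"
    "\<And>y. y \<in> Y \<Longrightarrow> real (card {a \<in> A. a + y \<in> A}) \<ge> (1 - \<eta>) * real (card A)"
proof -
  define S where "S N = (\<lambda>j. \<Sum>y\<in>Y. real (j y) *\<^sub>R y) ` (Y \<rightarrow>\<^sub>E {..N})" for N :: nat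
  have fin: "finite (S N)" for N
    unfolding S_def using Y by (intro finite_imageI finite_PiE) auto
  have ne: "S N \<noteq> {}" for N
    by (simp add: S_def PiE_eq_empty_iff)
  have card_le: "card (S N) \<le> (N + 1) ^ card Y" for N
  proof -
    have "card (S N) \<le> card (Y \<rightarrow>\<^sub>E {..N})"
      unfolding S_def using Y by (intro card_image_le finite_PiE) auto
    then show ?thesis
      using Y by (simp add: card_PiE)
  qed
  have mono: "S N \<subseteq> S (Suc N)" for N
    unfolding S_def by (intro image_mono PiE_mono) auto
  have step: "a + y \<in> S (Suc N)" if a: "a \<in> S N" and y: "y \<in> Y" for a y N
  proof -
    obtain j where j: "j \<in> Y \<rightarrow>\<^sub>E {..N}" "a = (\<Sum>y\<in>Y. real (j y) *\<^sub>R y)"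
      using a unfolding S_def by blast
    have "(\<Sum>z\<in>Y. real ((j(y := Suc (j y))) z) *\<^sub>R z) = (\<Sum>z\<in>Y. real (j z) *\<^sub>R z + (if z = y then y else 0))"
      by (rule sum.cong) (auto simp: algebra_simps)
    also have "\<dots> = a + y"
      using Y y by (simp add: sum.distrib j(2))
    finally have eq: "a + y = (\<Sum>z\<in>Y. real ((j(y := Suc (j y))) z) *\<^sub>R z)" ..
    have "j(y := Suc (j y)) \<in> Y \<rightarrow>\<^sub>E {..Suc N}"
      using j(1) y by (auto simp: PiE_iff extensional_def le_SucI)
    then show ?thesis
      unfolding eq S_def by (rule imageI)
  qed
  have "\<exists>N. real (card (S (Suc N))) \<le> (1 + \<eta>) * real (card (S N))"
  proof (rule ccontr)
    assume "\<not> ?thesis"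
    then have grow: "real (card (S (Suc N))) > (1 + \<eta>) * real (card (S N))" for N
      by (simp add: not_le)
    have exp: "real (card (S N)) \<ge> (1 + \<eta>) ^ N" for N
    proof (induction N)
      case 0
      have "card (S 0) > 0"
        using fin ne by (simp add: card_gt_0_iff)
      then show ?case
        by simp
    next
      case (Suc N)
      have "(1 + \<eta>) ^ Suc N \<le> (1 + \<eta>) * real (card (S N))"
        using Suc \<open>\<eta> > 0\<close> by simp
      then show ?case
        using grow[of N] by linarith
    qed
    have "real (card (S N)) \<le> (real N + 1) ^ card Y" for N
      using card_le[of N] by (metis of_nat_1 of_nat_add of_nat_le_iff of_nat_power)
    then have bound: "(1 + \<eta>) ^ N \<le> (real N + 1) ^ card Y" for N
      using exp order_trans by blast
    have "((\<lambda>N. (real N + 1) ^ card Y / (1 + \<eta>) ^ N) \<longlongrightarrow> 0) sequentially"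
      using \<open>\<eta> > 0\<close> by real_asymp
    then have "\<forall>\<^sub>F N in sequentially. (real N + 1) ^ card Y / (1 + \<eta>) ^ N < 1"
      by (rule order_tendstoD) simp
    then obtain N where "(real N + 1) ^ card Y / (1 + \<eta>) ^ N < 1"
      by (auto simp: eventually_sequentially)
    then have "(real N + 1) ^ card Y < (1 + \<eta>) ^ N"
      using \<open>\<eta> > 0\<close> by (simp add: divide_less_eq)
    then show False
      using bound[of N] by simp
  qed
  then obtain N where N: "real (card (S (Suc N))) \<le> (1 + \<eta>) * real (card (S N))"
    by blast
  show ?thesis
  proof (rule that[OF fin ne])
    fix y assume y: "y \<in> Y"
    let ?A = "S N" and ?B = "(\<lambda>a. a + y) ` S N"
    \<comment> \<open>The set \<open>?A\<close> and its translate have equal size and both lie in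
      \<open>S (Suc N)\<close>, which is larger than \<open>?A\<close> by a factor of at most
      \<open>1 + \<eta>\<close>; so they must share the fraction \<open>1 - \<eta>\<close>.\<close>
    have "card (?A \<union> ?B) + card (?A \<inter> ?B) = card ?A + card ?B"
      using card_Un_Int[of ?A ?B] fin by simp
    moreover have "card ?B = card ?A"
      by (rule card_image) (auto simp: inj_on_def)
    moreover have "card (?A \<union> ?B) \<le> card (S (Suc N))"
      using mono[of N] step[OF _ y] by (intro card_mono fin) auto
    moreover have "?A \<inter> ?B = (\<lambda>a. a + y) ` {a \<in> ?A. a + y \<in> ?A}"
      by auto
    then have "card (?A \<inter> ?B) = card {a \<in> ?A. a + y \<in> ?A}"
      by (simp add: card_image inj_on_def)
    ultimately have "real (card {a \<in> ?A. a + y \<in> ?A}) \<ge> 2 * real (card ?A) - real (card (S (Suc N)))"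
      by linarith
    then show "(1 - \<eta>) * real (card ?A) \<le> real (card {a \<in> ?A. a + y \<in> ?A})"
      using N by (simp add: algebra_simps)
  qed
qed

text \<open>Being a squared modulus, the kernel is nonnegative, so averaging against it respects sup
  norm bounds. Its coefficient at a frequency is the number of pairs in \<open>A\<close> with that
  difference.\<close>

lemma fejer_kernel_nonneg:
  assumes "finite A"
  shows "(\<Sum>(a, b)\<in>A \<times> A. character (a - b) t) = complex_of_real ((norm (\<Sum>a\<in>A. character a t))\<^sup>2)"
proof -
  have cnj: "cnj (character b t) = character (- b) t" for b
    by (simp add: character_def exp_cnj)
  have "complex_of_real ((norm (\<Sum>a\<in>A. character a t))\<^sup>2) = (\<Sum>a\<in>A. character a t) * (\<Sum>b\<in>A. character (- b) t)"
    by (simp only: complex_norm_square cnj_sum cnj)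
  also have "\<dots> = (\<Sum>a\<in>A. \<Sum>b\<in>A. character (a - b) t)"
    by (simp add: sum_product flip: character_add_freq)
  finally show ?thesis
    by (simp add: sum.cartesian_product)
qed

text \<open>Orthogonality of characters: the mean against \<open>character (- z)\<close> reads off
  the coefficient at \<open>z\<close>.\<close>

lemma has_mean_trig_poly:
  assumes "finite Y"
  shows "has_mean (\<lambda>x. (\<Sum>y\<in>Y. c y * character y x) * character (- z) x) (if z \<in> Y then c z else 0)"
proof -
  have "has_mean (\<lambda>x. \<Sum>y\<in>Y. c y * character (y - z) x) (\<Sum>y\<in>Y. c y * (if y - z = 0 then 1 else 0))"
    by (intro has_mean_sum[OF assms] has_mean_cmult has_mean_character continuous_intros)
  moreover have "(\<Sum>y\<in>Y. c y * (if y - z = 0 then 1 else 0)) = (if z \<in> Y then c z else 0)"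
    using assms by (simp add: if_distrib[of "\<lambda>t. _ * t"] cong: if_cong)
  moreover have "(\<Sum>y\<in>Y. c y * character y x) * character (- z) x = (\<Sum>y\<in>Y. c y * character (y - z) x)" for x
    using character_add_freq[of _ "- z" x] by (simp add: sum_distrib_right mult.assoc)
  ultimately show ?thesis
    by simp
qed

lemma trig_polysE:
  assumes "P \<in> trig_polys"
  obtains Y c where "finite Y" "P = (\<lambda>x. \<Sum>y\<in>Y. c y * character y x)"
  using assms unfolding trig_polys_def by blast

lemma trig_poly_approx_has_mean:
  assumes cont: "continuous_on UNIV g"
    and approx: "\<forall>e>0. \<exists>P\<in>trig_polys. \<forall>x. norm (g x - P x) \<le> e"
  shows "\<exists>c. has_mean (\<lambda>x. g x * character (- z) x) c"
proof (rule has_mean_uniform_limit)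
  show "continuous_on UNIV (\<lambda>x. g x * character (- z) x)"
    by (intro continuous_intros cont)
  fix e :: real assume "e > 0"
  then obtain P where P: "P \<in> trig_polys" "\<And>x. norm (g x - P x) \<le> e"
    using approx by blast
  then obtain Y c where Y: "finite Y" "P = (\<lambda>x. \<Sum>y\<in>Y. c y * character y x)"
    by (metis trig_polysE)
  have "norm (g x * character (- z) x - P x * character (- z) x) \<le> e" for x
    using P(2)[of x] by (simp add: norm_mult flip: left_diff_distrib)
  moreover have "continuous_on UNIV (\<lambda>x. P x * character (- z) x)"
    unfolding Y(2) by (intro continuous_intros)
  moreover have "\<exists>c. has_mean (\<lambda>x. P x * character (- z) x) c"
    unfolding Y(2) using has_mean_trig_poly[OF Y(1)] by blast
  ultimately show "\<exists>P. continuous_on UNIV P \<and> (\<exists>c. has_mean P c) \<and>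
      (\<forall>x. norm (g x * character (- z) x - P x) \<le> e)"
    by blast
qed

text \<open>Mean convolution with a trigonometric kernel multiplies the kernel's coefficients by the
  Fourier-Bohr coefficients \<open>\<alpha>\<close> of \<open>g\<close>. Indexing the frequencies by
  \<open>I\<close> allows repetitions, as they occur among differences of pairs.\<close>

lemma has_mean_convolution:
  assumes cont: "continuous_on UNIV g"
    and mean: "\<And>z. has_mean (\<lambda>t. g t * character (- z) t) (\<alpha> z)" and "finite I"
  shows "has_mean (\<lambda>t. g t * (\<Sum>p\<in>I. character (w p) (x - t))) (\<Sum>p\<in>I. \<alpha> (w p) * character (w p) x)"
proof -
  have "has_mean (\<lambda>t. \<Sum>p\<in>I. character (w p) x * (g t * character (- w p) t)) (\<Sum>p\<in>I. character (w p) x * \<alpha> (w p))"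
    by (intro has_mean_sum has_mean_cmult mean continuous_intros cont \<open>finite I\<close>)
  then show ?thesis
    by (simp add: sum_distrib_left character_diff mult.commute mult.left_commute)
qed

text \<open>Averaging \<open>g\<close> against the normalised Fejer kernel of a Folner set \<open>A\<close> for the frequencies of a
  trigonometric polynomial \<open>P\<close> near \<open>g\<close> does not increase the distance to \<open>P\<close> and hardly moves
  \<open>P\<close>; the average of \<open>g\<close> involves only frequencies at which \<open>g\<close> has a nonzero mean.\<close>

proposition trig_poly_approx_spectral:
  fixes g :: "real ^ 'n \<Rightarrow> complex"
  assumes cont: "continuous_on UNIV g"
    and approx: "\<forall>e>0. \<exists>P\<in>trig_polys. \<forall>x. norm (g x - P x) \<le> e"
    and spec: "\<forall>z. z \<notin> G \<longrightarrow> has_mean (\<lambda>x. g x * character (- z) x) 0"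
    and e: "e > 0"
  obtains I :: "((real ^ 'n) \<times> (real ^ 'n)) set" and w d where
    "finite I" "w ` I \<subseteq> G" "\<And>x. norm (g x - (\<Sum>p\<in>I. d p * character (w p) x)) \<le> e"
proof -
  have e3: "e / 3 > 0"
    using e by simp
  then obtain P where P: "P \<in> trig_polys" "\<And>x. norm (g x - P x) \<le> e / 3"
    using approx by blast
  then obtain Y c where Y: "finite Y" "P = (\<lambda>x. \<Sum>y\<in>Y. c y * character y x)"
    by (metis trig_polysE)
  have contP: "continuous_on UNIV P"
    unfolding Y(2) by (intro continuous_intros)
  define C where "C = (\<Sum>y\<in>Y. norm (c y))"
  have "C \<ge> 0"
    by (simp add: C_def sum_nonneg)
  \<comment> \<open>Averaging changes each coefficient of \<open>P\<close> by a fraction of at most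
    \<open>\<eta>\<close>, hence \<open>P\<close> by at most \<open>\<eta> * C \<le> e / 3\<close>.
    The added 1 keeps the denominator positive when \<open>C = 0\<close>.\<close>
  define \<eta> where "\<eta> = e / (3 * (C + 1))"
  have "\<eta> > 0"
    using e \<open>C \<ge> 0\<close> by (simp add: \<eta>_def)
  obtain A where A: "finite A" "A \<noteq> {}"
    "\<And>y. y \<in> Y \<Longrightarrow> real (card {a \<in> A. a + y \<in> A}) \<ge> (1 - \<eta>) * real (card A)"
    by (fact folner_set_exists[OF Y(1) \<open>\<eta> > 0\<close>])
  define I where "I = A \<times> A"
  define w where "w p = fst p - snd p" for p :: "(real ^ 'n) \<times> (real ^ 'n)"
  define N where "N = real (card A)"
  have "finite I" "N > 0"
    using A by (auto simp: I_def N_def card_gt_0_iff)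
  obtain \<alpha> where \<alpha>: "\<And>z. has_mean (\<lambda>t. g t * character (- z) t) (\<alpha> z)"
    using trig_poly_approx_has_mean[OF cont approx] by metis
  have \<alpha>0: "\<alpha> z = 0" if "z \<notin> G" for z
    using has_mean_unique[OF \<alpha>] spec that by blast
  define \<beta> where "\<beta> z = (if z \<in> Y then c z else 0)" for z
  define K where "K t = (norm (\<Sum>a\<in>A. character a t))\<^sup>2" for t
  have K: "(\<Sum>p\<in>I. character (w p) t) = complex_of_real (K t)" for t
    using fejer_kernel_nonneg[OF A(1), of t] by (simp add: K_def I_def w_def case_prod_beta)
  have "K t \<ge> 0" for t
    by (simp add: K_def)
  have contK: "continuous_on UNIV K"
    unfolding K_def by (intro continuous_intros)
  \<comment> \<open>Divided by \<open>N\<close>, \<open>Q\<close> and \<open>S\<close> are the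
    averages of \<open>g\<close> and \<open>P\<close> against the normalised kernel. Consecutive
    members of the chain \<open>g\<close>, \<open>P\<close>, \<open>S / N\<close>,
    \<open>Q / N\<close> differ by at most \<open>e / 3\<close>.\<close>
  define Q where "Q x = (\<Sum>p\<in>I. \<alpha> (w p) * character (w p) x)" for x
  define S where "S x = (\<Sum>p\<in>I. \<beta> (w p) * character (w p) x)" for x
  have card_fibre: "card {p \<in> I. w p = y} = card {a \<in> A. a + y \<in> A}" for y
  proof -
    have "{p \<in> I. w p = y} = (\<lambda>a. (a + y, a)) ` {a \<in> A. a + y \<in> A}"
      by (auto simp: I_def w_def image_iff algebra_simps)
    then show ?thesis
      by (simp add: card_image inj_on_def)
  qed
  have QS: "norm (Q x - S x) \<le> e / 3 * N" for x
  proof -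
    have contKx: "continuous_on UNIV (\<lambda>t. K (x - t))"
      by (rule continuous_on_compose2[OF contK]) (auto intro!: continuous_intros)
    have contKc: "continuous_on UNIV (\<lambda>t. complex_of_real (K (x - t)))"
      by (intro continuous_intros contKx)
    have "has_mean (\<lambda>t. g t * complex_of_real (K (x - t))) (Q x)"
      using has_mean_convolution[OF cont \<alpha> \<open>finite I\<close>, of w x] by (simp only: K Q_def)
    moreover have "has_mean (\<lambda>t. P t * complex_of_real (K (x - t))) (S x)"
      using has_mean_convolution[OF contP _ \<open>finite I\<close>, of \<beta> w x] has_mean_trig_poly[OF Y(1), of c]
      by (simp only: K S_def Y(2) \<beta>_def)
    ultimately have "has_mean (\<lambda>t. g t * complex_of_real (K (x - t)) - P t * complex_of_real (K (x - t))) (Q x - S x)"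
      by (intro has_mean_diff continuous_intros cont contP contKc)
    moreover have "has_mean (\<lambda>t. complex_of_real (e / 3 * K (x - t))) (complex_of_real (e / 3) * of_nat (card A))"
    proof -
      have "has_mean (\<lambda>t. 1 * character (- z) t) (if z = 0 then 1 else 0)" for z :: "real ^ 'n"
        using has_mean_character[of "- z"] by simp
      then have "has_mean (\<lambda>t. 1 * (\<Sum>p\<in>I. character (w p) (x - t)))
          (\<Sum>p\<in>I. (if w p = 0 then 1 else 0) * character (w p) x)"
        by (rule has_mean_convolution[OF continuous_on_const _ \<open>finite I\<close>])
      \<comment> \<open>Only pairs with equal entries contribute to the mean of the kernel, which is
        therefore \<open>card A\<close> for every \<open>x\<close>; this explains the normalisation
        by \<open>N\<close>.\<close>
      moreover have "(\<Sum>p\<in>I. (if w p = 0 then 1 else 0) * character (w p) x) = (\<Sum>p\<in>I. if w p = 0 then 1 else 0)"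
        by (rule sum.cong) auto
      moreover have "\<dots> = of_nat (card {p \<in> I. w p = 0})"
        using \<open>finite I\<close> by (simp add: sum.If_cases Int_def)
      ultimately have "has_mean (\<lambda>t. complex_of_real (K (x - t))) (of_nat (card A))"
        by (simp add: K card_fibre)
      from has_mean_cmult[OF this, of "complex_of_real (e / 3)"] show ?thesis
        by simp
    qed
    ultimately have "norm (Q x - S x) \<le> Re (complex_of_real (e / 3) * of_nat (card A))"
    proof (rule has_mean_norm_le)
      fix t
      have "norm (g t * complex_of_real (K (x - t)) - P t * complex_of_real (K (x - t))) = norm (g t - P t) * K (x - t)"
        using \<open>K (x - t) \<ge> 0\<close> by (simp add: norm_mult flip: left_diff_distrib)
      also have "\<dots> \<le> e / 3 * K (x - t)"
        using P(2) \<open>K (x - t) \<ge> 0\<close> by (rule mult_right_mono)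
      finally show "norm (g t * complex_of_real (K (x - t)) - P t * complex_of_real (K (x - t))) \<le> e / 3 * K (x - t)" .
    qed (intro continuous_intros cont contP contKc contKx)+
    then show ?thesis
      by (simp add: N_def)
  qed
  have S_eq: "S x = (\<Sum>y\<in>Y. of_nat (card {a \<in> A. a + y \<in> A}) * (c y * character y x))" for x
  proof -
    have "S x = (\<Sum>p\<in>I. \<Sum>y\<in>Y. if w p = y then c y * character y x else 0)"
      unfolding S_def using Y(1) by (intro sum.cong) (auto simp: \<beta>_def)
    also have "\<dots> = (\<Sum>y\<in>Y. \<Sum>p\<in>I. if w p = y then c y * character y x else 0)"
      by (rule sum.swap)
    also have "\<dots> = (\<Sum>y\<in>Y. of_nat (card {p \<in> I. w p = y}) * (c y * character y x))"
      using \<open>finite I\<close> by (intro sum.cong) (simp_all add: sum.If_cases Int_def)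
    finally show ?thesis
      by (simp only: card_fibre)
  qed
  have PS: "norm (complex_of_real N * P x - S x) \<le> e / 3 * N" for x
  proof -
    have card_le: "real (card {a \<in> A. a + y \<in> A}) \<le> N" for y
      unfolding N_def using A(1) by (simp add: card_mono)
    have "complex_of_real N * P x - S x =
        (\<Sum>y\<in>Y. complex_of_real (N - real (card {a \<in> A. a + y \<in> A})) * (c y * character y x))"
      unfolding S_eq Y(2) by (simp add: sum_distrib_left algebra_simps flip: sum_subtractf)
    also have "norm \<dots> \<le> (\<Sum>y\<in>Y. \<eta> * N * norm (c y))"
    proof (rule sum_norm_le)
      fix y assume "y \<in> Y"
      then have "N - real (card {a \<in> A. a + y \<in> A}) \<le> \<eta> * N"
        using A(3)[of y] by (simp add: N_def algebra_simps)
      then have "\<bar>N - real (card {a \<in> A. a + y \<in> A})\<bar> * norm (c y) \<le> \<eta> * N * norm (c y)"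
        using card_le[of y] by (intro mult_right_mono) auto
      then show "norm (complex_of_real (N - real (card {a \<in> A. a + y \<in> A})) * (c y * character y x)) \<le> \<eta> * N * norm (c y)"
        by (simp only: norm_mult norm_of_real norm_character mult_1_right)
    qed
    also have "\<dots> = (\<eta> * C) * N"
      by (simp add: C_def sum_distrib_left mult_ac)
    also have "\<dots> \<le> e / 3 * N"
    proof (rule mult_right_mono)
      have "e * C \<le> e * (C + 1)"
        using e by simp
      then show "\<eta> * C \<le> e / 3"
        using \<open>C \<ge> 0\<close> by (simp add: \<eta>_def field_simps)
    qed (use \<open>N > 0\<close> in simp)
    finally show ?thesis .
  qed
  show ?thesis
  proof (rule that)
    \<comment> \<open>Frequencies outside \<open>G\<close> carry the coefficient 0 by
      \<open>\<alpha>0\<close>, so discarding them does not change the sum.\<close>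
    show "finite {p \<in> I. w p \<in> G}" "w ` {p \<in> I. w p \<in> G} \<subseteq> G"
      using \<open>finite I\<close> by auto
    fix x
    have "(\<Sum>p\<in>{p \<in> I. w p \<in> G}. (\<alpha> (w p) / complex_of_real N) * character (w p) x) =
        (\<Sum>p\<in>I. (\<alpha> (w p) / complex_of_real N) * character (w p) x)"
      using \<open>finite I\<close> \<alpha>0 by (intro sum.mono_neutral_left) auto
    also have "\<dots> = Q x / complex_of_real N"
      by (simp add: Q_def sum_divide_distrib)
    finally have eq: "(\<Sum>p\<in>{p \<in> I. w p \<in> G}. (\<alpha> (w p) / complex_of_real N) * character (w p) x) = Q x / complex_of_real N" .
    have "norm (complex_of_real N * P x - Q x) \<le> 2 * e / 3 * N"
      using norm_triangle_ineq[of "complex_of_real N * P x - S x" "S x - Q x"] PS[of x] QS[of x]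
      by (simp add: norm_minus_commute)
    moreover have "complex_of_real N * (P x - Q x / complex_of_real N) = complex_of_real N * P x - Q x"
      using \<open>N > 0\<close> by (simp add: right_diff_distrib)
    then have "N * norm (P x - Q x / complex_of_real N) = norm (complex_of_real N * P x - Q x)"
      using \<open>N > 0\<close> by (metis abs_of_pos norm_mult norm_of_real)
    ultimately have "N * norm (P x - Q x / complex_of_real N) \<le> N * (2 * e / 3)"
      by (simp add: mult.commute)
    then have "norm (P x - Q x / complex_of_real N) \<le> 2 * e / 3"
      using \<open>N > 0\<close> by simp
    then show "norm (g x - (\<Sum>p\<in>{p \<in> I. w p \<in> G}. (\<alpha> (w p) / complex_of_real N) * character (w p) x)) \<le> e"
      unfolding eq using P(2)[of x] norm_triangle_ineq[of "g x - P x" "P x - Q x / complex_of_real N"] by simp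
  qed
qed

section \<open>Means of convolutions with the counting measure\<close>

lemma min_separation_less_eq:
  assumes "x \<in> \<Lambda>" "y \<in> \<Lambda>" "x \<noteq> y"
  shows "min_separation \<Lambda> \<le> dist x y"
  unfolding min_separation_def
proof (rule cInf_lower)
  show "dist x y \<in> {norm (b - a) | a b. a \<in> \<Lambda> \<and> b \<in> \<Lambda> \<and> a \<noteq> b}"
    using assms by (auto simp: dist_norm)
  show "bdd_below {norm (b - a) | a b. a \<in> \<Lambda> \<and> b \<in> \<Lambda> \<and> a \<noteq> b}"
    by (rule bdd_belowI[of _ 0]) auto
qed

lemma delone_finite_Int_bounded:
  assumes "delone \<Lambda>" "bounded S"
  shows "finite (\<Lambda> \<inter> S)"
proof (rule finite_bounded_separated)
  show "bounded (\<Lambda> \<inter> S)"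
    using assms(2) by (rule bounded_subset) auto
  show "min_separation \<Lambda> > 0"
    using assms(1) by (simp add: delone_def)
  show "x = y" if "x \<in> \<Lambda> \<inter> S" "y \<in> \<Lambda> \<inter> S" "dist x y < min_separation \<Lambda>" for x y
    using that min_separation_less_eq[of x \<Lambda> y] by auto
qed

text \<open>A packing argument: balls of radius \<open>s\<close>, half the separation, around the
  points in the shell are pairwise disjoint and lie in the shell widened by \<open>s\<close> on both
  sides.\<close>

lemma card_shell_le:
  fixes \<Lambda> :: "(real ^ 'n) set"
  assumes "delone \<Lambda>" and "c \<ge> 0" and s: "s = min_separation \<Lambda> / 2"
  shows "real (card (\<Lambda> \<inter> (ball 0 (R + c) - ball 0 (R - c)))) * measure lborel (ball (0 :: real ^ 'n) s) \<le>
    measure lborel (ball (0 :: real ^ 'n) (R + (c + s))) - measure lborel (ball (0 :: real ^ 'n) (R - (c + s)))"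
proof -
  define F where "F = \<Lambda> \<inter> (ball 0 (R + c) - ball 0 (R - c))"
  have "s > 0"
    using assms by (simp add: delone_def)
  have fin: "finite F"
    unfolding F_def by (rule delone_finite_Int_bounded[OF assms(1)]) (auto intro: bounded_subset[OF bounded_ball])
  have ball_measure: "measure lborel (ball a s) = measure lborel (ball (0 :: real ^ 'n) s)" for a :: "real ^ 'n"
    using content_ball_conv_unit_ball[of s a] content_ball_conv_unit_ball[of s "0 :: real ^ 'n"] \<open>s > 0\<close> by simp
  have fm: "ball a r \<in> fmeasurable lborel" for a :: "real ^ 'n" and r
    using emeasure_lborel_ball_finite[of a r] by (intro fmeasurableI) auto
  have disj: "disjoint_family_on (\<lambda>a. ball a s) F"
    unfolding disjoint_family_on_def
  proof (intro ballI impI)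
    fix a b assume ab: "a \<in> F" "b \<in> F" "a \<noteq> b"
    then have "2 * s \<le> dist a b"
      using min_separation_less_eq[of a \<Lambda> b] by (simp add: F_def s)
    then show "ball a s \<inter> ball b s = {}"
      by (intro disjoint_ballI) simp
  qed
  have "measure lborel (\<Union>a\<in>F. ball a s) = (\<Sum>a\<in>F. measure lborel (ball a s))"
  proof (rule measure_finite_Union[OF fin _ disj])
    show "emeasure lborel (ball a s) \<noteq> \<infinity>" for a :: "real ^ 'n"
      using emeasure_lborel_ball_finite[of a s] by (simp add: less_top)
  qed auto
  also have "\<dots> = (\<Sum>a\<in>F. measure lborel (ball (0 :: real ^ 'n) s))"
    by (rule sum.cong[OF refl], rule ball_measure)
  finally have U: "measure lborel (\<Union>a\<in>F. ball a s) = real (card F) * measure lborel (ball (0 :: real ^ 'n) s)"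
    by simp
  have Ufm: "(\<Union>a\<in>F. ball a s) \<in> fmeasurable lborel"
    using fin fm by (intro fmeasurable.finite_UN) auto
  have out: "norm x < R + (c + s)" "\<not> norm x < R - (c + s)" if "a \<in> F" "dist a x < s" for a x
    using that norm_triangle_ineq2[of a x] norm_triangle_ineq2[of x a]
    by (auto simp: F_def dist_norm norm_minus_commute)
  have "measure lborel ((\<Union>a\<in>F. ball a s) \<union> ball 0 (R - (c + s))) =
      measure lborel (\<Union>a\<in>F. ball a s) + measure lborel (ball (0 :: real ^ 'n) (R - (c + s)))"
  proof (rule measure_Union)
    show "emeasure lborel (\<Union>a\<in>F. ball a s) \<noteq> \<infinity>" "emeasure lborel (ball (0 :: real ^ 'n) (R - (c + s))) \<noteq> \<infinity>"
      using Ufm fm by (auto simp: fmeasurable_def less_top)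
    show "(\<Union>a\<in>F. ball a s) \<inter> ball 0 (R - (c + s)) = {}"
      using out by force
  qed (use fin in auto)
  moreover have "measure lborel ((\<Union>a\<in>F. ball a s) \<union> ball 0 (R - (c + s))) \<le> measure lborel (ball (0 :: real ^ 'n) (R + (c + s)))"
  proof (rule measure_mono_fmeasurable)
    have "ball 0 (R - (c + s)) \<subseteq> ball (0 :: real ^ 'n) (R + (c + s))"
      using \<open>c \<ge> 0\<close> \<open>s > 0\<close> by (intro subset_ball) simp
    moreover have "(\<Union>a\<in>F. ball a s) \<subseteq> ball 0 (R + (c + s))"
      using out(1) by auto
    ultimately show "(\<Union>a\<in>F. ball a s) \<union> ball 0 (R - (c + s)) \<subseteq> ball 0 (R + (c + s))"
      by blast
    show "(\<Union>a\<in>F. ball a s) \<union> ball 0 (R - (c + s)) \<in> sets lborel"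
      by (intro sets.Un fmeasurableD[OF Ufm] fmeasurableD[OF fm])
  qed (rule fm)
  ultimately show ?thesis
    using U by (simp add: F_def)
qed

text \<open>The finite index set depends on \<open>R\<close> and not on \<open>x\<close>, so that
  continuity of the convolution and its integration over a ball reduce to finite sums.\<close>

lemma conv_counting_eq_sum:
  assumes "delone \<Lambda>" and supp: "\<forall>x. norm x \<ge> c \<longrightarrow> f x = 0" and "norm x < R"
  shows "conv_counting \<Lambda> f x = (\<Sum>a\<in>\<Lambda> \<inter> ball 0 (R + c). f (x - a))"
proof -
  have "conv_counting \<Lambda> f x = (\<Sum>\<^sub>\<infinity>a\<in>\<Lambda> \<inter> ball 0 (R + c). f (x - a))"
    unfolding conv_counting_def
  proof (rule infsum_cong_neutral)
    fix a assume "a \<in> \<Lambda> - \<Lambda> \<inter> ball 0 (R + c)"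
    then have "norm a \<ge> R + c"
      by auto
    then have "norm (x - a) \<ge> c"
      using assms(3) norm_triangle_ineq2[of a x] by (simp add: norm_minus_commute)
    then show "f (x - a) = 0"
      by (simp add: supp)
  qed auto
  then show ?thesis
    using delone_finite_Int_bounded[OF assms(1) bounded_ball] by simp
qed


lemma continuous_conv_counting:
  assumes "delone \<Lambda>" and supp: "\<forall>x. norm x \<ge> c \<longrightarrow> f x = 0" and cont: "continuous_on UNIV f"
  shows "continuous_on UNIV (conv_counting \<Lambda> f)"
proof -
  have "continuous_on (ball 0 R) (conv_counting \<Lambda> f)" for R
  proof -
    have "continuous_on (ball 0 R) (\<lambda>x. \<Sum>a\<in>\<Lambda> \<inter> ball 0 (R + c). f (x - a))"
      by (intro continuous_intros continuous_on_compose2[OF cont]) auto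
    moreover have "conv_counting \<Lambda> f x = (\<Sum>a\<in>\<Lambda> \<inter> ball 0 (R + c). f (x - a))" if "x \<in> ball 0 R" for x
      using that by (intro conv_counting_eq_sum[OF assms(1) supp]) auto
    ultimately show ?thesis
      by (metis (no_types, lifting) continuous_on_cong)
  qed
  then have "continuous_on (\<Union>R. ball 0 R) (conv_counting \<Lambda> f)"
    by (intro continuous_on_open_UN) auto
  moreover have "(\<Union>R. ball (0 :: real ^ 'a) R) = UNIV"
    using gt_ex by auto
  ultimately show ?thesis
    by simp
qed

text \<open>Only the points of \<open>\<Lambda>\<close> in a shell of fixed width around the sphere of radius \<open>R\<close> contribute to
  the difference of the two sides, and their number is negligible against the volume of the ball.\<close>

lemma ball_mean_conv_counting:
  fixes \<Lambda> :: "(real ^ 'n) set"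
  assumes delone: "delone \<Lambda>" and c: "c \<ge> 0" and supp: "\<forall>x. norm x \<ge> c \<longrightarrow> f x = 0"
    and cont: "continuous_on UNIV f"
  obtains F where "((\<lambda>R. ball_mean (\<lambda>x. conv_counting \<Lambda> f x * character (- y) x) R -
      F * ((\<Sum>a\<in>\<Lambda> \<inter> ball 0 R. character (- y) a) /\<^sub>R measure lborel (ball (0 :: real ^ 'n) R))) \<longlongrightarrow> 0) at_top"
proof -
  define h where "h x = f x * character (- y) x" for x
  define F where "F = (LINT x|lborel. h x)"
  define C where "C = (LINT x|lborel. norm (h x))"
  have conth: "continuous_on UNIV h"
    unfolding h_def by (intro continuous_intros cont)
  have h0: "h x = 0" if "norm x \<ge> c" for x
    using supp that by (simp add: h_def)
  have inth: "integrable lborel h"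
  proof -
    have "integrable lborel (\<lambda>x. indicator (cball 0 c) x *\<^sub>R h x)"
      by (rule borel_integrable_compact) (auto intro: continuous_on_subset[OF conth])
    moreover have "(\<lambda>x. indicator (cball 0 c) x *\<^sub>R h x) = h"
      using h0 by (auto simp: fun_eq_iff indicator_def not_le intro!: h0[symmetric])
    ultimately show ?thesis
      by simp
  qed
  have meash: "h \<in> borel_measurable borel"
    using inth by (simp add: borel_measurable_integrable)
  have C: "norm F \<le> C" "C \<ge> 0"
    unfolding F_def C_def by (auto intro: Bochner_Integration.integral_nonneg)
  define s where "s = min_separation \<Lambda> / 2"
  have "s > 0"
    using delone by (simp add: delone_def s_def)
  then have V: "measure lborel (ball (0 :: real ^ 'n) s) > 0"
    by (rule content_ball_pos)
  define W where "W R = measure lborel (ball (0 :: real ^ 'n) (R + (c + s))) - measure lborel (ball (0 :: real ^ 'n) (R - (c + s)))" for R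
  have bound: "norm ((LINT x:ball 0 R|lborel. conv_counting \<Lambda> f x * character (- y) x) -
      F * (\<Sum>a\<in>\<Lambda> \<inter> ball 0 R. character (- y) a)) \<le> 2 * C / measure lborel (ball (0 :: real ^ 'n) s) * W R" for R
  proof -
    define A where "A = \<Lambda> \<inter> ball 0 (R + c)"
    have "finite A"
      unfolding A_def by (rule delone_finite_Int_bounded[OF delone bounded_ball])
    define J where "J a = (LINT x|lborel. indicator (ball 0 R) x *\<^sub>R h (x - a))" for a
    have int_shift: "integrable lborel (\<lambda>x. indicator (ball 0 R) x *\<^sub>R h (x - a))" for a
      using set_integrable_ball[of "\<lambda>x. h (x - a)" 0 R]
      by (simp add: set_integrable_def continuous_on_compose2[OF conth] continuous_intros)
    have "indicator (ball 0 R) x *\<^sub>R (conv_counting \<Lambda> f x * character (- y) x) =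
        (\<Sum>a\<in>A. character (- y) a * (indicator (ball 0 R) x *\<^sub>R h (x - a)))" for x
    proof (cases "x \<in> ball 0 R")
      case True
      then have eq: "conv_counting \<Lambda> f x = (\<Sum>a\<in>A. f (x - a))"
        unfolding A_def by (intro conv_counting_eq_sum[OF delone supp]) auto
      have "character (- y) x = character (- y) a * character (- y) (x - a)" for a
        by (simp flip: character_add)
      then have "f (x - a) * character (- y) x = character (- y) a * h (x - a)" for a
        by (simp add: h_def)
      then show ?thesis
        using True by (simp add: eq sum_distrib_right)
    qed simp
    then have "(LINT x:ball 0 R|lborel. conv_counting \<Lambda> f x * character (- y) x) =
        (LINT x|lborel. (\<Sum>a\<in>A. character (- y) a * (indicator (ball 0 R) x *\<^sub>R h (x - a))))"
      by (simp add: set_lebesgue_integral_def)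
    also have "\<dots> = (\<Sum>a\<in>A. LINT x|lborel. character (- y) a * (indicator (ball 0 R) x *\<^sub>R h (x - a)))"
      by (intro Bochner_Integration.integral_sum integrable_mult_right int_shift)
    also have "\<dots> = (\<Sum>a\<in>A. character (- y) a * J a)"
      by (simp only: J_def integral_mult_right_zero)
    finally have lhs: "(LINT x:ball 0 R|lborel. conv_counting \<Lambda> f x * character (- y) x) = (\<Sum>a\<in>A. character (- y) a * J a)" .
    define D where "D = \<Lambda> \<inter> (ball 0 (R + c) - ball 0 (R - c))"
    have "finite D"
      unfolding D_def by (rule delone_finite_Int_bounded[OF delone]) (auto intro: bounded_subset[OF bounded_ball])
    have "(\<Sum>a\<in>\<Lambda> \<inter> ball 0 R. character (- y) a) = (\<Sum>a\<in>A. if norm a < R then character (- y) a else 0)"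
      using \<open>finite A\<close> c by (intro sum.mono_neutral_cong_left) (auto simp: A_def)
    then have "(LINT x:ball 0 R|lborel. conv_counting \<Lambda> f x * character (- y) x) - F * (\<Sum>a\<in>\<Lambda> \<inter> ball 0 R. character (- y) a) =
        (\<Sum>a\<in>A. character (- y) a * (J a - (if norm a < R then F else 0)))"
      unfolding lhs by (simp add: sum_distrib_left flip: sum_subtractf) (rule sum.cong, simp_all add: algebra_simps)
    also have "\<dots> = (\<Sum>a\<in>D. character (- y) a * (J a - (if norm a < R then F else 0)))"
    proof (rule sum.mono_neutral_right[OF \<open>finite A\<close>])
      show "D \<subseteq> A"
        by (auto simp: D_def A_def)
      show "\<forall>a\<in>A - D. character (- y) a * (J a - (if norm a < R then F else 0)) = 0"
      proof
        fix a assume "a \<in> A - D"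
        then have a: "norm a < R - c"
          by (auto simp: A_def D_def)
        \<comment> \<open>Since \<open>a\<close> has distance more than \<open>c\<close> from the
          sphere of radius \<open>R\<close>, the support of the translate of \<open>h\<close> by
          \<open>a\<close> lies inside the ball.\<close>
        have "indicator (ball 0 R) x *\<^sub>R h (x - a) = h (- a + x)" for x
        proof (cases "norm x < R")
          case False
          then have "norm (x - a) \<ge> c"
            using a norm_triangle_ineq2[of x a] by simp
          then show ?thesis
            by (simp add: h0)
        qed simp
        then have "J a = (LINT x|lborel. h (- a + x))"
          by (simp add: J_def)
        then have "J a = F"
          unfolding F_def by (simp only: integral_translate[OF meash])
        then show "character (- y) a * (J a - (if norm a < R then F else 0)) = 0"
          using a c by simp
      qed
    qed
    also have "norm \<dots> \<le> (\<Sum>a\<in>D. 2 * C)"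
    proof (rule sum_norm_le)
      fix a
      have "norm (J a) \<le> (LINT x|lborel. norm (h (- a + x)))"
        unfolding J_def
      proof (rule Bochner_Integration.integral_norm_bound_integral[OF int_shift])
        have "integrable (distr lborel borel ((+) (- a))) (\<lambda>x. norm (h x))"
          using inth by (simp add: lborel_distr_plus)
        then show "integrable lborel (\<lambda>x. norm (h (- a + x)))"
          by (subst (asm) integrable_distr_eq) (use meash in auto)
      qed (simp add: indicator_def)
      also have "\<dots> = C"
        using integral_translate[of "\<lambda>x. complex_of_real (norm (h x))" "- a"] meash by (simp add: C_def)
      finally have "norm (J a) \<le> C" .
      then have "norm (J a - (if norm a < R then F else 0)) \<le> 2 * C"
        using C norm_triangle_ineq4[of "J a" F] by auto
      then show "norm (character (- y) a * (J a - (if norm a < R then F else 0))) \<le> 2 * C"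
        by (simp add: norm_mult)
    qed
    also have "\<dots> = 2 * C / measure lborel (ball (0 :: real ^ 'n) s) * (real (card D) * measure lborel (ball (0 :: real ^ 'n) s))"
      using V by simp
    also have "\<dots> \<le> 2 * C / measure lborel (ball (0 :: real ^ 'n) s) * W R"
      unfolding D_def W_def using card_shell_le[OF delone c s_def, of R] C V by (intro mult_left_mono) simp_all
    finally show ?thesis .
  qed
  have "((\<lambda>R. 2 * C / measure lborel (ball (0 :: real ^ 'n) s) * (W R / measure lborel (ball (0 :: real ^ 'n) R))) \<longlongrightarrow>
      2 * C / measure lborel (ball (0 :: real ^ 'n) s) * 0) at_top"
    unfolding W_def by (intro tendsto_intros shell_volume_tendsto)
  then have lim: "((\<lambda>R. 2 * C / measure lborel (ball (0 :: real ^ 'n) s) * (W R / measure lborel (ball (0 :: real ^ 'n) R))) \<longlongrightarrow> 0) at_top"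
    by simp
  show ?thesis
  proof (rule that, rule Lim_null_comparison[OF always_eventually lim], intro allI)
    fix R
    let ?V = "measure lborel (ball (0 :: real ^ 'n) R)"
    have "ball_mean (\<lambda>x. conv_counting \<Lambda> f x * character (- y) x) R - F * ((\<Sum>a\<in>\<Lambda> \<inter> ball 0 R. character (- y) a) /\<^sub>R ?V) =
        ((LINT x:ball 0 R|lborel. conv_counting \<Lambda> f x * character (- y) x) - F * (\<Sum>a\<in>\<Lambda> \<inter> ball 0 R. character (- y) a)) /\<^sub>R ?V"
      by (simp add: ball_mean_def scaleR_diff_right)
    also have "norm \<dots> = norm ((LINT x:ball 0 R|lborel. conv_counting \<Lambda> f x * character (- y) x) - F * (\<Sum>a\<in>\<Lambda> \<inter> ball 0 R. character (- y) a)) / ?V"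
      by (simp add: divide_inverse mult.commute)
    also have "\<dots> \<le> (2 * C / measure lborel (ball (0 :: real ^ 'n) s) * W R) / ?V"
      using bound[of R] by (rule divide_right_mono) simp
    finally show "norm (ball_mean (\<lambda>x. conv_counting \<Lambda> f x * character (- y) x) R - F * ((\<Sum>a\<in>\<Lambda> \<inter> ball 0 R. character (- y) a) /\<^sub>R ?V)) \<le>
        2 * C / measure lborel (ball (0 :: real ^ 'n) s) * (W R / ?V)"
      by simp
  qed
qed

text \<open>Membership in the spectrum includes convergence of the averages \<open>S\<close> over
  \<open>\<Lambda>\<close>, so convergence must be derived and not presupposed. A nonzero mean of
  the convolution forces \<open>F \<noteq> 0\<close>, and dividing by \<open>F\<close> shows that
  \<open>S\<close> converges to a nonzero limit.\<close>

lemma mean_zero_outside_spectrum: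
  fixes \<Lambda> :: "(real ^ 'n) set"
  assumes delone: "delone \<Lambda>" and c: "c \<ge> 0" and supp: "\<forall>x. norm x \<ge> c \<longrightarrow> f x = 0"
    and cont: "continuous_on UNIV f"
    and mean: "has_mean (\<lambda>x. conv_counting \<Lambda> f x * character (- y) x) \<alpha>" and y: "y \<notin> spectrum \<Lambda>"
  shows "\<alpha> = 0"
proof (rule ccontr)
  assume "\<alpha> \<noteq> 0"
  define S where "S R = (\<Sum>a\<in>\<Lambda> \<inter> ball 0 R. character (- y) a) /\<^sub>R measure lborel (ball (0 :: real ^ 'n) R)" for R
  obtain F where F: "((\<lambda>R. ball_mean (\<lambda>x. conv_counting \<Lambda> f x * character (- y) x) R - F * S R) \<longlongrightarrow> 0) at_top"
    unfolding S_def by (fact ball_mean_conv_counting[OF delone c supp cont])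
  have "((\<lambda>R. ball_mean (\<lambda>x. conv_counting \<Lambda> f x * character (- y) x) R -
      (ball_mean (\<lambda>x. conv_counting \<Lambda> f x * character (- y) x) R - F * S R)) \<longlongrightarrow> \<alpha> - 0) at_top"
    using mean unfolding has_mean_def by (intro tendsto_diff F)
  then have FS: "((\<lambda>R. F * S R) \<longlongrightarrow> \<alpha>) at_top"
    by simp
  have "F \<noteq> 0"
  proof
    assume "F = 0"
    then have "((\<lambda>R::real. 0) \<longlongrightarrow> \<alpha>) at_top"
      using FS by simp
    then show False
      using \<open>\<alpha> \<noteq> 0\<close> by (simp add: tendsto_const_iff)
  qed
  then have "(S \<longlongrightarrow> \<alpha> / F) at_top"
    using tendsto_divide[OF FS tendsto_const, of F] by simp
  then have "has_fourier_coeff \<Lambda> y (\<alpha> / F)"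
    by (simp add: has_fourier_coeff_def S_def[abs_def])
  then have "y \<in> spectrum \<Lambda>"
    using \<open>F \<noteq> 0\<close> \<open>\<alpha> \<noteq> 0\<close> unfolding spectrum_def by (auto intro!: exI[of _ "\<alpha> / F"])
  then show False
    using y by simp
qed

section \<open>Almost periods of the point set\<close>

lemma almost_periodic_approx:
  assumes "g \<in> almost_periodic_funs" "e > 0"
  shows "\<exists>P\<in>trig_polys. \<forall>x. norm (g x - P x) \<le> e"
proof -
  obtain G where G: "G \<in> closure {p. apply_bcontfun p \<in> trig_polys}" "g = apply_bcontfun G"
    using assms(1) by (auto simp: almost_periodic_funs_def)
  then obtain p where p: "apply_bcontfun p \<in> trig_polys" "dist p G < e"
    using assms(2) by (auto simp: closure_approachable)
  have "norm (g x - apply_bcontfun p x) \<le> e" for x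
    using dist_bounded[of p x G] p(2) by (simp add: G(2) dist_norm norm_minus_commute)
  then show ?thesis
    using p(1) by blast
qed

text \<open>All frequencies of the approximating polynomial have the form
  \<open>transpose M *v l\<close> with \<open>l\<close> integral, so a translation by
  \<open>t\<close> affects it only through \<open>M *v t\<close> modulo integer vectors. The
  constant \<open>d\<close> depends on this one polynomial, hence not on the point
  \<open>x\<close>.\<close>

lemma conv_counting_almost_periods:
  fixes M :: "real ^ 'n ^ 'm"
  assumes delone: "delone \<Lambda>" and bohr: "bohr_almost_periodic \<Lambda>" and assoc: "associated_with M \<Lambda>"
    and c: "c \<ge> 0" and supp: "\<forall>x. norm x \<ge> c \<longrightarrow> f x = 0" and cont: "continuous_on UNIV f" and e: "e > 0"
  obtains d where "d > 0" "\<And>t k x. \<lbrakk>\<And>i. k $ i \<in> \<int>; norm (M *v t - k) < d\<rbrakk> \<Longrightarrow>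
    norm (conv_counting \<Lambda> f (x + t) - conv_counting \<Lambda> f x) < e"
proof -
  let ?g = "conv_counting \<Lambda> f"
  define G where "G = {transpose M *v k | k. \<forall>i. k $ i \<in> \<int>}"
  have "{x. f x \<noteq> 0} \<subseteq> cball 0 c"
    using supp by (force simp: not_le[symmetric])
  then have "compact (closure {x. f x \<noteq> 0})"
    by (meson bounded_cball bounded_subset compact_closure)
  then have "?g \<in> almost_periodic_funs"
    using bohr cont by (simp add: bohr_almost_periodic_def compactly_supported_def)
  then have approx: "\<forall>e>0. \<exists>P\<in>trig_polys. \<forall>x. norm (?g x - P x) \<le> e"
    using almost_periodic_approx by blast
  have contg: "continuous_on UNIV ?g"
    by (rule continuous_conv_counting[OF delone supp cont])
  have spec: "\<forall>z. z \<notin> G \<longrightarrow> has_mean (\<lambda>x. ?g x * character (- z) x) 0"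
  proof (intro allI impI)
    fix z assume z: "z \<notin> G"
    obtain \<alpha> where \<alpha>: "has_mean (\<lambda>x. ?g x * character (- z) x) \<alpha>"
      using trig_poly_approx_has_mean[OF contg approx] by blast
    have "z \<notin> spectrum \<Lambda>"
      using assoc z by (auto simp: associated_with_def G_def)
    then show "has_mean (\<lambda>x. ?g x * character (- z) x) 0"
      using \<alpha> mean_zero_outside_spectrum[OF delone c supp cont \<alpha>] by simp
  qed
  have e4: "e / 4 > 0"
    using e by simp
  obtain I :: "((real ^ 'n) \<times> (real ^ 'n)) set" and w b where I: "finite I" "w ` I \<subseteq> G"
    "\<And>x. norm (?g x - (\<Sum>p\<in>I. b p * character (w p) x)) \<le> e / 4"
    by (fact trig_poly_approx_spectral[OF contg approx spec e4])
  have "\<forall>p\<in>I. \<exists>k. (\<forall>i. k $ i \<in> \<int>) \<and> w p = transpose M *v k"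
    using I(2) unfolding G_def by blast
  then obtain l where l: "\<And>p i. p \<in> I \<Longrightarrow> l p $ i \<in> \<int>" "\<And>p. p \<in> I \<Longrightarrow> w p = transpose M *v l p"
    by metis
  \<comment> \<open>With \<open>u = M *v t - k\<close>, this bounds the change of the polynomial
    under translation by \<open>t\<close>, at all points simultaneously; it is continuous and
    vanishes at 0.\<close>
  define H where "H u = (\<Sum>p\<in>I. norm (b p) * norm (character (l p) u - 1))" for u
  have "continuous_on UNIV H"
    unfolding H_def by (intro continuous_intros)
  then have "continuous (at 0) H"
    by (simp add: continuous_on_eq_continuous_at)
  moreover have "H 0 = 0"
    by (simp add: H_def)
  ultimately have "\<forall>e>0. \<exists>d>0. \<forall>u. norm u < d \<longrightarrow> \<bar>H u\<bar> < e"
    unfolding continuous_at_eps_delta by (simp add: dist_norm)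
  then obtain d where d: "d > 0" "\<And>u. norm u < d \<Longrightarrow> \<bar>H u\<bar> < e / 4"
    using e4 by blast
  show ?thesis
  proof (rule that[OF d(1)])
    fix t :: "real ^ 'n" and k :: "real ^ 'm" and x
    assume k: "\<And>i. k $ i \<in> \<int>" and small: "norm (M *v t - k) < d"
    let ?Q = "\<lambda>x. \<Sum>p\<in>I. b p * character (w p) x"
    have shift: "character (w p) t = character (l p) (M *v t - k)" if "p \<in> I" for p
    proof -
      have "w p \<bullet> t - l p \<bullet> (M *v t - k) = l p \<bullet> k"
        using l(2)[OF that] by (simp add: dot_lmul_matrix inner_diff_right)
      moreover have "l p \<bullet> k \<in> \<int>"
        unfolding inner_vec_def using l(1)[OF that] k by (auto intro: Ints_sum Ints_mult)
      ultimately show ?thesis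
        unfolding character_def exp_2pi_i_eq_iff by simp
    qed
    have "?Q (x + t) - ?Q x = (\<Sum>p\<in>I. b p * character (w p) x * (character (w p) t - 1))"
      by (simp add: character_add algebra_simps flip: sum_subtractf)
    also have "norm \<dots> \<le> H (M *v t - k)"
      unfolding H_def by (rule sum_norm_le) (simp add: norm_mult shift)
    also have "\<dots> < e / 4"
      using d(2)[OF small] by simp
    finally have "norm (?Q (x + t) - ?Q x) < e / 4" .
    moreover have eq: "?g (x + t) - ?g x = (?g (x + t) - ?Q (x + t)) + (?Q (x + t) - ?Q x) - (?g x - ?Q x)"
      by simp
    ultimately show "norm (?g (x + t) - ?g x) < e"
      unfolding eq
      using I(3)[of "x + t"] I(3)[of x] norm_triangle_ineq4[of "(?g (x + t) - ?Q (x + t)) + (?Q (x + t) - ?Q x)" "?g x - ?Q x"]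
        norm_triangle_ineq[of "?g (x + t) - ?Q (x + t)" "?Q (x + t) - ?Q x"] e
      by linarith
  qed
qed

text \<open>For a tent function of radius \<open>e\<close> and height 1, the convolution is at least
  1 at each point \<open>a\<close> of \<open>\<Lambda>\<close>: the term of \<open>a\<close> is 1
  and all others are nonnegative. A change of less than 1 leaves it nonzero at \<open>a + t\<close>,
  where some tent must therefore be present.\<close>

proposition delone_almost_periods:
  fixes M :: "real ^ 'n ^ 'm"
  assumes delone: "delone \<Lambda>" and bohr: "bohr_almost_periodic \<Lambda>" and assoc: "associated_with M \<Lambda>" and e: "e > 0"
  obtains d where "d > 0" "\<And>t k a. \<lbrakk>\<And>i. k $ i \<in> \<int>; norm (M *v t - k) < d; a \<in> \<Lambda>\<rbrakk> \<Longrightarrow> \<exists>b\<in>\<Lambda>. dist b (a + t) < e"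
proof -
  define f where "f x = complex_of_real (max 0 (1 - norm x / e))" for x :: "real ^ 'n"
  have supp: "\<forall>x. norm x \<ge> e \<longrightarrow> f x = 0"
    using e by (simp add: f_def field_simps)
  have cont: "continuous_on UNIV f"
    unfolding f_def by (intro continuous_intros) (use e in auto)
  have e0: "e \<ge> 0"
    using e by simp
  obtain d where d: "d > 0" "\<And>t k x. \<lbrakk>\<And>i. k $ i \<in> \<int>; norm (M *v t - k) < d\<rbrakk> \<Longrightarrow>
    norm (conv_counting \<Lambda> f (x + t) - conv_counting \<Lambda> f x) < 1"
    by (fact conv_counting_almost_periods[OF delone bohr assoc e0 supp cont zero_less_one])
  show ?thesis
  proof (rule that[OF d(1)])
    fix t :: "real ^ 'n" and k :: "real ^ 'm" and a
    assume k: "\<And>i. k $ i \<in> \<int>" "norm (M *v t - k) < d" and a: "a \<in> \<Lambda>"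
    define A where "A = \<Lambda> \<inter> ball 0 (norm a + 1 + e)"
    have "finite A"
      unfolding A_def by (rule delone_finite_Int_bounded[OF delone bounded_ball])
    have "conv_counting \<Lambda> f a = (\<Sum>b\<in>A. f (a - b))"
      unfolding A_def by (rule conv_counting_eq_sum[OF delone supp]) auto
    moreover have "Re (f (a - a)) \<le> (\<Sum>b\<in>A. Re (f (a - b)))"
      by (rule member_le_sum) (use a e \<open>finite A\<close> in \<open>auto simp: A_def f_def\<close>)
    ultimately have "Re (conv_counting \<Lambda> f a) \<ge> 1"
      by (simp add: f_def)
    then have "conv_counting \<Lambda> f (a + t) \<noteq> 0"
      using d(2)[OF k, of a] complex_Re_le_cmod[of "conv_counting \<Lambda> f a"] by auto
    then have "\<exists>b\<in>\<Lambda>. f (a + t - b) \<noteq> 0"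
      unfolding conv_counting_def using infsum_0 by metis
    then obtain b where "b \<in> \<Lambda>" "f (a + t - b) \<noteq> 0" ..
    moreover from this have "norm (a + t - b) < e"
      using supp by (meson not_le)
    ultimately show "\<exists>b\<in>\<Lambda>. dist b (a + t) < e"
      by (auto simp: dist_norm norm_minus_commute)
  qed
qed

section \<open>The lifted closure covers the orthogonal complement\<close>

declare transpose_matrix_vector [simp del]

locale isometric_embedding =
  fixes M :: "real ^ 'n ^ 'm"
  assumes isometry: "transpose M ** M = mat 1"
begin

definition Q :: "real ^ 'm \<Rightarrow> real ^ 'm"
  where "Q x = x - M *v (transpose M *v x)"

text \<open>The kernel of the transpose is the orthogonal complement of the range of
  \<open>M\<close>.\<close>

definition V :: "(real ^ 'm) set"
  where "V = {v. transpose M *v v = 0}"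

lemma transpose_M_M [simp]: "transpose M *v (M *v x) = x"
  by (simp add: matrix_vector_mul_assoc isometry)

lemma Q_diff: "Q (x - y) = Q x - Q y"
  by (simp add: Q_def matrix_vector_mult_diff_distrib)

lemma Q_add: "Q (x + y) = Q x + Q y"
  by (simp add: Q_def matrix_vector_right_distrib)

lemma Q_M [simp]: "Q (M *v x) = 0"
  by (simp add: Q_def)

lemma Q_in_V: "Q x \<in> V"
  by (simp add: Q_def V_def matrix_vector_mult_diff_distrib)

lemma Q_ident: "v \<in> V \<Longrightarrow> Q v = v"
  by (simp add: Q_def V_def)

lemma inner_transpose: "(transpose M *v x) \<bullet> y = x \<bullet> (M *v y)"
  by (simp add: dot_lmul_matrix transpose_matrix_vector)

lemma norm_M: "norm (M *v x) = norm x"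
proof -
  have "(M *v x) \<bullet> (M *v x) = x \<bullet> x"
    by (simp flip: inner_transpose)
  then show ?thesis
    by (simp add: norm_eq_sqrt_inner)
qed

lemma norm_decomposition: "(norm x)\<^sup>2 = (norm (Q x))\<^sup>2 + (norm (transpose M *v x))\<^sup>2"
proof -
  have "Q x \<bullet> (M *v y) = 0" for y
    using Q_in_V[of x] by (simp add: V_def flip: inner_transpose)
  then have "(norm (Q x + M *v (transpose M *v x)))\<^sup>2 = (norm (Q x))\<^sup>2 + (norm (M *v (transpose M *v x)))\<^sup>2"
    by (simp add: norm_add_Pythagorean orthogonal_def)
  then show ?thesis
    by (simp add: norm_M) (simp add: Q_def)
qed

lemma norm_Q_le: "norm (Q x) \<le> norm x"
  by (rule power2_le_imp_le) (simp_all add: norm_decomposition[of x])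

lemma norm_transpose_le: "norm (transpose M *v x) \<le> norm x"
  by (rule power2_le_imp_le) (simp_all add: norm_decomposition[of x])

lemma norm_le_sum: "norm x \<le> norm (Q x) + norm (transpose M *v x)"
proof -
  have "norm x = norm (Q x + M *v (transpose M *v x))"
    by (simp add: Q_def)
  also have "\<dots> \<le> norm (Q x) + norm (transpose M *v x)"
    using norm_triangle_ineq[of "Q x" "M *v (transpose M *v x)"] by (simp add: norm_M)
  finally show ?thesis .
qed

lemma subspace_V: "subspace V"
  by (auto simp: subspace_def V_def matrix_vector_right_distrib matrix_vector_mult_scaleR)

lemma dim_V: "dim V = CARD('m) - CARD('n)"
proof -
  let ?W = "range (\<lambda>x. M *v x)"
  have lin: "linear (\<lambda>x. M *v x)"
    by simp
  have W: "subspace ?W"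
    by (rule linear_subspace_image[OF lin subspace_UNIV])
  have "inj (\<lambda>x. M *v x)"
    by (rule injI) (metis transpose_M_M)
  then have "dim ?W = CARD('n)"
    using dim_image_eq[OF lin, of UNIV] by (simp add: dim_UNIV)
  moreover have "{y \<in> UNIV. \<forall>x\<in>?W. orthogonal x y} = V"
  proof -
    have "(\<forall>x. (M *v x) \<bullet> y = 0) \<longleftrightarrow> transpose M *v y = 0" for y
    proof -
      have "(M *v x) \<bullet> y = x \<bullet> (transpose M *v y)" for x
        by (metis inner_transpose inner_commute)
      then show ?thesis
        by (metis inner_eq_zero_iff inner_zero_right)
    qed
    then show ?thesis
      by (auto simp: V_def orthogonal_def)
  qed
  ultimately show ?thesis
    using dim_subspace_orthogonal_to_vectors[OF W subspace_UNIV] by (simp add: dim_UNIV)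
qed

end

text \<open>The harmonic analysis enters through \<open>almost_periods\<close> alone; the rest of
  the geometry rests on separation and density.\<close>

locale toral_point_set = isometric_embedding M
  for M :: "real ^ 'n ^ 'm" +
  fixes \<Lambda> :: "(real ^ 'n) set"
  assumes delone: "delone \<Lambda>"
    and dense: "closure (range (\<lambda>x. rho (M *v x))) = torus"
    and almost_periods: "e > 0 \<Longrightarrow> \<exists>d>0. \<forall>t k. (\<forall>i. k $ i \<in> \<int>) \<longrightarrow> norm (M *v t - k) < d \<longrightarrow>
      (\<forall>a\<in>\<Lambda>. \<exists>b\<in>\<Lambda>. dist b (a + t) < e)"
begin

definition K :: "(complex ^ 'm) set"
  where "K = closure ((\<lambda>x. rho (M *v x)) ` \<Lambda>)"

definition X :: "(real ^ 'm) set"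
  where "X = rho -` K"

text \<open>Closeness in the torus becomes closeness in the covering space at the price of an
  integer vector. Taking \<open>S\<close> to be the image of \<open>\<Lambda>\<close> describes
  \<open>X\<close>, and taking the image of the whole space describes density.\<close>

lemma rho_lift:
  assumes "S \<subseteq> range (\<lambda>x. rho (M *v x))" "rho p \<in> closure S" "e > 0"
  obtains x k where "rho (M *v x) \<in> S" "\<And>i. k $ i \<in> \<int>" "dist p (M *v x + k) < e"
proof -
  obtain d where d: "d > 0"
    "\<And>x y. \<lbrakk>x \<in> (UNIV :: (real ^ 'm) set); y \<in> torus; dist (rho x) y < d\<rbrakk> \<Longrightarrow> \<exists>x'\<in>UNIV. rho x' = y \<and> dist x x' < e"
    by (fact uniform_covering_liftE[OF uniform_covering_rho assms(3)])
  obtain s where "s \<in> S" "dist s (rho p) < d"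
    using assms(2) d(1) by (auto simp: closure_approachable)
  moreover then obtain x where "s = rho (M *v x)"
    using assms(1) by blast
  ultimately obtain q where q: "rho q = rho (M *v x)" "dist p q < e" and S: "rho (M *v x) \<in> S"
    using d(2)[of p s] by (auto simp: dist_commute)
  show ?thesis
  proof (rule that[OF S])
    show "(q - M *v x) $ i \<in> \<int>" for i
      using q(1) by (simp only: rho_eq_iff)
    show "dist p (M *v x + (q - M *v x)) < e"
      using q(2) by simp
  qed
qed

lemma X_approx:
  assumes "p \<in> X" "e > 0"
  obtains a k where "a \<in> \<Lambda>" "\<And>i. k $ i \<in> \<int>" "dist p (M *v a + k) < e"
proof -
  obtain x k where x: "rho (M *v x) \<in> (\<lambda>x. rho (M *v x)) ` \<Lambda>" "\<And>i. k $ i \<in> \<int>" "dist p (M *v x + k) < e"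
    by (rule rho_lift[of "(\<lambda>x. rho (M *v x)) ` \<Lambda>" p e]) (use assms in \<open>auto simp: X_def K_def\<close>)
  then obtain a where a: "a \<in> \<Lambda>" "rho (M *v x) = rho (M *v a)"
    by blast
  show ?thesis
  proof (rule that[OF a(1)])
    have "(M *v x - M *v a) $ i \<in> \<int>" for i
      using a(2) by (simp only: rho_eq_iff)
    then show "(M *v x - M *v a + k) $ i \<in> \<int>" for i
      using x(2)[of i] by (simp only: vector_add_component Ints_add)
    show "dist p (M *v a + (M *v x - M *v a + k)) < e"
      using x(3) by simp
  qed
qed

lemma in_X: "\<lbrakk>a \<in> \<Lambda>; \<And>i. k $ i \<in> \<int>\<rbrakk> \<Longrightarrow> M *v a + k \<in> X"
proof -
  assume a: "a \<in> \<Lambda>" "\<And>i. k $ i \<in> \<int>"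
  then have "rho (M *v a + k) = rho (M *v a)"
    by (simp add: rho_eq_iff)
  then show ?thesis
    using a(1) closure_subset by (fastforce simp: X_def K_def)
qed

text \<open>Since \<open>Q\<close> annihilates the range of \<open>M\<close>, density of the line
  pattern in the torus turns into density of the projected integer vectors in
  \<open>V\<close>.\<close>

lemma V_approx:
  assumes "v \<in> V" "e > 0"
  obtains k where "\<And>i. k $ i \<in> \<int>" "dist v (Q k) < e"
proof -
  obtain x k where k: "\<And>i. k $ i \<in> \<int>" "dist v (M *v x + k) < e"
    by (rule rho_lift[of "range (\<lambda>x. rho (M *v x))" v e]) (use assms dense in auto)
  have "norm (Q (v - (M *v x + k))) < e"
    using norm_Q_le k(2) by (metis dist_norm order_le_less_trans)
  then have "dist v (Q k) < e"
    using assms(1) by (simp add: Q_diff Q_add Q_ident dist_norm)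
  then show ?thesis
    using that k(1) by blast
qed

lemma K_subset: "K \<subseteq> torus"
  unfolding K_def dense[symmetric] by (intro closure_mono) auto

lemma rho_X: "rho ` X = K"
proof -
  have "K \<subseteq> range rho"
    using K_subset uniform_covering_rho[where 'm = 'm] by (auto simp: uniform_covering_def)
  then show ?thesis
    by (auto simp: X_def)
qed

lemma compact_K: "compact K"
proof -
  have "K = torus \<inter> K"
    using K_subset by blast
  moreover have "compact (torus \<inter> K)"
    by (intro compact_Int_closed compact_torus) (simp add: K_def)
  ultimately show ?thesis
    by simp
qed

lemma closed_X: "closed X"
  unfolding X_def by (rule continuous_closed_vimage)
    (auto simp: K_def intro!: continuous_on_rho[of UNIV "\<lambda>x. x", unfolded continuous_on_eq_continuous_at[OF open_UNIV], rule_format])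

lemma continuous_Q: "continuous_on S Q"
  unfolding Q_def by (intro continuous_intros linear_continuous_on bounded_linear_compose[OF matrix_vector_mul_bounded_linear])
    simp_all

text \<open>Let \<open>M *v a + k\<close> and \<open>M *v a' + k'\<close> approximate
  \<open>p\<close> and \<open>p'\<close>. Equality of \<open>Q p\<close> and \<open>Q p'\<close>
  makes \<open>t = transpose M *v (k' - k)\<close> an almost period, so some \<open>b\<close> in
  \<open>\<Lambda>\<close> is near \<open>a' + t\<close>. As \<open>p\<close> and \<open>p'\<close>
  are close, separation forces \<open>b = a\<close>; then the approximants agree up to small errors
  both along \<open>V\<close> and along the range of \<open>M\<close>.\<close>

lemma X_inj:
  assumes p: "p \<in> X" "p' \<in> X" "Q p = Q p'" and close: "dist p p' < min_separation \<Lambda> / 2"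
  shows "p = p'"
proof -
  define s where "s = min_separation \<Lambda>"
  have "s > 0"
    using delone by (simp add: s_def delone_def)
  have bound: "dist p p' \<le> 5 * e" if "e > 0" for e
  proof -
    \<comment> \<open>The distance from \<open>b\<close> to \<open>a\<close> is below
      \<open>e' + 2 * h + s / 2\<close> with \<open>h \<le> e'\<close>, which is at most
      \<open>s\<close> for \<open>e' \<le> s / 6\<close>.\<close>
    define e' where "e' = min e (s / 6)"
    have e': "e' > 0" "e' \<le> e" "e' \<le> s / 6"
      using that \<open>s > 0\<close> by (auto simp: e'_def)
    obtain d where d: "d > 0" "\<And>t k a. \<lbrakk>\<forall>i. k $ i \<in> \<int>; norm (M *v t - k) < d; a \<in> \<Lambda>\<rbrakk> \<Longrightarrow> \<exists>b\<in>\<Lambda>. dist b (a + t) < e'"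
      using almost_periods[OF e'(1)] by auto
    define h where "h = min e' (d / 2)"
    have h: "h > 0" "h \<le> e'" "2 * h \<le> d"
      using e' d(1) by (auto simp: h_def)
    obtain a k where a: "a \<in> \<Lambda>" "\<And>i. k $ i \<in> \<int>" "dist p (M *v a + k) < h"
      using X_approx[OF p(1) h(1)] by blast
    obtain a' k' where a': "a' \<in> \<Lambda>" "\<And>i. k' $ i \<in> \<int>" "dist p' (M *v a' + k') < h"
      using X_approx[OF p(2) h(1)] by blast
    define q where "q = M *v a + k"
    define q' where "q' = M *v a' + k'"
    define t where "t = transpose M *v (k' - k)"
    have qp: "norm (q - p) < h" "norm (q' - p') < h"
      using a(3) a'(3) by (simp_all add: q_def q'_def dist_norm norm_minus_commute)
    have "Q (q' - q) = Q (q' - p') - Q (q - p)"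
      using p(3) by (simp add: Q_diff)
    then have Qqq: "norm (Q (q' - q)) < 2 * h"
      using norm_triangle_ineq4[of "Q (q' - p')" "Q (q - p)"] norm_Q_le[of "q' - p'"] norm_Q_le[of "q - p"] qp by simp
    have "M *v t - (k' - k) = - Q (q' - q)"
      by (simp add: t_def q_def q'_def Q_diff Q_add) (simp add: Q_def matrix_vector_mult_diff_distrib)
    then have "norm (M *v t - (k' - k)) < d"
      using Qqq h(3) by simp
    moreover have "\<forall>i. (k' - k) $ i \<in> \<int>"
      using a(2) a'(2) by simp
    ultimately obtain b where b: "b \<in> \<Lambda>" "dist b (a' + t) < e'"
      using d(2) a'(1) by blast
    have Mqq: "transpose M *v (q' - q) = a' + t - a"
      by (simp add: q_def q'_def t_def matrix_vector_mult_diff_distrib matrix_vector_right_distrib)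
    have "norm (q' - q) < 2 * h + s / 2"
    proof -
      have "q' - q = (q' - p') - (q - p) - (p - p')"
        by simp
      then have "norm (q' - q) \<le> norm (q' - p') + norm (q - p) + norm (p - p')"
        using norm_triangle_ineq4[of "(q' - p') - (q - p)" "p - p'"] norm_triangle_ineq4[of "q' - p'" "q - p"] by simp
      then show ?thesis
        using qp close by (simp add: dist_norm s_def)
    qed
    then have "dist (a' + t) a < 2 * h + s / 2"
      using norm_transpose_le[of "q' - q"] by (simp add: Mqq dist_norm)
    then have "dist b a < s"
      using b(2) h(2) e'(3) dist_triangle[of b a "a' + t"] by linarith
    then have "b = a"
      using min_separation_less_eq[OF b(1) a(1)] by (auto simp: s_def)
    then have "norm (transpose M *v (q' - q)) < e'"
      using b(2) by (simp add: Mqq dist_norm norm_minus_commute)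
    then have "norm (q' - q) < 3 * e'"
      using norm_le_sum[of "q' - q"] Qqq h(2) by linarith
    moreover have "p' - p = (q' - q) - (q' - p') + (q - p)"
      by simp
    then have "norm (p' - p) \<le> norm (q' - q) + norm (q' - p') + norm (q - p)"
      using norm_triangle_ineq[of "(q' - q) - (q' - p')" "q - p"] norm_triangle_ineq4[of "q' - q" "q' - p'"] by simp
    ultimately show ?thesis
      using qp h(2) e'(2) by (simp add: dist_norm norm_minus_commute)
  qed
  have "dist p p' \<le> 0"
  proof (rule field_le_epsilon)
    fix e :: real assume "e > 0"
    then show "dist p p' \<le> 0 + e"
      using bound[of "e / 5"] by simp
  qed
  then show ?thesis
    by simp
qed

text \<open>Almost periods only produce points of \<open>X\<close> near \<open>p\<close> whose
  projections come arbitrarily close to \<open>v\<close>. Compactness of the part of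
  \<open>X\<close> in a closed ball turns these into an exact lift.\<close>

lemma X_lift:
  assumes e: "e > 0"
  shows "\<exists>d>0. \<forall>p\<in>X. \<forall>v\<in>V. dist (Q p) v < d \<longrightarrow> (\<exists>p'\<in>X. Q p' = v \<and> dist p p' < e)"
proof -
  have e4: "e / 4 > 0"
    using e by simp
  obtain d where d: "d > 0" "\<And>t k a. \<lbrakk>\<forall>i. k $ i \<in> \<int>; norm (M *v t - k) < d; a \<in> \<Lambda>\<rbrakk> \<Longrightarrow> \<exists>b\<in>\<Lambda>. dist b (a + t) < e / 4"
    using almost_periods[OF e4] by auto
  \<comment> \<open>Chosen so that \<open>3 * D < d\<close>, which makes \<open>t\<close> an almost
    period, and \<open>4 * D + e / 4 \<le> e / 2\<close>, which keeps \<open>z\<close> in the closed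
    ball.\<close>
  define D where "D = min d e / 16"
  have D: "D > 0" "3 * D < d" "16 * D \<le> e"
    using d(1) e by (auto simp: D_def)
  have "\<exists>p'\<in>X. Q p' = v \<and> dist p p' < e" if p: "p \<in> X" and v: "v \<in> V" and pv: "dist (Q p) v < D" for p v
  proof -
    let ?C = "X \<inter> cball p (e / 2)"
    have "v \<in> closure (Q ` ?C)"
      unfolding closure_approachable
    proof (intro allI impI)
      fix \<eta> :: real assume "\<eta> > 0"
      define h where "h = min \<eta> D"
      have h: "h > 0" "h \<le> \<eta>" "h \<le> D"
        using \<open>\<eta> > 0\<close> D(1) by (auto simp: h_def)
      obtain a k where a: "a \<in> \<Lambda>" "\<And>i. k $ i \<in> \<int>" "dist p (M *v a + k) < D"
        using X_approx[OF p D(1)] by blast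
      obtain k' where k': "\<And>i. k' $ i \<in> \<int>" "dist v (Q k') < h"
        using V_approx[OF v h(1)] by blast
      define q where "q = M *v a + k"
      define t where "t = transpose M *v (k - k')"
      have qp: "norm (q - p) < D"
        using a(3) by (simp add: q_def dist_norm norm_minus_commute)
      have eq: "Q k - Q k' = Q (q - p) + (Q p - v) + (v - Q k')"
        by (simp add: q_def Q_diff Q_add)
      have "norm (Q k - Q k') \<le> norm (Q (q - p)) + norm (Q p - v) + norm (v - Q k')"
        unfolding eq using norm_triangle_ineq[of "Q (q - p) + (Q p - v)" "v - Q k'"] norm_triangle_ineq[of "Q (q - p)" "Q p - v"] by linarith
      then have Qkk: "norm (Q k - Q k') < 3 * D"
        using norm_Q_le[of "q - p"] qp pv k'(2) h(3) by (simp add: dist_norm)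
      have "M *v t - (k - k') = - (Q k - Q k')"
        by (simp add: t_def Q_def matrix_vector_mult_diff_distrib)
      then have "norm (M *v t - (k - k')) < d"
        using Qkk D(2) by (simp only: norm_minus_cancel)
      moreover have "\<forall>i. (k - k') $ i \<in> \<int>"
        using a(2) k'(1) by simp
      ultimately obtain b where b: "b \<in> \<Lambda>" "dist b (a + t) < e / 4"
        using d(2) a(1) by blast
      \<comment> \<open>Replacing \<open>k\<close> by \<open>k'\<close> brings the projection close
        to \<open>v\<close>; the displacement this causes along the range of \<open>M\<close> is
        \<open>M *v t\<close> up to sign, and passing from \<open>a\<close> to \<open>b\<close> near
        \<open>a + t\<close> compensates for it.\<close>
      define z where "z = M *v b + k'"
      have "z \<in> X"
        unfolding z_def using b(1) k'(1) by (rule in_X)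
      have "transpose M *v (z - q) = b - (a + t)"
        by (simp add: z_def q_def t_def matrix_vector_mult_diff_distrib matrix_vector_right_distrib)
      moreover have "Q (z - q) = Q k' - Q k"
        by (simp add: z_def q_def Q_diff Q_add)
      ultimately have "norm (z - q) \<le> norm (Q k' - Q k) + norm (b - (a + t))"
        using norm_le_sum[of "z - q"] by simp
      then have "norm (z - q) < 3 * D + e / 4"
        using Qkk b(2) unfolding dist_norm norm_minus_commute[of "Q k'" "Q k"] by linarith
      then have "norm (z - p) < 4 * D + e / 4"
        using qp norm_triangle_ineq[of "z - q" "q - p"] by simp
      then have "z \<in> ?C"
        using \<open>z \<in> X\<close> D(3) by (simp add: dist_norm norm_minus_commute)
      moreover have "dist (Q z) v < \<eta>"
        using k'(2) h(2) by (simp add: z_def Q_add dist_commute)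
      ultimately show "\<exists>y\<in>Q ` ?C. dist y v < \<eta>"
        by blast
    qed
    moreover have "compact (Q ` ?C)"
      by (intro compact_continuous_image continuous_Q closed_Int_compact closed_X compact_cball)
    ultimately have "v \<in> Q ` ?C"
      by (simp add: compact_imp_closed)
    then show ?thesis
      using e by auto
  qed
  then show ?thesis
    using D(1) by blast
qed

lemma uniform_covering_Q: "uniform_covering X Q V"
proof (rule uniform_covering_surjI)
  show "continuous_on X Q"
    by (rule continuous_Q)
  show "Q ` X \<subseteq> V"
    using Q_in_V by blast
  have "\<Lambda> \<noteq> {}"
    using delone by (auto simp: delone_def)
  then obtain a where "a \<in> \<Lambda>"
    by blast
  then show "X \<noteq> {}"
    using in_X[of a 0] by auto
  show "connected V"
    using subspace_V by (intro convex_connected subspace_imp_convex)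
  have "min_separation \<Lambda> / 2 > 0"
    using delone by (simp add: delone_def)
  then show "\<exists>r>0. \<forall>x\<in>X. \<forall>x'\<in>X. Q x = Q x' \<longrightarrow> dist x x' < r \<longrightarrow> x = x'"
    using X_inj by blast
qed (rule X_lift)

text \<open>Lifting the identity of the simply connected \<open>V\<close> through \<open>Q\<close>,
  starting at a preimage \<open>p\<close> of a point of \<open>Kc\<close>, gives the sheet through
  \<open>p\<close>. Its image in the torus is connected and clopen in \<open>K\<close> and meets
  \<open>Kc\<close>, so it is all of \<open>Kc\<close>.\<close>

lemma component_of_closure:
  assumes "Kc \<in> components K"
  obtains \<sigma> where "torus_cover_section X V Q \<sigma>" "Kc = torus_cover_section.\<pi> \<sigma> ` V"
proof -
  obtain a where a: "a \<in> Kc"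
    using assms in_components_nonempty by blast
  then have "a \<in> rho ` X"
    using assms in_components_subset rho_X by blast
  then obtain p where p: "p \<in> X" "a = rho p"
    by blast
  have convex: "convex V"
    using subspace_V by (rule subspace_imp_convex)
  have id: "continuous_on V (\<lambda>v. v)" "(\<lambda>v. v) \<in> V \<rightarrow> V"
    by auto
  obtain \<sigma> where \<sigma>: "continuous_on V \<sigma>" "\<sigma> \<in> V \<rightarrow> X" "\<sigma> (Q p) = p" "\<And>v. v \<in> V \<Longrightarrow> Q (\<sigma> v) = v"
    using covering_space_lift_strong[OF uniform_covering_imp_covering_space[OF uniform_covering_Q] p(1) Q_in_V
        convex_imp_simply_connected[OF convex] convex_imp_locally_path_connected[OF convex] id refl] by blast
  have sect: "torus_cover_section X V Q \<sigma>"
  proof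
    show "y \<in> X" if "x \<in> X" "rho y = rho x" for x y
      using that by (simp add: X_def)
  qed (use \<sigma> subspace_V Q_diff Q_in_V norm_Q_le uniform_covering_Q in auto)
  then interpret torus_cover_section X V Q \<sigma> .
  have "Kc = \<pi> ` V"
  proof (rule clopen_connected_eq_component[OF assms])
    show "connected (\<pi> ` V)"
      by (intro connected_continuous_image continuous_\<pi> convex_connected convex)
    show "openin (top_of_set K) (\<pi> ` V)" "closedin (top_of_set K) (\<pi> ` V)"
      using clopen_image by (simp_all only: rho_X)
    have "a = \<pi> (Q p)"
      by (simp add: \<pi>_def \<sigma>(3) p(2))
    then show "Kc \<inter> \<pi> ` V \<noteq> {}"
      using a Q_in_V by blast
  qed
  then show ?thesis
    using that sect by blast
qed

end

theorem theorem4: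
  fixes \<Lambda> :: "(real ^ 'n) set"
    and M :: "real ^ 'n ^ 'm"
    and \<psi> :: "real ^ 'n \<Rightarrow> complex ^ 'm"
    and K Kc :: "(complex ^ 'm) set"
  assumes "CARD('m) > CARD('n)"
    and "delone \<Lambda>"
    and "bohr_almost_periodic \<Lambda>"
    and "toral_type \<Lambda>"
    and "toral_compactification \<psi>"
    and "\<psi> = rho \<circ> (\<lambda>x. M *v x)"
    and "associated_with M \<Lambda>"
    and "transpose M ** M = mat 1"
    and "K = closure (\<psi> ` \<Lambda>)"
    and "Kc \<in> components K"
  shows "top_of_set Kc homeomorphic_space torus_space (CARD('m) - CARD('n)) \<and>
    (\<forall>a\<in>Kc. fundamental_group_map torus id a
       \<in> mon (fundamental_group Kc a) (fundamental_group torus a))"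
proof -
  have \<psi>: "\<psi> = (\<lambda>x. rho (M *v x))"
    using assms(6) by (simp add: o_def)
  interpret T: toral_point_set M \<Lambda>
  proof
    show "closure (range (\<lambda>x. rho (M *v x))) = torus"
      using assms(5) by (simp add: toral_compactification_def \<psi>)
    fix e :: real assume "e > 0"
    obtain d where d: "d > 0" "\<And>t k a. \<lbrakk>\<And>i. k $ i \<in> \<int>; norm (M *v t - k) < d; a \<in> \<Lambda>\<rbrakk> \<Longrightarrow> \<exists>b\<in>\<Lambda>. dist b (a + t) < e"
      by (fact delone_almost_periods[OF assms(2,3,7) \<open>e > 0\<close>])
    show "\<exists>d>0. \<forall>t k. (\<forall>i. k $ i \<in> \<int>) \<longrightarrow> norm (M *v t - k) < d \<longrightarrow> (\<forall>a\<in>\<Lambda>. \<exists>b\<in>\<Lambda>. dist b (a + t) < e)"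
      by (intro exI[of _ d] conjI allI impI ballI d)  auto
  qed (fact assms)+
  have "Kc \<in> components T.K"
    using assms(9,10) by (simp add: T.K_def \<psi>)
  then obtain \<sigma> where "torus_cover_section T.X T.V T.Q \<sigma>" and Kc: "Kc = torus_cover_section.\<pi> \<sigma> ` T.V"
    by (rule T.component_of_closure)
  then interpret S: torus_cover_section T.X T.V T.Q \<sigma>
    by simp
  \<comment> \<open>Closedness in the compact set \<open>T.K\<close> makes the component compact,
    which is what forces the periods to span \<open>T.V\<close>.\<close>
  have "closedin (top_of_set T.K) Kc"
    using S.clopen_image(2) by (simp add: Kc T.rho_X)
  then have "compact (S.\<pi> ` T.V)"
    using T.compact_K closedin_compact Kc by blast
  then show ?thesis
    using S.homeomorphic_torus_space S.fundamental_group_mono by (simp add: Kc T.dim_V)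
qed

end
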